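(* Let $(\mathbb{X},\mathbb{Y},\mathbb{A},P,Q,c)$ be a POMDP and let $\alpha$ be a discount factor. Suppose that either Assumption (D) or Assumption (P) holds, that the function $c$ is $\mathbb{K}$-inf-compact on $\mathbb{X}\times\mathbb{A}$, that the stochastic kernel $P(dx'|x,a)$ on $\mathbb{X}$ given $\mathbb{X}\times\mathbb{A}$ is weakly continuous, and that the stochastic kernel $Q(dy|a,x)$ on $\mathbb{Y}$ given $\mathbb{A}\times\mathbb{X}$ is continuous in the total variation. Then the COMDP $(\mathbb{P}(\mathbb{X}),\mathbb{A},q,\bar c)$ satisfies Assumption (W* ), and therefore it has the optimality properties (O1)--(O6).
   Context: Notation. $\overline{\mathbb{R}}=\mathbb{R}\cup\{+\infty\}$. For a metric space $\mathbb{S}$, $\mathcal{B}(\mathbb{S})$ is its Borel $\sigma$-field and $\mathbb{P}(\mathbb{S})$ is the set of probability measures on $(\mathbb{S},\mathcal{B}(\mathbb{S}))$, endowed with the topology of weak convergence. Measures $\mu^{(n)}$ converge to $\mu$ in the total variation if $\sup\{\int f\,d\mu^{(n)}-\int f\,d\mu: f:\mathbb{S}\to[-1,1]\text{ Borel}\}\to0$. A stochastic kernel $T(ds_1|s_2)$ on $\mathbb{S}_1$ given $\mathbb{S}_2$ is a map such that $T(\cdot|s_2)\in\mathbb{P}(\mathbb{S}_1)$ for each $s_2$ and $T(B|\cdot)$ is Borel for each $B\in\mathcal{B}(\mathbb{S}_1)$; it is weakly continuous (continuous in the total variation) if $s_2^{(n)}\to s_2$ implies $T(\cdot|s_2^{(n)})\to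 T(\cdot|s_2)$ weakly (in the total variation). POMDP. A POMDP $(\mathbb{X},\mathbb{Y},\mathbb{A},P,Q,c)$ consists of nonempty Borel subsets $\mathbb{X}$ (states), $\mathbb{Y}$ (observations), $\mathbb{A}$ (actions) of Polish spaces, a stochastic kernel $P(dx'|x,a)$ on $\mathbb{X}$ given $\mathbb{X}\times\mathbb{A}$, a stochastic kernel $Q(dy|a,x)$ on $\mathbb{Y}$ given $\mathbb{A}\times\mathbb{X}$, and a bounded below Borel function $c:\mathbb{X}\times\mathbb{A}\to\overline{\mathbb{R}}$. Assumption (D): $c$ is bounded below on $\mathbb{X}\times\mathbb{A}$ and $\alpha\in[0,1)$. Assumption (P): $c$ is nonnegative on $\mathbb{X}\times\mathbb{A}$ and $\alpha\in[0,1]$. Inf-compactness. A function $f:\mathbb{S}_1\times\mathbb{S}_2\to\overline{\mathbb{R}}$ ($\mathbb{S}_1,\mathbb{S}_2$ metric spaces) is inf-compact if $\{f\le\lambda\}$ is compact for every $\lambda\in\mathbb{R}$ (similarly for functions on a single metric space); it is $\mathbb{K}$-inf-compact on $\mathbb{S}_1\times\mathbb{S}_2$ if for every compact $K\subseteq\mathbb{S}_1$ its restriction to $K\times\mathbb{S}_2$ is inf-compact. Filtering. For $z\in\mathbb{P}(\mathbb{X})$, $a\in\mathbb{A}$, $B\in\mathcal{B}(\mathbb{X})$, $C\in\mathcal{B}(\mathbb{Y})$ let $R(B\times C|z,a)=\int_{\mathbb{X}}\int_B Q(C|a,x')P(dx'|x,a)z(dx)$, which defines a stochastic kernel on $\mathbb{X}\times\mathbb{Y}$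 given $\mathbb{P}(\mathbb{X})\times\mathbb{A}$, and let $R'(C|z,a)=R(\mathbb{X}\times C|z,a)$. There exists a stochastic kernel $H(dx|z,a,y)$ on $\mathbb{X}$ given $\mathbb{P}(\mathbb{X})\times\mathbb{A}\times\mathbb{Y}$ such that $R(B\times C|z,a)=\int_C H(B|z,a,y)R'(dy|z,a)$ for all $B,C,z,a$. Write $H(z,a,y)=H(\cdot|z,a,y)\in\mathbb{P}(\mathbb{X})$. Define the stochastic kernel $q$ on $\mathbb{P}(\mathbb{X})$ given $\mathbb{P}(\mathbb{X})\times\mathbb{A}$ by $q(D|z,a)=\int_{\mathbb{Y}}\mathbf{1}\{H(z,a,y)\in D\}R'(dy|z,a)$, $D\in\mathcal{B}(\mathbb{P}(\mathbb{X}))$; it does not depend on the choice of such $H$. COMDP. The COMDP $(\mathbb{P}(\mathbb{X}),\mathbb{A},q,\bar c)$ is the Markov decision process with state space $\mathbb{P}(\mathbb{X})$, action set $\mathbb{A}$ at every state, transition kernel $q$ and one-step cost $\bar c(z,a)=\int_{\mathbb{X}}c(x,a)z(dx)$. An $I$-policy is a sequence $\delta=\{\delta_t\}_{t\ge0}$ of stochastic kernels $\delta_t$ on $\mathbb{A}$ given $\mathbb{P}(\mathbb{X})\times(\mathbb{A}\times\mathbb{P}(\mathbb{X}))^t$ (histories $z_0,a_0,\dots,z_t$); it is Markov if it is given by Borel maps $\phi_t:\mathbb{P}(\mathbb{X})\to\mathbb{A}$ with $a_t=\phi_t(z_t)$, and stationary if moreover $\phi_t=\phi$ does not depend on $t$.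 For $T\in\{0,1,\dots\}\cup\{\infty\}$, $\bar v^{\delta}_{T,\alpha}(z)=\mathbb{E}^\delta_z\sum_{t=0}^{T-1}\alpha^t\bar c(z_t,a_t)$ with $z_0=z$, $\bar v_{T,\alpha}(z)=\inf_\delta\bar v^\delta_{T,\alpha}(z)$, and the subscript $T$ is dropped if $T=\infty$; $\bar v_{0,\alpha}=0$. A policy is $T$-horizon optimal (discount-optimal) if it attains the infimum for all $z$, for horizon $T$ (for $T=\infty$). Assumption (W* ) for the COMDP: $\bar c$ is $\mathbb{K}$-inf-compact on $\mathbb{P}(\mathbb{X})\times\mathbb{A}$, and $q(\cdot|z,a)$ is weakly continuous in $(z,a)\in\mathbb{P}(\mathbb{X})\times\mathbb{A}$. Optimality properties of the COMDP: (O1) $\bar v_{t,\alpha}$, $t=0,1,\dots$, and $\bar v_\alpha$ are lower semi-continuous on $\mathbb{P}(\mathbb{X})$, and $\bar v_{t,\alpha}(z)\to\bar v_\alpha(z)$ as $t\to\infty$ for all $z$. (O2) For all $z\in\mathbb{P}(\mathbb{X})$, $t=0,1,\dots$: $\bar v_{t+1,\alpha}(z)=\min_{a\in\mathbb{A}}\{\bar c(z,a)+\alpha\int\bar v_{t,\alpha}(z')q(dz'|z,a)\}=\min_{a\in\mathbb{A}}\{\int_{\mathbb{X}}c(x,a)z(dx)+\alpha\int_{\mathbb{X}}\int_{\mathbb{X}}\int_{\mathbb{Y}}\bar v_{t,\alpha}(H(z,a,y))Q(dy|a,x')P(dx'|x,a)z(dx)\}$; and the nonempty sets $A_{t,\alpha}(z)=\{a\in\mathbb{A}:\bar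 v_{t+1,\alpha}(z)=\bar c(z,a)+\alpha\int\bar v_{t,\alpha}(z')q(dz'|z,a)\}$ satisfy: the graph $\{(z,a):a\in A_{t,\alpha}(z)\}$ is a Borel subset of $\mathbb{P}(\mathbb{X})\times\mathbb{A}$; $A_{t,\alpha}(z)=\mathbb{A}$ if $\bar v_{t+1,\alpha}(z)=+\infty$, and $A_{t,\alpha}(z)$ is compact if $\bar v_{t+1,\alpha}(z)<+\infty$. (O3) For each $T=1,2,\dots$ there is an optimal Markov $T$-horizon $I$-policy $(\phi_0,\dots,\phi_{T-1})$; and any $T$-horizon Markov $I$-policy with $\phi_{T-1-t}(z)\in A_{t,\alpha}(z)$ for all $z$ and $t=0,\dots,T-1$ is $T$-horizon optimal. (O4) For all $z\in\mathbb{P}(\mathbb{X})$: $\bar v_\alpha(z)=\min_{a\in\mathbb{A}}\{\bar c(z,a)+\alpha\int\bar v_\alpha(z')q(dz'|z,a)\}=\min_{a\in\mathbb{A}}\{\int_{\mathbb{X}}c(x,a)z(dx)+\alpha\int_{\mathbb{X}}\int_{\mathbb{X}}\int_{\mathbb{Y}}\bar v_\alpha(H(z,a,y))Q(dy|a,x')P(dx'|x,a)z(dx)\}$; and the nonempty sets $A_\alpha(z)=\{a\in\mathbb{A}:\bar v_\alpha(z)=\bar c(z,a)+\alpha\int\bar v_\alpha(z')q(dz'|z,a)\}$ satisfy: the graph $\{(z,a):a\in A_\alpha(z)\}$ is a Borel subset of $\mathbb{P}(\mathbb{X})\times\mathbb{A}$; $A_\alpha(z)=\mathbb{A}$ if $\bar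 v_\alpha(z)=+\infty$, and $A_\alpha(z)$ is compact if $\bar v_\alpha(z)<+\infty$. (O5) For the infinite horizon there is a stationary discount-optimal $I$-policy, and a stationary $I$-policy $\phi$ is optimal if and only if $\phi(z)\in A_\alpha(z)$ for all $z\in\mathbb{P}(\mathbb{X})$. (O6) If $\bar c$ is inf-compact on $\mathbb{P}(\mathbb{X})\times\mathbb{A}$, then $\bar v_{t,\alpha}$, $t=1,2,\dots$, and $\bar v_\alpha$ are inf-compact on $\mathbb{P}(\mathbb{X})$. *)

theory Defs
  imports "HOL-Probability.Probability"
begin

section \<open>Measures and functions on topological spaces\<close>

text \<open>
  Metric spaces enter only through their topologies, so they are represented by values of type
  \<^typ>\<open>'a topology\<close>: a subset \<open>X\<close> of a Polish space is \<open>top_of_set X\<close>, and a set of probability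
  measures carries the topology of weak convergence.
\<close>

definition borel_of :: "'a topology \<Rightarrow> 'a measure" where
  "borel_of T = sigma (topspace T) {U. openin T U}"

definition prob_measures :: "'a topology \<Rightarrow> 'a measure set" where
  "prob_measures T = {\<mu>. prob_space \<mu> \<and> sets \<mu> = sets (borel_of T)}"

definition weak_topology :: "'a topology \<Rightarrow> 'a measure topology" where
  "weak_topology T = topology_generated_by
     {{\<mu> \<in> prob_measures T. (\<integral>s. f s \<partial>\<mu>) \<in> U} | f U.
        continuous_map T euclideanreal f \<and> bounded (f ` topspace T) \<and> open U}"

text \<open>Only used for probability measures \<open>\<mu>\<close> and \<open>\<nu>\<close> on \<open>T\<close>, where the set of reals below is bounded.\<close>

definition tv_gap :: "'a topology \<Rightarrow> 'a measure \<Rightarrow> 'a measure \<Rightarrow> real" where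
  "tv_gap T \<mu> \<nu> =
     (SUP f \<in> {f \<in> borel_measurable (borel_of T). f ` topspace T \<subseteq> {-1..1}}.
        (\<integral>s. f s \<partial>\<mu>) - (\<integral>s. f s \<partial>\<nu>))"

text \<open>A kernel on \<open>T1\<close> given \<open>T2\<close>.\<close>

definition stochastic_kernel :: "'a topology \<Rightarrow> 'b topology \<Rightarrow> ('b \<Rightarrow> 'a measure) \<Rightarrow> bool" where
  "stochastic_kernel T1 T2 K \<longleftrightarrow>
     (\<forall>s \<in> topspace T2. K s \<in> prob_measures T1) \<and>
     (\<forall>B \<in> sets (borel_of T1). (\<lambda>s. measure (K s) B) \<in> borel_measurable (borel_of T2))"

definition weakly_continuous :: "'a topology \<Rightarrow> 'b topology \<Rightarrow> ('b \<Rightarrow> 'a measure) \<Rightarrow> bool" where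
  "weakly_continuous T1 T2 K \<longleftrightarrow>
     (\<forall>s s0. range s \<subseteq> topspace T2 \<and> limitin T2 s s0 sequentially \<longrightarrow>
        limitin (weak_topology T1) (\<lambda>n. K (s n)) (K s0) sequentially)"

definition tv_continuous :: "'a topology \<Rightarrow> 'b topology \<Rightarrow> ('b \<Rightarrow> 'a measure) \<Rightarrow> bool" where
  "tv_continuous T1 T2 K \<longleftrightarrow>
     (\<forall>s s0. range s \<subseteq> topspace T2 \<and> limitin T2 s s0 sequentially \<longrightarrow>
        (\<lambda>n. tv_gap T1 (K (s n)) (K s0)) \<longlonglongrightarrow> 0)"

definition inf_compact :: "'a topology \<Rightarrow> ('a \<Rightarrow> ereal) \<Rightarrow> bool" where
  "inf_compact T f \<longleftrightarrow> (\<forall>r::real. compactin T {s \<in> topspace T. f s \<le> ereal r})"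

definition K_inf_compact :: "'a topology \<Rightarrow> 'b topology \<Rightarrow> ('a \<times> 'b \<Rightarrow> ereal) \<Rightarrow> bool" where
  "K_inf_compact T1 T2 f \<longleftrightarrow>
     (\<forall>K. compactin T1 K \<longrightarrow>
        inf_compact (subtopology (prod_topology T1 T2) (K \<times> topspace T2)) f)"

definition lower_semicontinuous :: "'a topology \<Rightarrow> ('a \<Rightarrow> ereal) \<Rightarrow> bool" where
  "lower_semicontinuous T f \<longleftrightarrow> (\<forall>r::ereal. openin T {s \<in> topspace T. r < f s})"

text \<open>
  The integral of an extended real function whose negative part has a finite integral, which is
  the case below because all integrands are bounded below and all measures are probability
  measures. The conversion \<^const>\<open>e2ennreal\<close> sends negative numbers to \<open>0\<close>, so the two terms are
  the integrals of the positive and of the negative part.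
\<close>

definition ereal_integral :: "'a measure \<Rightarrow> ('a \<Rightarrow> ereal) \<Rightarrow> ereal" where
  "ereal_integral \<mu> f =
     enn2ereal (\<integral>\<^sup>+s. e2ennreal (f s) \<partial>\<mu>) - enn2ereal (\<integral>\<^sup>+s. e2ennreal (- f s) \<partial>\<mu>)"

definition is_attained_min :: "'a set \<Rightarrow> ('a \<Rightarrow> ereal) \<Rightarrow> ereal \<Rightarrow> bool" where
  "is_attained_min D f m \<longleftrightarrow> (\<exists>a \<in> D. f a = m) \<and> (\<forall>a \<in> D. m \<le> f a)"


section \<open>Markov decision processes\<close>

text \<open>
  Throughout, \<open>S\<close> is the state space, \<open>A\<close> the set of actions (all available at every state),
  \<open>q\<close> the transition kernel, \<open>c\<close> the one-step cost and \<open>\<alpha>\<close> the discount factor.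
  The history \<open>s\<^sub>0, a\<^sub>0, \<dots>, s\<^sub>t\<close> is encoded as \<open>(h, s\<^sub>t)\<close> with \<open>h i = (s\<^sub>i, a\<^sub>i)\<close> for \<open>i < t\<close>.
\<close>

type_synonym ('s, 'a) policy = "nat \<Rightarrow> (nat \<Rightarrow> 's \<times> 'a) \<times> 's \<Rightarrow> 'a measure"

definition policies :: "'s topology \<Rightarrow> 'a topology \<Rightarrow> ('s, 'a) policy set" where
  "policies S A = {\<delta>. \<forall>t. stochastic_kernel A
     (prod_topology (product_topology (\<lambda>_. prod_topology S A) {0..<t}) S) (\<delta> t)}"

definition markov_policy :: "'a topology \<Rightarrow> (nat \<Rightarrow> 's \<Rightarrow> 'a) \<Rightarrow> ('s, 'a) policy" where
  "markov_policy A \<phi> t = (\<lambda>(h, s). return (borel_of A) (\<phi> t s))"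

definition step_law :: "'s topology \<Rightarrow> 'a topology \<Rightarrow> ('s \<times> 'a \<Rightarrow> 's measure) \<Rightarrow> ('s, 'a) policy \<Rightarrow>
    's \<Rightarrow> nat \<Rightarrow> (nat \<Rightarrow> 's \<times> 'a) \<Rightarrow> ('s \<times> 'a) measure" where
  "step_law S A q \<delta> s0 t h =
     (case t of 0 \<Rightarrow> return (borel_of S) s0 | Suc u \<Rightarrow> q (h u)) \<bind>
     (\<lambda>s. distr (\<delta> t (h, s)) (borel_of S \<Otimes>\<^sub>M borel_of A) (Pair s))"

text \<open>The law of \<open>(s\<^sub>t, a\<^sub>t)\<^sub>t\<close> under \<open>\<delta>\<close> started in \<open>s0\<close>, by the Ionescu-Tulcea theorem.\<close>

definition strategic_measure :: "'s topology \<Rightarrow> 'a topology \<Rightarrow> ('s \<times> 'a \<Rightarrow> 's measure) \<Rightarrow>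
    ('s, 'a) policy \<Rightarrow> 's \<Rightarrow> (nat \<Rightarrow> 's \<times> 'a) measure" where
  "strategic_measure S A q \<delta> s0 =
     projective_family.lim UNIV
       (Ionescu_Tulcea.CI (step_law S A q \<delta> s0) (\<lambda>_. borel_of S \<Otimes>\<^sub>M borel_of A))
       (\<lambda>_. borel_of S \<Otimes>\<^sub>M borel_of A)"

definition total_cost :: "('s \<times> 'a \<Rightarrow> ereal) \<Rightarrow> real \<Rightarrow> enat \<Rightarrow> (nat \<Rightarrow> 's \<times> 'a) \<Rightarrow> ereal" where
  "total_cost c \<alpha> T \<omega> = (\<Sum>t. if enat t < T then ereal (\<alpha> ^ t) * c (\<omega> t) else 0)"

definition policy_value :: "'s topology \<Rightarrow> 'a topology \<Rightarrow> ('s \<times> 'a \<Rightarrow> 's measure) \<Rightarrow>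
    ('s \<times> 'a \<Rightarrow> ereal) \<Rightarrow> real \<Rightarrow> enat \<Rightarrow> ('s, 'a) policy \<Rightarrow> 's \<Rightarrow> ereal" where
  "policy_value S A q c \<alpha> T \<delta> s =
     ereal_integral (strategic_measure S A q \<delta> s) (total_cost c \<alpha> T)"

definition opt_value :: "'s topology \<Rightarrow> 'a topology \<Rightarrow> ('s \<times> 'a \<Rightarrow> 's measure) \<Rightarrow>
    ('s \<times> 'a \<Rightarrow> ereal) \<Rightarrow> real \<Rightarrow> enat \<Rightarrow> 's \<Rightarrow> ereal" where
  "opt_value S A q c \<alpha> T s = (INF \<delta> \<in> policies S A. policy_value S A q c \<alpha> T \<delta> s)"

definition optimal_policy :: "'s topology \<Rightarrow> 'a topology \<Rightarrow> ('s \<times> 'a \<Rightarrow> 's measure) \<Rightarrow>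
    ('s \<times> 'a \<Rightarrow> ereal) \<Rightarrow> real \<Rightarrow> enat \<Rightarrow> ('s, 'a) policy \<Rightarrow> bool" where
  "optimal_policy S A q c \<alpha> T \<delta> \<longleftrightarrow> \<delta> \<in> policies S A \<and>
     (\<forall>s \<in> topspace S. policy_value S A q c \<alpha> T \<delta> s = opt_value S A q c \<alpha> T s)"

text \<open>
  For finite \<open>T\<close> these are the actions attaining the minimum in the optimality equation that
  expresses the value of horizon \<open>T + 1\<close> through that of horizon \<open>T\<close>; since \<open>eSuc \<infinity> = \<infinity>\<close>,
  \<open>T = \<infinity>\<close> gives the infinite-horizon case.
\<close>

definition opt_actions :: "'s topology \<Rightarrow> 'a topology \<Rightarrow> ('s \<times> 'a \<Rightarrow> 's measure) \<Rightarrow>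
    ('s \<times> 'a \<Rightarrow> ereal) \<Rightarrow> real \<Rightarrow> enat \<Rightarrow> 's \<Rightarrow> 'a set" where
  "opt_actions S A q c \<alpha> T s = {a \<in> topspace A. opt_value S A q c \<alpha> (eSuc T) s =
     c (s, a) + ereal \<alpha> * ereal_integral (q (s, a)) (opt_value S A q c \<alpha> T)}"

definition assumption_W :: "'s topology \<Rightarrow> 'a topology \<Rightarrow> ('s \<times> 'a \<Rightarrow> 's measure) \<Rightarrow>
    ('s \<times> 'a \<Rightarrow> ereal) \<Rightarrow> bool" where
  "assumption_W S A q c \<longleftrightarrow> K_inf_compact S A c \<and> weakly_continuous S (prod_topology S A) q"


section \<open>Partially observable Markov decision processes\<close>

record ('x, 'y, 'a) pomdp =
  state_set :: "'x set"
  obs_set :: "'y set"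
  action_set :: "'a set"
  trans_kernel :: "'x \<times> 'a \<Rightarrow> 'x measure"
  obs_kernel :: "'a \<times> 'x \<Rightarrow> 'y measure"
  cost :: "'x \<times> 'a \<Rightarrow> ereal"

abbreviation state_top :: "('x::topological_space, 'y, 'a) pomdp \<Rightarrow> 'x topology" where
  "state_top M \<equiv> top_of_set (state_set M)"

abbreviation obs_top :: "('x, 'y::topological_space, 'a) pomdp \<Rightarrow> 'y topology" where
  "obs_top M \<equiv> top_of_set (obs_set M)"

abbreviation action_top :: "('x, 'y, 'a::topological_space) pomdp \<Rightarrow> 'a topology" where
  "action_top M \<equiv> top_of_set (action_set M)"

abbreviation belief_top :: "('x::topological_space, 'y, 'a) pomdp \<Rightarrow> 'x measure topology" where
  "belief_top M \<equiv> weak_topology (state_top M)"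

definition cost_bounded_below :: "('x, 'y, 'a) pomdp \<Rightarrow> bool" where
  "cost_bounded_below M \<longleftrightarrow> (\<exists>b::real. \<forall>x \<in> state_set M. \<forall>a \<in> action_set M. ereal b \<le> cost M (x, a))"

definition is_pomdp :: "('x::polish_space, 'y::polish_space, 'a::polish_space) pomdp \<Rightarrow> bool" where
  "is_pomdp M \<longleftrightarrow>
     state_set M \<in> sets borel \<and> state_set M \<noteq> {} \<and>
     obs_set M \<in> sets borel \<and> obs_set M \<noteq> {} \<and>
     action_set M \<in> sets borel \<and> action_set M \<noteq> {} \<and>
     stochastic_kernel (state_top M) (prod_topology (state_top M) (action_top M)) (trans_kernel M) \<and>
     stochastic_kernel (obs_top M) (prod_topology (action_top M) (state_top M)) (obs_kernel M) \<and>
     cost M \<in> borel_measurable (borel_of (prod_topology (state_top M) (action_top M))) \<and>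
     cost_bounded_below M"

definition assumption_D :: "('x, 'y, 'a) pomdp \<Rightarrow> real \<Rightarrow> bool" where
  "assumption_D M \<alpha> \<longleftrightarrow> cost_bounded_below M \<and> 0 \<le> \<alpha> \<and> \<alpha> < 1"

definition assumption_P :: "('x, 'y, 'a) pomdp \<Rightarrow> real \<Rightarrow> bool" where
  "assumption_P M \<alpha> \<longleftrightarrow>
     (\<forall>x \<in> state_set M. \<forall>a \<in> action_set M. 0 \<le> cost M (x, a)) \<and> 0 \<le> \<alpha> \<and> \<alpha> \<le> 1"

text \<open>
  The joint law \<open>R\<close> of the next state and the next observation; \<open>joint_kernel_rectangle\<close> below
  gives its values on rectangles, which determine it.
\<close>

definition joint_kernel :: "('x::topological_space, 'y::topological_space, 'a) pomdp \<Rightarrow>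
    'x measure \<times> 'a \<Rightarrow> ('x \<times> 'y) measure" where
  "joint_kernel M = (\<lambda>(z, a). z \<bind> (\<lambda>x. trans_kernel M (x, a) \<bind>
     (\<lambda>x'. distr (obs_kernel M (a, x')) (borel_of (state_top M) \<Otimes>\<^sub>M borel_of (obs_top M)) (Pair x'))))"

definition next_obs_kernel :: "('x::topological_space, 'y::topological_space, 'a) pomdp \<Rightarrow>
    'x measure \<times> 'a \<Rightarrow> 'y measure" where
  "next_obs_kernel M za = distr (joint_kernel M za) (borel_of (obs_top M)) snd"

definition filter_kernel :: "('x::topological_space, 'y::topological_space, 'a::topological_space) pomdp \<Rightarrow>
    ('x measure \<times> 'a \<times> 'y \<Rightarrow> 'x measure) \<Rightarrow> bool" where
  "filter_kernel M H \<longleftrightarrow>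
     stochastic_kernel (state_top M)
       (prod_topology (belief_top M) (prod_topology (action_top M) (obs_top M))) H \<and>
     (\<forall>z \<in> prob_measures (state_top M). \<forall>a \<in> action_set M.
      \<forall>B \<in> sets (borel_of (state_top M)). \<forall>C \<in> sets (borel_of (obs_top M)).
        emeasure (joint_kernel M (z, a)) (B \<times> C) =
        (\<integral>\<^sup>+y\<in>C. emeasure (H (z, a, y)) B \<partial>next_obs_kernel M (z, a)))"

definition belief_kernel :: "('x::topological_space, 'y::topological_space, 'a) pomdp \<Rightarrow>
    ('x measure \<times> 'a \<times> 'y \<Rightarrow> 'x measure) \<Rightarrow> 'x measure \<times> 'a \<Rightarrow> 'x measure measure" where
  "belief_kernel M H = (\<lambda>(z, a).
     distr (next_obs_kernel M (z, a)) (borel_of (belief_top M)) (\<lambda>y. H (z, a, y)))"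

definition belief_cost :: "('x, 'y, 'a) pomdp \<Rightarrow> 'x measure \<times> 'a \<Rightarrow> ereal" where
  "belief_cost M = (\<lambda>(z, a). ereal_integral z (\<lambda>x. cost M (x, a)))"


section \<open>Optimality properties of the belief MDP\<close>

abbreviation comdp_value :: "('x::topological_space, 'y::topological_space, 'a::topological_space) pomdp \<Rightarrow>
    ('x measure \<times> 'a \<times> 'y \<Rightarrow> 'x measure) \<Rightarrow> real \<Rightarrow> enat \<Rightarrow> 'x measure \<Rightarrow> ereal" where
  "comdp_value M H \<equiv> opt_value (belief_top M) (action_top M) (belief_kernel M H) (belief_cost M)"

abbreviation comdp_optimal :: "('x::topological_space, 'y::topological_space, 'a::topological_space) pomdp \<Rightarrow>
    ('x measure \<times> 'a \<times> 'y \<Rightarrow> 'x measure) \<Rightarrow> real \<Rightarrow> enat \<Rightarrow> ('x measure, 'a) policy \<Rightarrow> bool" where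
  "comdp_optimal M H \<equiv> optimal_policy (belief_top M) (action_top M) (belief_kernel M H) (belief_cost M)"

abbreviation comdp_actions :: "('x::topological_space, 'y::topological_space, 'a::topological_space) pomdp \<Rightarrow>
    ('x measure \<times> 'a \<times> 'y \<Rightarrow> 'x measure) \<Rightarrow> real \<Rightarrow> enat \<Rightarrow> 'x measure \<Rightarrow> 'a set" where
  "comdp_actions M H \<equiv> opt_actions (belief_top M) (action_top M) (belief_kernel M H) (belief_cost M)"

definition optimality_equation :: "('x::topological_space, 'y::topological_space, 'a::topological_space) pomdp \<Rightarrow>
    ('x measure \<times> 'a \<times> 'y \<Rightarrow> 'x measure) \<Rightarrow> real \<Rightarrow> enat \<Rightarrow> bool" where
  "optimality_equation M H \<alpha> T \<longleftrightarrow>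
     (\<forall>z \<in> prob_measures (state_top M).
        is_attained_min (action_set M)
          (\<lambda>a. belief_cost M (z, a) +
               ereal \<alpha> * ereal_integral (belief_kernel M H (z, a)) (comdp_value M H \<alpha> T))
          (comdp_value M H \<alpha> (eSuc T) z) \<and>
        is_attained_min (action_set M)
          (\<lambda>a. ereal_integral z (\<lambda>x. cost M (x, a)) +
               ereal \<alpha> * ereal_integral z (\<lambda>x. ereal_integral (trans_kernel M (x, a))
                 (\<lambda>x'. ereal_integral (obs_kernel M (a, x'))
                   (\<lambda>y. comdp_value M H \<alpha> T (H (z, a, y))))))
          (comdp_value M H \<alpha> (eSuc T) z) \<and>
        comdp_actions M H \<alpha> T z \<noteq> {} \<and>
        (comdp_value M H \<alpha> (eSuc T) z = \<infinity> \<longrightarrow> comdp_actions M H \<alpha> T z = action_set M) \<and>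
        (comdp_value M H \<alpha> (eSuc T) z < \<infinity> \<longrightarrow> compact (comdp_actions M H \<alpha> T z))) \<and>
     {(z, a). z \<in> prob_measures (state_top M) \<and> a \<in> comdp_actions M H \<alpha> T z}
       \<in> sets (borel_of (prod_topology (belief_top M) (action_top M)))"

definition property_O1 :: "('x::topological_space, 'y::topological_space, 'a::topological_space) pomdp \<Rightarrow>
    ('x measure \<times> 'a \<times> 'y \<Rightarrow> 'x measure) \<Rightarrow> real \<Rightarrow> bool" where
  "property_O1 M H \<alpha> \<longleftrightarrow>
     (\<forall>t::nat. lower_semicontinuous (belief_top M) (comdp_value M H \<alpha> (enat t))) \<and>
     lower_semicontinuous (belief_top M) (comdp_value M H \<alpha> \<infinity>) \<and>
     (\<forall>z \<in> prob_measures (state_top M).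
        (\<lambda>t. comdp_value M H \<alpha> (enat t) z) \<longlonglongrightarrow> comdp_value M H \<alpha> \<infinity> z)"

definition property_O2 :: "('x::topological_space, 'y::topological_space, 'a::topological_space) pomdp \<Rightarrow>
    ('x measure \<times> 'a \<times> 'y \<Rightarrow> 'x measure) \<Rightarrow> real \<Rightarrow> bool" where
  "property_O2 M H \<alpha> \<longleftrightarrow> (\<forall>t::nat. optimality_equation M H \<alpha> (enat t))"

text \<open>
  Here \<open>(\<phi>\<^sub>0, \<dots>, \<phi>\<^sub>T\<^sub>-\<^sub>1)\<close> is represented by an infinite sequence of Borel maps whose remaining
  members are arbitrary; they do not affect costs up to horizon \<open>T\<close>.
\<close>

definition property_O3 :: "('x::topological_space, 'y::topological_space, 'a::topological_space) pomdp \<Rightarrow>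
    ('x measure \<times> 'a \<times> 'y \<Rightarrow> 'x measure) \<Rightarrow> real \<Rightarrow> bool" where
  "property_O3 M H \<alpha> \<longleftrightarrow> (\<forall>T::nat. 1 \<le> T \<longrightarrow>
     (\<exists>\<phi>. (\<forall>t. \<phi> t \<in> borel_of (belief_top M) \<rightarrow>\<^sub>M borel_of (action_top M)) \<and>
        comdp_optimal M H \<alpha> (enat T) (markov_policy (action_top M) \<phi>)) \<and>
     (\<forall>\<phi>. (\<forall>t. \<phi> t \<in> borel_of (belief_top M) \<rightarrow>\<^sub>M borel_of (action_top M)) \<and>
        (\<forall>z \<in> prob_measures (state_top M). \<forall>t<T. \<phi> (T - 1 - t) z \<in> comdp_actions M H \<alpha> (enat t) z) \<longrightarrow>
        comdp_optimal M H \<alpha> (enat T) (markov_policy (action_top M) \<phi>)))"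

definition property_O4 :: "('x::topological_space, 'y::topological_space, 'a::topological_space) pomdp \<Rightarrow>
    ('x measure \<times> 'a \<times> 'y \<Rightarrow> 'x measure) \<Rightarrow> real \<Rightarrow> bool" where
  "property_O4 M H \<alpha> \<longleftrightarrow> optimality_equation M H \<alpha> \<infinity>"

definition property_O5 :: "('x::topological_space, 'y::topological_space, 'a::topological_space) pomdp \<Rightarrow>
    ('x measure \<times> 'a \<times> 'y \<Rightarrow> 'x measure) \<Rightarrow> real \<Rightarrow> bool" where
  "property_O5 M H \<alpha> \<longleftrightarrow>
     (\<exists>\<phi> \<in> borel_of (belief_top M) \<rightarrow>\<^sub>M borel_of (action_top M).
        comdp_optimal M H \<alpha> \<infinity> (markov_policy (action_top M) (\<lambda>_. \<phi>))) \<and>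
     (\<forall>\<phi> \<in> borel_of (belief_top M) \<rightarrow>\<^sub>M borel_of (action_top M).
        comdp_optimal M H \<alpha> \<infinity> (markov_policy (action_top M) (\<lambda>_. \<phi>)) \<longleftrightarrow>
        (\<forall>z \<in> prob_measures (state_top M). \<phi> z \<in> comdp_actions M H \<alpha> \<infinity> z))"

definition property_O6 :: "('x::topological_space, 'y::topological_space, 'a::topological_space) pomdp \<Rightarrow>
    ('x measure \<times> 'a \<times> 'y \<Rightarrow> 'x measure) \<Rightarrow> real \<Rightarrow> bool" where
  "property_O6 M H \<alpha> \<longleftrightarrow>
     inf_compact (prod_topology (belief_top M) (action_top M)) (belief_cost M) \<longrightarrow>
     (\<forall>t::nat. 1 \<le> t \<longrightarrow> inf_compact (belief_top M) (comdp_value M H \<alpha> (enat t))) \<and>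
     inf_compact (belief_top M) (comdp_value M H \<alpha> \<infinity>)"


section \<open>Sanity checks\<close>

lemma space_borel_of [simp]: "space (borel_of T) = topspace T"
  by (simp add: borel_of_def space_measure_of_conv)

lemma sets_borel_of: "sets (borel_of T) = sigma_sets (topspace T) {U. openin T U}"
  unfolding borel_of_def by (rule sets_measure_of) (auto dest: openin_subset)

lemma measurable_continuous_map_borel_of:
  assumes "continuous_map S T f"
  shows "f \<in> borel_of S \<rightarrow>\<^sub>M borel_of T"
proof (unfold borel_of_def[of T], rule measurable_measure_of)
  show "f \<in> space (borel_of S) \<rightarrow> topspace T"
    using continuous_map_image_subset_topspace[OF assms] by auto
  fix U assume "U \<in> {U. openin T U}"
  hence "openin S {x \<in> topspace S. f x \<in> U}"
    using openin_continuous_map_preimage[OF assms] by blast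
  moreover have "f -` U \<inter> space (borel_of S) = {x \<in> topspace S. f x \<in> U}"
    by auto
  ultimately show "f -` U \<inter> space (borel_of S) \<in> sets (borel_of S)"
    by (auto simp: sets_borel_of)
qed (auto dest: openin_subset)

lemma measurable_stochastic_kernel:
  assumes "stochastic_kernel T1 T2 K"
  shows "K \<in> borel_of T2 \<rightarrow>\<^sub>M subprob_algebra (borel_of T1)"
proof (rule measurable_subprob_algebra)
  fix s assume "s \<in> space (borel_of T2)"
  hence K: "K s \<in> prob_measures T1"
    using assms by (simp add: stochastic_kernel_def)
  thus "subprob_space (K s)" "sets (K s) = sets (borel_of T1)"
    by (auto simp: prob_measures_def prob_space_imp_subprob_space)
next
  fix B assume B: "B \<in> sets (borel_of T1)"
  have "emeasure (K s) B = ennreal (measure (K s) B)" if "s \<in> space (borel_of T2)" for s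
    using assms that
    by (auto simp: stochastic_kernel_def prob_measures_def
        intro!: finite_measure.emeasure_eq_measure prob_space.finite_measure)
  moreover have "(\<lambda>s. ennreal (measure (K s) B)) \<in> borel_measurable (borel_of T2)"
    using assms B by (auto simp: stochastic_kernel_def)
  ultimately show "(\<lambda>s. emeasure (K s) B) \<in> borel_measurable (borel_of T2)"
    by (subst measurable_cong) auto
qed

lemma topspace_weak_topology [simp]: "topspace (weak_topology T) = prob_measures T"
proof -
  have "prob_measures T \<in> {{\<mu> \<in> prob_measures T. (\<integral>s. f s \<partial>\<mu>) \<in> U} | f U.
        continuous_map T euclideanreal f \<and> bounded (f ` topspace T) \<and> open U}"
    by (rule CollectI, rule exI[of _ "\<lambda>_. 0"], rule exI[of _ UNIV]) (auto simp: bounded_iff)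
  thus ?thesis
    unfolding weak_topology_def topology_generated_by_topspace by blast
qed

lemma limitin_weak_topology:
  assumes mu: "range \<mu> \<subseteq> prob_measures T" and nu: "\<nu> \<in> prob_measures T"
  shows "limitin (weak_topology T) \<mu> \<nu> sequentially \<longleftrightarrow>
    (\<forall>f. continuous_map T euclideanreal f \<and> bounded (f ` topspace T) \<longrightarrow>
       (\<lambda>n. \<integral>s. f s \<partial>\<mu> n) \<longlonglongrightarrow> (\<integral>s. f s \<partial>\<nu>))" (is "?L \<longleftrightarrow> ?R")
proof
  assume L: ?L
  show ?R
  proof (intro allI impI topological_tendstoI)
    fix f :: "'a \<Rightarrow> real" and U :: "real set"
    assume f: "continuous_map T euclideanreal f \<and> bounded (f ` topspace T)"
      and U: "open U" "(\<integral>s. f s \<partial>\<nu>) \<in> U"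
    let ?V = "{\<mu> \<in> prob_measures T. (\<integral>s. f s \<partial>\<mu>) \<in> U}"
    have "openin (weak_topology T) ?V"
      unfolding weak_topology_def
      by (rule topology_generated_by_Basis) (use f U in blast)
    hence "eventually (\<lambda>n. \<mu> n \<in> ?V) sequentially"
      using L nu U by (auto simp: limitin_def)
    thus "eventually (\<lambda>n. (\<integral>s. f s \<partial>\<mu> n) \<in> U) sequentially"
      by (rule eventually_mono) simp
  qed
next
  assume R: ?R
  let ?G = "{{\<mu> \<in> prob_measures T. (\<integral>s. f s \<partial>\<mu>) \<in> U} | f U.
        continuous_map T euclideanreal f \<and> bounded (f ` topspace T) \<and> open U}"
  have "eventually (\<lambda>n. \<mu> n \<in> V) sequentially"
    if "generate_topology_on ?G V" "\<nu> \<in> V" for V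
    using that
  proof (induction rule: generate_topology_on.induct)
    case (Int V W)
    then show ?case by (auto intro: eventually_conj)
  next
    case (UN \<K>)
    then obtain k where "k \<in> \<K>" "\<nu> \<in> k" by blast
    with UN.IH have "eventually (\<lambda>n. \<mu> n \<in> k) sequentially" by blast
    thus ?case by (rule eventually_mono) (use \<open>k \<in> \<K>\<close> in blast)
  next
    case (Basis V)
    then obtain f U where f: "continuous_map T euclideanreal f" "bounded (f ` topspace T)"
      and U: "open U" and V: "V = {\<mu> \<in> prob_measures T. (\<integral>s. f s \<partial>\<mu>) \<in> U}"
      by blast
    have "eventually (\<lambda>n. (\<integral>s. f s \<partial>\<mu> n) \<in> U) sequentially"
      using R f U Basis.prems V by (auto dest: topological_tendstoD)
    thus ?case
      by (rule eventually_mono) (use mu V in auto)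
  qed auto
  thus ?L
    using nu unfolding limitin_def topspace_weak_topology
    by (auto simp: weak_topology_def openin_topology_generated_by_iff)
qed

lemma joint_kernel_rectangle:
  assumes M: "is_pomdp M" and z: "z \<in> prob_measures (state_top M)" and a: "a \<in> action_set M"
    and B: "B \<in> sets (borel_of (state_top M))" and C: "C \<in> sets (borel_of (obs_top M))"
  shows "emeasure (joint_kernel M (z, a)) (B \<times> C) =
    (\<integral>\<^sup>+x. (\<integral>\<^sup>+x'\<in>B. emeasure (obs_kernel M (a, x')) C \<partial>trans_kernel M (x, a)) \<partial>z)"
proof -
  let ?X = "borel_of (state_top M)" and ?Y = "borel_of (obs_top M)"
  let ?f = "\<lambda>x'. distr (obs_kernel M (a, x')) (?X \<Otimes>\<^sub>M ?Y) (Pair x')"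
  have zs: "sets z = sets ?X" "space z = space ?X" "space z \<noteq> {}"
    using z M by (auto simp: prob_measures_def is_pomdp_def dest: sets_eq_imp_space_eq)
  have P: "(\<lambda>x. trans_kernel M (x, a)) \<in> ?X \<rightarrow>\<^sub>M subprob_algebra ?X"
  proof -
    have "(\<lambda>x. (x, a)) \<in> ?X \<rightarrow>\<^sub>M borel_of (prod_topology (state_top M) (action_top M))"
      by (rule measurable_continuous_map_borel_of)
        (use a in \<open>auto simp: continuous_map_pairedI intro!: continuous_intros\<close>)
    moreover have "trans_kernel M \<in> borel_of (prod_topology (state_top M) (action_top M)) \<rightarrow>\<^sub>M
        subprob_algebra ?X"
      by (rule measurable_stochastic_kernel) (use M in \<open>simp add: is_pomdp_def\<close>)
    ultimately show ?thesis by (rule measurable_compose)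
  qed
  have Q: "(\<lambda>x. obs_kernel M (a, x)) \<in> ?X \<rightarrow>\<^sub>M subprob_algebra ?Y"
  proof -
    have "(\<lambda>x. (a, x)) \<in> ?X \<rightarrow>\<^sub>M borel_of (prod_topology (action_top M) (state_top M))"
      by (rule measurable_continuous_map_borel_of)
        (use a in \<open>auto simp: continuous_map_pairedI intro!: continuous_intros\<close>)
    moreover have "obs_kernel M \<in> borel_of (prod_topology (action_top M) (state_top M)) \<rightarrow>\<^sub>M
        subprob_algebra ?Y"
      by (rule measurable_stochastic_kernel) (use M in \<open>simp add: is_pomdp_def\<close>)
    ultimately show ?thesis by (rule measurable_compose)
  qed
  have f: "?f \<in> ?X \<rightarrow>\<^sub>M subprob_algebra (?X \<Otimes>\<^sub>M ?Y)"
    by (rule measurable_distr2[OF _ Q]) simp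
  have PsX: "sets (trans_kernel M (x, a)) = sets ?X" "space (trans_kernel M (x, a)) = space ?X"
    if "x \<in> space ?X" for x
    using subprob_measurableD[OF P that] by auto
  have ne: "space ?X \<noteq> {}"
    using zs by simp
  have BC: "B \<times> C \<in> sets (?X \<Otimes>\<^sub>M ?Y)"
    using B C by simp
  have fx: "emeasure (?f x') (B \<times> C) = emeasure (obs_kernel M (a, x')) C * indicator B x'"
    if x': "x' \<in> space ?X" for x'
  proof -
    have Qs: "sets (obs_kernel M (a, x')) = sets ?Y"
      using subprob_measurableD[OF Q x'] by auto
    have "Pair x' \<in> obs_kernel M (a, x') \<rightarrow>\<^sub>M ?X \<Otimes>\<^sub>M ?Y"
      using x' by (subst measurable_cong_sets[OF Qs refl]) simp
    hence "emeasure (?f x') (B \<times> C) = emeasure (obs_kernel M (a, x'))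
        (Pair x' -` (B \<times> C) \<inter> space (obs_kernel M (a, x')))"
      using BC by (rule emeasure_distr)
    also have "Pair x' -` (B \<times> C) \<inter> space (obs_kernel M (a, x')) = (if x' \<in> B then C else {})"
      using sets.sets_into_space[of C "obs_kernel M (a, x')"] C Qs by auto
    finally show ?thesis by simp
  qed
  have bind_meas: "(\<lambda>x. trans_kernel M (x, a) \<bind> ?f) \<in> z \<rightarrow>\<^sub>M subprob_algebra (?X \<Otimes>\<^sub>M ?Y)"
    using measurable_bind2[OF P f] by (simp add: measurable_cong_sets[OF zs(1) refl])
  have "emeasure (joint_kernel M (z, a)) (B \<times> C) =
      (\<integral>\<^sup>+x. emeasure (trans_kernel M (x, a) \<bind> ?f) (B \<times> C) \<partial>z)"
    unfolding joint_kernel_def prod.case by (rule emeasure_bind[OF zs(3) bind_meas BC])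
  also have "\<dots> = (\<integral>\<^sup>+x. (\<integral>\<^sup>+x'\<in>B. emeasure (obs_kernel M (a, x')) C \<partial>trans_kernel M (x, a)) \<partial>z)"
  proof (rule nn_integral_cong)
    fix x assume "x \<in> space z"
    hence x: "x \<in> space ?X" using zs by simp
    have "?f \<in> trans_kernel M (x, a) \<rightarrow>\<^sub>M subprob_algebra (?X \<Otimes>\<^sub>M ?Y)"
      using f by (simp add: measurable_cong_sets[OF PsX(1)[OF x] refl])
    hence "emeasure (trans_kernel M (x, a) \<bind> ?f) (B \<times> C) =
        (\<integral>\<^sup>+x'. emeasure (?f x') (B \<times> C) \<partial>trans_kernel M (x, a))"
      using PsX(2)[OF x] ne BC by (intro emeasure_bind) auto
    also have "\<dots> = (\<integral>\<^sup>+x'\<in>B. emeasure (obs_kernel M (a, x')) C \<partial>trans_kernel M (x, a))"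
      by (intro nn_integral_cong) (use fx PsX(2)[OF x] in auto)
    finally show "emeasure (trans_kernel M (x, a) \<bind> ?f) (B \<times> C) =
        (\<integral>\<^sup>+x'\<in>B. emeasure (obs_kernel M (a, x')) C \<partial>trans_kernel M (x, a))" .
  qed
  finally show ?thesis .
qed

end

theory Submission
  imports Defs
begin

text \<open>
  The belief process is a Markov decision process whose state space is a space of measures. The
  proof shows that this process has a weakly continuous transition kernel and a \<open>K\<close>-inf-compact
  cost, and that these two properties alone give all the optimality properties.

  \<^emph>\<open>Weak continuity of the belief kernel.\<close> Let \<open>(z n, a n) \<longlonglongrightarrow> (z0, a0)\<close>. A filter is only
  determined almost everywhere, so its values cannot be compared pointwise; instead the joint law of
  the next state and the next observation is tested with products \<open>f(x') s(y)\<close>, where \<open>f\<close> is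
  continuous but \<open>s\<close> is merely measurable. The convergence is uniform in \<open>s\<close>
  (\<open>joint_integral_diff\<close>): it suffices to treat a sequence of test functions \<open>s n\<close>; by continuity in
  total variation the functions \<open>x' \<mapsto> \<integral> s n dQ(a0, x')\<close> are equicontinuous, so a subsequence of them
  converges by the Arzela-Ascoli theorem, and weak convergence is then applied twice, to the
  transition kernel and to the belief. Testing with the set where one filter integral exceeds the
  other turns this into \<open>L\<^sup>1\<close> convergence of \<open>\<integral> f dH(z n, a n, y)\<close> (\<open>filter_L1_tendsto\<close>).
  As countably many \<open>f\<close> determine weak convergence, the posterior beliefs converge weakly for almost
  every \<open>y\<close> along a subsequence (\<open>filter_AE_subsequence\<close>), and dominated convergence yields
  \<open>belief_kernel_weakly_continuous\<close>.

  \<^emph>\<open>The expected cost.\<close> Suppose that the expected costs along \<open>(z n, a n)\<close> stay bounded and \<open>z n\<close>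
  converges. If no convergent sequence of states had bounded costs along a subsequence of \<open>a n\<close>, then
  Fatou's lemma for weakly converging measures (\<open>nn_integral_Fatou_weak\<close>) would make the expected costs
  tend to infinity. Inf-compactness over such a convergent sequence gives a cluster point of \<open>a n\<close>,
  and Fatou's lemma bounds the cost there (\<open>K_inf_compact_nn_expectation\<close>).

  \<^emph>\<open>The space of beliefs.\<close> Countably many continuous functions approximate the indicators of all open
  sets from below. Their integrals embed the space of probability measures into a countable power of
  the real line (\<open>weak_topology_embedding\<close>), so it is again separable and metrizable, and its Borel
  sets are those of the \<open>\<sigma>\<close>-algebra generated by the evaluations of measures
  (\<open>sets_borel_of_weak_topology\<close>). Hence sequences suffice in all topological arguments, and kernels
  can be composed.

  \<^emph>\<open>The decision process.\<close> A constant added to the one-step cost makes it nonnegative, and integrals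
  can be taken in \<^typ>\<open>ennreal\<close>. Value iteration preserves lower semicontinuity because the actions
  that matter form compact sets; the same compactness allows the limit in the number of steps to be
  exchanged with the minimum over the actions (\<open>Bellman_equation\<close>) and provides measurable minimisers
  (\<open>measurable_selection_compact\<close>, \<open>measurable_minimizer\<close>). That value iteration computes the optimal
  values is verified by exchanging a terminal cost for one more step of the Ionescu-Tulcea process
  (\<open>stage_cost_Suc\<close>), which gives the lower bound \<open>val_le_policy_cost\<close> for all policies and equality
  for minimising ones (\<open>policy_cost_markov_minimizers\<close>, \<open>policy_cost_stationary_iff\<close>). Finally the
  constant is removed (\<open>opt_value_eq\<close>).
\<close>

section \<open>Separable metrizable spaces\<close>

definition separable_metrizable :: "'a topology \<Rightarrow> bool" where
  "separable_metrizable T \<longleftrightarrow> metrizable_space T \<and> second_countable T"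

lemma separable_metrizable_top_of_set:
  "separable_metrizable (top_of_set (X :: 'a::polish_space set))"
proof -
  obtain B :: "'a set set" where "countable B" "topological_basis B"
    using ex_countable_basis by blast
  then have "second_countable (euclidean :: 'a topology)"
    unfolding second_countable_def
    by (metis open_openin topological_basisE topological_basis_open)
  then show ?thesis
    by (simp add: separable_metrizable_def metrizable_space_subtopology metrizable_space_euclidean
        second_countable_subtopology)
qed

definition countable_base :: "'a topology \<Rightarrow> 'a set set \<Rightarrow> bool" where
  "countable_base T B \<longleftrightarrow> countable B \<and> (\<forall>V\<in>B. openin T V) \<and>
     (\<forall>U x. openin T U \<and> x \<in> U \<longrightarrow> (\<exists>V\<in>B. x \<in> V \<and> V \<subseteq> U))"

lemma second_countable_iff: "second_countable T \<longleftrightarrow> (\<exists>B. countable_base T B)"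
  by (simp add: second_countable_def countable_base_def)

lemma countable_baseD:
  assumes "countable_base T B"
  shows "countable B" "V \<in> B \<Longrightarrow> openin T V" "openin T U \<Longrightarrow> x \<in> U \<Longrightarrow> \<exists>V\<in>B. x \<in> V \<and> V \<subseteq> U"
  using assms by (simp_all add: countable_base_def)

lemma countable_base_prod_topology:
  assumes B: "countable_base S B" and D: "countable_base T D"
  shows "countable_base (prod_topology S T) ((\<lambda>(V, W). V \<times> W) ` (B \<times> D))"
  unfolding countable_base_def
proof (intro conjI allI impI ballI)
  show "countable ((\<lambda>(V, W). V \<times> W) ` (B \<times> D))"
    using countable_baseD(1)[OF B] countable_baseD(1)[OF D] by auto
  show "openin (prod_topology S T) V" if "V \<in> (\<lambda>(V, W). V \<times> W) ` (B \<times> D)" for V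
    using that countable_baseD(2)[OF B] countable_baseD(2)[OF D] by (auto simp: openin_prod_Times_iff)
  fix U p assume "openin (prod_topology S T) U \<and> p \<in> U"
  then obtain U1 U2 where "openin S U1" "openin T U2" "fst p \<in> U1" "snd p \<in> U2" "U1 \<times> U2 \<subseteq> U"
    by (metis openin_prod_topology_alt prod.collapse)
  with countable_baseD(3)[OF B, of U1 "fst p"] countable_baseD(3)[OF D, of U2 "snd p"]
  obtain V W where "V \<in> B" "W \<in> D" "fst p \<in> V" "snd p \<in> W" "V \<subseteq> U1" "W \<subseteq> U2"
    by blast
  with \<open>U1 \<times> U2 \<subseteq> U\<close> show "\<exists>V\<in>(\<lambda>(V, W). V \<times> W) ` (B \<times> D). p \<in> V \<and> V \<subseteq> U"
    by (intro bexI[of _ "V \<times> W"]) (auto simp: mem_Times_iff)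
qed

lemma separable_metrizable_prod_topology:
  assumes "separable_metrizable S" "separable_metrizable T"
  shows "separable_metrizable (prod_topology S T)"
  using assms countable_base_prod_topology
  unfolding separable_metrizable_def second_countable_iff metrizable_space_prod_topology by blast

lemma sets_borel_of_subset_countable_base:
  assumes B: "countable_base T B" and N: "\<And>V. V \<in> B \<Longrightarrow> V \<in> sets N" "topspace T \<in> sets N"
  shows "sets (borel_of T) \<subseteq> sets N"
  unfolding sets_borel_of
proof (rule sets.sigma_sets_subset', safe)
  fix U assume U: "openin T U"
  have "U = \<Union>{V \<in> B. V \<subseteq> U}"
  proof (intro equalityI subsetI)
    fix x assume "x \<in> U"
    from countable_baseD(3)[OF B U this] obtain V where "V \<in> B" "x \<in> V" "V \<subseteq> U" by (elim bexE conjE)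
    then show "x \<in> \<Union>{V \<in> B. V \<subseteq> U}" by (intro UnionI[of V] CollectI conjI)
  qed auto
  moreover have "\<Union>{V \<in> B. V \<subseteq> U} \<in> sets N"
  proof (rule sets.countable_Union)
    show "countable {V \<in> B. V \<subseteq> U}" using countable_baseD(1)[OF B] by simp
    show "{V \<in> B. V \<subseteq> U} \<subseteq> sets N" using N(1) by auto
  qed
  ultimately show "U \<in> sets N" by simp
qed (rule N)

text \<open>
  Product kernels are formed with the product \<open>\<sigma>\<close>-algebra, whereas kernels on product spaces are
  measurable for the Borel sets of the product topology.
\<close>

lemma sets_borel_of_prod_topology:
  assumes S: "second_countable S" and T: "second_countable T"
  shows "sets (borel_of (prod_topology S T)) = sets (borel_of S \<Otimes>\<^sub>M borel_of T)"
proof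
  obtain B D where B: "countable_base S B" and D: "countable_base T D"
    using S T unfolding second_countable_iff by blast
  show "sets (borel_of (prod_topology S T)) \<subseteq> sets (borel_of S \<Otimes>\<^sub>M borel_of T)"
  proof (rule sets_borel_of_subset_countable_base[OF countable_base_prod_topology[OF B D]])
    show "V \<in> sets (borel_of S \<Otimes>\<^sub>M borel_of T)" if "V \<in> (\<lambda>(V, W). V \<times> W) ` (B \<times> D)" for V
      using that countable_baseD(2)[OF B] countable_baseD(2)[OF D]
      by (auto simp: sets_borel_of intro!: pair_measureI)
  qed (metis sets.top space_borel_of space_pair_measure topspace_prod_topology)
  have "fst \<in> borel_of (prod_topology S T) \<rightarrow>\<^sub>M borel_of S" "snd \<in> borel_of (prod_topology S T) \<rightarrow>\<^sub>M borel_of T"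
    by (auto intro!: measurable_continuous_map_borel_of continuous_map_fst continuous_map_snd)
  then have "(\<lambda>p. (fst p, snd p)) \<in> borel_of (prod_topology S T) \<rightarrow>\<^sub>M borel_of S \<Otimes>\<^sub>M borel_of T"
    by (rule measurable_Pair)
  from measurable_sets[OF this] sets.sets_into_space
  show "sets (borel_of S \<Otimes>\<^sub>M borel_of T) \<subseteq> sets (borel_of (prod_topology S T))"
    by (fastforce simp: space_pair_measure Int_absorb2)
qed

lemma borel_of_openin: "openin T U \<Longrightarrow> U \<in> sets (borel_of T)"
  by (simp add: sets_borel_of)

lemma measurable_euclideanreal_borel_of:
  "continuous_map T euclideanreal f \<Longrightarrow> f \<in> borel_measurable (borel_of T)"
  using measurable_continuous_map_borel_of[of T euclideanreal f]
  by (simp add: borel_def borel_of_def)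

lemma exists_decreasing_neighbourhood_base:
  assumes "first_countable T" "x \<in> topspace T"
  obtains U :: "nat \<Rightarrow> 'a set" where "\<And>n. openin T (U n)" "\<And>n. x \<in> U n" "decseq U"
    "\<And>V. openin T V \<Longrightarrow> x \<in> V \<Longrightarrow> \<exists>n. U n \<subseteq> V"
proof -
  obtain B where B: "countable B" "\<And>V. V \<in> B \<Longrightarrow> openin T V"
    "\<And>U. openin T U \<Longrightarrow> x \<in> U \<Longrightarrow> \<exists>V\<in>B. x \<in> V \<and> V \<subseteq> U"
    using assms unfolding first_countable_def by metis
  let ?B = "{V \<in> B. x \<in> V}"
  have cB: "countable ?B" and ne: "?B \<noteq> {}"
    using B(1) B(3)[of "topspace T"] assms(2) by auto
  define W where "W = from_nat_into ?B"
  have W: "openin T (W n)" "x \<in> W n" for n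
    using from_nat_into[OF ne, of n] B(2) by (auto simp: W_def)
  show ?thesis
  proof (rule that[of "\<lambda>n. \<Inter>i\<in>{..n}. W i"])
    show "openin T (\<Inter>i\<in>{..n}. W i)" "x \<in> (\<Inter>i\<in>{..n}. W i)" for n
      using W by (auto intro!: openin_INT2)
    show "decseq (\<lambda>n. \<Inter>i\<in>{..n}. W i)"
      by (auto simp: decseq_def)
    fix V assume "openin T V" "x \<in> V"
    then obtain V' where "V' \<in> ?B" "V' \<subseteq> V" using B(3) by blast
    then obtain n where "W n = V'"
      by (metis W_def cB from_nat_into_surj)
    with \<open>V' \<subseteq> V\<close> show "\<exists>n. (\<Inter>i\<in>{..n}. W i) \<subseteq> V"
      by (intro exI[of _ n]) auto
  qed
qed

text \<open>
  Continuity hypotheses are stated along sequences, whereas semicontinuity is used through open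
  sets. This converts one into the other, uniformly over a tail of indices.
\<close>

lemma eventually_near_of_sequences:
  assumes T: "first_countable T" and x: "x \<in> topspace T"
    and P: "\<And>s. range s \<subseteq> topspace T \<Longrightarrow> limitin T s x sequentially \<Longrightarrow>
      eventually (\<lambda>n. P n (s n)) sequentially"
  shows "\<exists>U k. openin T U \<and> x \<in> U \<and> (\<forall>n\<ge>k. \<forall>y\<in>U. P n y)"
proof (rule ccontr)
  assume neg: "\<not> ?thesis"
  obtain U :: "nat \<Rightarrow> 'a set" where U: "\<And>n. openin T (U n)" "\<And>n. x \<in> U n" "decseq U"
    "\<And>V. openin T V \<Longrightarrow> x \<in> V \<Longrightarrow> \<exists>n. U n \<subseteq> V"
    using exists_decreasing_neighbourhood_base[OF T x] by blast
  have step: "\<exists>n y. n \<ge> k \<and> y \<in> U i \<and> \<not> P n y" for k i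
  proof (rule ccontr)
    assume "\<not> ?thesis"
    then have "\<forall>n\<ge>k. \<forall>y\<in>U i. P n y" by blast
    then show False using neg U(1)[of i] U(2)[of i] by blast
  qed
  have "\<exists>f. \<forall>i. (snd (f i) \<in> U i \<and> \<not> P (fst (f i)) (snd (f i))) \<and> fst (f i) < fst (f (Suc i))"
  proof (rule dependent_nat_choice)
    show "\<exists>p. snd p \<in> U 0 \<and> \<not> P (fst p) (snd p)"
      using step[of 0 0] by (metis fst_conv snd_conv)
    show "\<exists>p'. (snd p' \<in> U (Suc i) \<and> \<not> P (fst p') (snd p')) \<and> fst p < fst p'" for p :: "nat \<times> 'a" and i
      using step[of "Suc (fst p)" "Suc i"] by (metis Suc_le_eq fst_conv snd_conv)
  qed
  then obtain f where f: "\<And>i. snd (f i) \<in> U i" "\<And>i. \<not> P (fst (f i)) (snd (f i))"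
    "\<And>i. fst (f i) < fst (f (Suc i))" by blast
  \<comment> \<open>the counterexamples, padded with \<open>x\<close>, form a sequence that converges to \<open>x\<close>\<close>
  define N where "N i = fst (f i)" for i
  have N: "strict_mono N"
    using f(3) by (simp add: strict_mono_Suc_iff N_def)
  define s where "s n = (if n \<in> range N then snd (f (inv N n)) else x)" for n
  have sN: "s (N i) = snd (f i)" for i
    using N by (simp add: s_def inv_f_f strict_mono_imp_inj_on)
  have sU: "s n \<in> U i" if "n \<ge> N i" for n i
  proof (cases "n \<in> range N")
    case True
    then obtain j where "n = N j" by blast
    moreover from this that have "i \<le> j" using N by (simp add: strict_mono_less_eq)
    ultimately show ?thesis using sN f(1)[of j] decseqD[OF U(3) \<open>i \<le> j\<close>] by auto
  qed (simp add: s_def U)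
  have "limitin T s x sequentially"
    unfolding limitin_sequentially
  proof (intro conjI allI impI)
    fix V assume "openin T V \<and> x \<in> V"
    then obtain i where "U i \<subseteq> V" using U(4) by blast
    then show "\<exists>N. \<forall>n\<ge>N. s n \<in> V" using sU by blast
  qed fact
  moreover have "range s \<subseteq> topspace T"
    using x f(1) openin_subset[OF U(1)] by (auto simp: s_def)
  ultimately have "eventually (\<lambda>n. P n (s n)) sequentially" by (intro P)
  then obtain k where "\<And>n. n \<ge> k \<Longrightarrow> P n (s n)" by (auto simp: eventually_sequentially)
  moreover have "N k \<ge> k" using N by (simp add: seq_suble)
  ultimately show False using f(2)[of k] sN[of k] by (metis N_def)
qed

lemma continuous_map_of_sequences:
  assumes T: "first_countable T"
    and lim: "\<And>s x. range s \<subseteq> topspace T \<Longrightarrow> limitin T s x sequentially \<Longrightarrow>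
      limitin T' (\<lambda>n. f (s n)) (f x) sequentially"
  shows "continuous_map T T' f"
proof -
  have f: "f x \<in> topspace T'" if "x \<in> topspace T" for x
    using lim[of "\<lambda>_. x" x] that limitin_topspace by (fastforce simp: limitin_const_iff limitin_def)
  show ?thesis
    unfolding continuous_map_def
  proof (intro conjI allI impI)
    show "f \<in> topspace T \<rightarrow> topspace T'" using f by auto
    fix V assume V: "openin T' V"
    show "openin T {x \<in> topspace T. f x \<in> V}"
    proof (subst openin_subopen, safe)
      fix x assume x: "x \<in> topspace T" "f x \<in> V"
      have "\<exists>U (k::nat). openin T U \<and> x \<in> U \<and> (\<forall>n\<ge>k. \<forall>y\<in>U. f y \<in> V)"
        by (rule eventually_near_of_sequences[OF T x(1), where P = "\<lambda>_ y. f y \<in> V"])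
          (use lim V x in \<open>auto simp: limitin_def\<close>)
      then obtain U k where U: "openin T U" "x \<in> U" "\<And>n y. n \<ge> (k::nat) \<Longrightarrow> y \<in> U \<Longrightarrow> f y \<in> V" by blast
      have "U \<subseteq> {x \<in> topspace T. f x \<in> V}"
        using U(3)[of k] openin_subset[OF U(1)] by auto
      then show "\<exists>U. openin T U \<and> x \<in> U \<and> U \<subseteq> {x \<in> topspace T. f x \<in> V}"
        using U by blast
    qed
  qed
qed

lemma metrizable_compactin_sequentially:
  assumes "metrizable_space T"
  shows "compactin T S \<longleftrightarrow> S \<subseteq> topspace T \<and>
    (\<forall>\<sigma>::nat \<Rightarrow> 'a. range \<sigma> \<subseteq> S \<longrightarrow> (\<exists>l r. l \<in> S \<and> strict_mono r \<and> limitin T (\<sigma> \<circ> r) l sequentially))"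
proof -
  obtain X d where "Metric_space X d" "T = Metric_space.mtopology X d"
    using assms unfolding metrizable_space_def by metis
  then show ?thesis
    using Metric_space.compactin_sequentially[of X d S] Metric_space.topspace_mtopology[of X d] by simp
qed

text \<open>Metrizable spaces are compactly generated, so compact sets detect closedness.\<close>

lemma closedin_of_compact_slices:
  assumes T: "metrizable_space T" and S: "S \<subseteq> topspace T"
    and K: "\<And>K. compactin T K \<Longrightarrow> compactin T (K \<inter> S)"
  shows "closedin T S"
proof -
  have "closedin (subtopology T K) (K \<inter> S)" if "compactin T K" for K
    using K[OF that] metrizable_imp_Hausdorff_space[OF T]
    by (meson Int_lower1 closed_Int_compactin closedin_subset_topspace compactin_imp_closedin)
  then show ?thesis
    using metrizable_imp_k_space[OF T] S unfolding k_space by blast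
qed

subsection \<open>Countable families of continuous functions\<close>

text \<open>
  In a metrizable space a basic open set is a union of countably many closed sets; Urysohn's lemma
  is applied to each pair of such a closed set and the complement of the basic set.
\<close>

lemma countable_Urysohn_family:
  assumes "separable_metrizable T"
  obtains F :: "('a \<Rightarrow> real) set" where "countable F" "(\<lambda>_. 0) \<in> F"
    "\<And>f. f \<in> F \<Longrightarrow> continuous_map T euclideanreal f"
    "\<And>f x. f \<in> F \<Longrightarrow> x \<in> topspace T \<Longrightarrow> 0 \<le> f x \<and> f x \<le> 1"
    "\<And>U x. openin T U \<Longrightarrow> x \<in> U \<Longrightarrow> \<exists>f\<in>F. f x = 1 \<and> (\<forall>y\<in>topspace T - U. f y = 0)"
proof -
  have met: "metrizable_space T" using assms by (simp add: separable_metrizable_def)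
  obtain B where "countable_base T B"
    using assms unfolding separable_metrizable_def second_countable_iff by blast
  note B = countable_baseD[OF this]
  have "\<exists>C. (\<forall>n::nat. closedin T (C n)) \<and> \<Union> (range C) = V" if "V \<in> B" for V
    using open_imp_fsigma_in[OF met B(2)[OF that]] unfolding fsigma_in_ascending by blast
  then have "\<forall>V\<in>B. \<exists>C. (\<forall>n::nat. closedin T (C n)) \<and> \<Union> (range C) = V" by blast
  from bchoice[OF this] obtain C
    where "\<forall>V\<in>B. (\<forall>n::nat. closedin T (C V n)) \<and> \<Union> (range (C V)) = V" ..
  then have C: "\<And>V n. V \<in> B \<Longrightarrow> closedin T (C V n)" "\<And>V. V \<in> B \<Longrightarrow> \<Union> (range (C V)) = V"
    by blast+
  have "\<exists>f. continuous_map T euclideanreal f \<and> (\<forall>x\<in>topspace T. 0 \<le> f x \<and> f x \<le> 1) \<and>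
      (\<forall>x\<in>C V n. f x = 1) \<and> (\<forall>x\<in>topspace T - V. f x = 0)" if V: "V \<in> B" for V and n :: nat
  proof -
    have "closedin T (topspace T - V)" using B(2)[OF V] by auto
    moreover have "disjnt (topspace T - V) (C V n)" using C(2)[OF V] by (auto simp: disjnt_def)
    ultimately obtain f where f: "continuous_map T (top_of_set {0..1::real}) f"
        "f ` (topspace T - V) \<subseteq> {0}" "f ` C V n \<subseteq> {1}"
      using Urysohn_lemma[OF metrizable_imp_normal_space[OF met], of "topspace T - V" "C V n" 0 1] C(1)[OF V]
      by auto
    have "continuous_map T euclideanreal f"
      using f(1) by (simp add: continuous_map_in_subtopology)
    moreover have "f x \<in> {0..1}" if "x \<in> topspace T" for x
      using continuous_map_image_subset_topspace[OF f(1)] that by auto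
    moreover have "f x = 1" if "x \<in> C V n" for x using f(3) that by blast
    moreover have "f x = 0" if "x \<in> topspace T - V" for x using f(2) that by blast
    ultimately show ?thesis by auto
  qed
  then have "\<forall>p\<in>B \<times> UNIV. \<exists>f. continuous_map T euclideanreal f \<and> (\<forall>x\<in>topspace T. 0 \<le> f x \<and> f x \<le> 1) \<and>
      (\<forall>x\<in>C (fst p) (snd p). f x = 1) \<and> (\<forall>x\<in>topspace T - fst p. f x = 0)"
    by auto
  from bchoice[OF this] obtain h where h: "\<forall>p\<in>B \<times> UNIV. continuous_map T euclideanreal (h p) \<and>
      (\<forall>x\<in>topspace T. 0 \<le> h p x \<and> h p x \<le> 1) \<and>
      (\<forall>x\<in>C (fst p) (snd p). h p x = 1) \<and> (\<forall>x\<in>topspace T - fst p. h p x = 0)"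
    by blast
  define g where "g V n = h (V, n)" for V n
  have g: "continuous_map T euclideanreal (g V n) \<and>
      (\<forall>x\<in>topspace T. 0 \<le> g V n x \<and> g V n x \<le> 1) \<and>
      (\<forall>x\<in>C V n. g V n x = 1) \<and> (\<forall>x\<in>topspace T - V. g V n x = 0)" if "V \<in> B" for V n
    using bspec[OF h, of "(V, n)"] that by (simp add: g_def)
  show ?thesis
  proof (rule that[of "insert (\<lambda>_. 0) (case_prod g ` (B \<times> UNIV))"])
    show "countable (insert (\<lambda>_. 0) (case_prod g ` (B \<times> UNIV)))"
      using B(1) by auto
    fix U x assume "openin T U" "x \<in> U"
    then obtain V where V: "V \<in> B" "x \<in> V" "V \<subseteq> U" using B(3) by blast
    moreover obtain n where "x \<in> C V n" using C(2)[OF V(1)] V(2) by blast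
    ultimately show "\<exists>f\<in>insert (\<lambda>_. 0) (case_prod g ` (B \<times> UNIV)). f x = 1 \<and> (\<forall>y\<in>topspace T - U. f y = 0)"
      using g[OF V(1), of n] by (intro bexI[of _ "g V n"]) auto
  qed (use g in auto)
qed

text \<open>
  Countability of the whole family, with one family serving all open sets, is what makes the weak
  topology countably generated.
\<close>

definition approximating_family :: "'a topology \<Rightarrow> ('a \<Rightarrow> real) set \<Rightarrow> bool" where
  "approximating_family T E \<longleftrightarrow> countable E \<and> E \<noteq> {} \<and>
     (\<forall>f\<in>E. continuous_map T euclideanreal f \<and> (\<forall>x\<in>topspace T. 0 \<le> f x \<and> f x \<le> 1)) \<and>
     (\<forall>U. openin T U \<longrightarrow> (\<exists>g. range g \<subseteq> E \<and> (\<forall>x\<in>topspace T. incseq (\<lambda>n::nat. g n x)) \<and>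
        (\<forall>x\<in>topspace T. (\<lambda>n. g n x) \<longlonglongrightarrow> indicator U x)))"

lemma approximating_familyD:
  assumes "approximating_family T E"
  shows "countable E" "E \<noteq> {}" "f \<in> E \<Longrightarrow> continuous_map T euclideanreal f"
    "f \<in> E \<Longrightarrow> x \<in> topspace T \<Longrightarrow> 0 \<le> f x \<and> f x \<le> 1"
    "openin T U \<Longrightarrow> \<exists>g. range g \<subseteq> E \<and> (\<forall>x\<in>topspace T. incseq (\<lambda>n::nat. g n x)) \<and>
        (\<forall>x\<in>topspace T. (\<lambda>n. g n x) \<longlonglongrightarrow> indicator U x)"
  using assms by (simp_all add: approximating_family_def)

text \<open>
  Finite joins of the functions in a countable Urysohn family do it: enumerate the functions that vanish off \<open>U\<close> and join ever
  more of them. The measure of an open set is then a monotone limit of integrals of countably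
  many continuous functions, which makes the weak topology separable and metrizable.
\<close>

lemma exists_approximating_family:
  assumes "separable_metrizable T"
  shows "\<exists>E. approximating_family T E"
proof -
  obtain F :: "('a \<Rightarrow> real) set" where F: "countable F" "(\<lambda>_. 0) \<in> F"
    "\<And>f. f \<in> F \<Longrightarrow> continuous_map T euclideanreal f"
    "\<And>f x. f \<in> F \<Longrightarrow> x \<in> topspace T \<Longrightarrow> 0 \<le> f x \<and> f x \<le> 1"
    "\<And>U x. openin T U \<Longrightarrow> x \<in> U \<Longrightarrow> \<exists>f\<in>F. f x = 1 \<and> (\<forall>y\<in>topspace T - U. f y = 0)"
    using countable_Urysohn_family[OF assms] by blast
  \<comment> \<open>a substitute for the maximum over \<open>J\<close> that is visibly continuous\<close>
  define m where "m J x = 1 - (\<Prod>f\<in>J. 1 - f x)" for J :: "('a \<Rightarrow> real) set" and x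
  have m01: "0 \<le> m J x \<and> m J x \<le> 1" if "finite J" "J \<subseteq> F" "x \<in> topspace T" for J x
  proof -
    have "0 \<le> (\<Prod>f\<in>J. 1 - f x)" "(\<Prod>f\<in>J. 1 - f x) \<le> 1"
      using that F(4) by (auto intro!: prod_nonneg prod_le_1)
    then show ?thesis by (simp add: m_def)
  qed
  have m_mono: "m J x \<le> m J' x" if "finite J'" "J \<subseteq> J'" "J' \<subseteq> F" "x \<in> topspace T" for J J' x
  proof -
    have "(\<Prod>f\<in>J'. 1 - f x) = (\<Prod>f\<in>J' - J. 1 - f x) * (\<Prod>f\<in>J. 1 - f x)"
      using that by (simp add: prod.subset_diff)
    also have "\<dots> \<le> (\<Prod>f\<in>J. 1 - f x)"
      using that F(4) by (intro mult_left_le_one_le prod_nonneg prod_le_1) (auto simp: subset_iff)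
    finally show ?thesis by (simp add: m_def)
  qed
  have m_1: "m J x = 1" if "finite J" "f \<in> J" "f x = 1" for J f x
    using that by (auto simp: m_def intro!: prod_zero)
  have m_0: "m J x = 0" if "\<And>f. f \<in> J \<Longrightarrow> f x = 0" for J x
    unfolding m_def using that by (subst prod.neutral) auto
  have "approximating_family T (m ` {J. finite J \<and> J \<subseteq> F})"
    unfolding approximating_family_def
  proof (intro conjI ballI allI impI)
    show "countable (m ` {J. finite J \<and> J \<subseteq> F})"
      using countable_Collect_finite_subset[OF F(1)] by simp
    show "m ` {J. finite J \<and> J \<subseteq> F} \<noteq> {}" by blast
    show "continuous_map T euclideanreal f" if "f \<in> m ` {J. finite J \<and> J \<subseteq> F}" for f
      using that F(3) unfolding m_def by (auto intro!: continuous_intros)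
    show "0 \<le> f x" "f x \<le> 1" if "f \<in> m ` {J. finite J \<and> J \<subseteq> F}" "x \<in> topspace T" for f x
      using that m01 by auto
    fix U assume U: "openin T U"
    define FU where "FU = {f \<in> F. \<forall>y\<in>topspace T - U. f y = 0}"
    have FU: "countable FU" "FU \<noteq> {}" "FU \<subseteq> F"
      using F(1,2) by (auto simp: FU_def)
    define J where "J n = from_nat_into FU ` {..n}" for n :: nat
    have J: "finite (J n)" "J n \<subseteq> FU" for n
      using from_nat_into[OF FU(2)] by (auto simp: J_def)
    have "(\<lambda>n. m (J n) x) \<longlonglongrightarrow> indicator U x" if x: "x \<in> topspace T" for x
    proof (cases "x \<in> U")
      case True
      then obtain f where f: "f \<in> FU" "f x = 1" using F(5)[OF U] by (auto simp: FU_def)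
      then obtain k where "f = from_nat_into FU k" by (metis FU(1) from_nat_into_surj)
      then have "f \<in> J n" if "n \<ge> k" for n using that by (auto simp: J_def)
      then have "\<forall>n\<ge>k. m (J n) x = 1"
        using m_1 J(1) f(2) by blast
      then have "eventually (\<lambda>n. m (J n) x = 1) sequentially"
        unfolding eventually_sequentially by blast
      then show ?thesis using True by (simp add: tendsto_eventually)
    next
      case False
      then have "m (J n) x = 0" for n
        using J(2) x by (intro m_0) (auto simp: FU_def)
      then show ?thesis using False by simp
    qed
    moreover have "incseq (\<lambda>n. m (J n) x)" if "x \<in> topspace T" for x
      unfolding incseq_def using that J FU(3)
      by (intro allI impI m_mono) (auto simp: J_def)
    ultimately show "\<exists>g. range g \<subseteq> m ` {J. finite J \<and> J \<subseteq> F} \<and> (\<forall>x\<in>topspace T. incseq (\<lambda>n::nat. g n x)) \<and>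
        (\<forall>x\<in>topspace T. (\<lambda>n. g n x) \<longlonglongrightarrow> indicator U x)"
      using J FU(3) by (intro exI[of _ "\<lambda>n. m (J n)"]) blast
  qed
  then show ?thesis ..
qed

section \<open>Semicontinuity, inf-compactness and measurable selection\<close>

definition lsc :: "'a topology \<Rightarrow> ('a \<Rightarrow> ennreal) \<Rightarrow> bool" where
  "lsc T f \<longleftrightarrow> (\<forall>r. openin T {x \<in> topspace T. r < f x})"

lemma lsc_measurable:
  assumes "lsc T f" shows "f \<in> borel_measurable (borel_of T)"
  by (rule borel_measurableI_greater)
    (use assms in \<open>auto simp: lsc_def intro!: borel_of_openin\<close>)

lemma lsc_const: "lsc T (\<lambda>_. c)"
  unfolding lsc_def
proof
  fix r show "openin T {x \<in> topspace T. r < c}" by (cases "r < c") auto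
qed

lemma lsc_cong: "(\<And>x. x \<in> topspace T \<Longrightarrow> f x = g x) \<Longrightarrow> lsc T f \<longleftrightarrow> lsc T g"
  unfolding lsc_def by (metis (mono_tags, lifting) Collect_cong)

lemma lsc_SUP:
  assumes "\<And>i. i \<in> I \<Longrightarrow> lsc T (f i)" shows "lsc T (\<lambda>x. SUP i\<in>I. f i x)"
proof -
  have "{x \<in> topspace T. r < (SUP i\<in>I. f i x)} = (\<Union>i\<in>I. {x \<in> topspace T. r < f i x})" for r
    by (auto simp: less_SUP_iff)
  then show ?thesis
    using assms unfolding lsc_def by (auto intro!: openin_Union)
qed

text \<open>
  This writes the superlevel set of a sum as a union of intersections of superlevel sets. The first
  two disjuncts cover the case that a summand is \<open>0\<close>, below which there is nothing.
\<close>

lemma less_add_ennreal_iff: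
  fixes a b r :: ennreal
  shows "r < a + b \<longleftrightarrow> r < a \<or> r < b \<or> (\<exists>p q. p < a \<and> q < b \<and> r < p + q)"
proof (intro iffI; (elim disjE exE conjE)?)
  assume r: "r < a + b"
  show "r < a \<or> r < b \<or> (\<exists>p q. p < a \<and> q < b \<and> r < p + q)"
  proof (cases "a = 0 \<or> b = 0 \<or> a = \<infinity> \<or> b = \<infinity>")
    case True
    then show ?thesis using r by (auto simp: less_top[symmetric])
  next
    case False
    then obtain x y where xy: "a = ennreal x" "b = ennreal y" "0 < x" "0 < y"
      by (metis ennreal_cases ennreal_eq_0_iff infinity_ennreal_def not_le_imp_less)
    have "r \<noteq> \<infinity>" using r by auto
    then obtain z where z: "r = ennreal z" "0 \<le> z" by (cases r) auto
    have "z < x + y" using r xy z by (simp flip: ennreal_plus add: ennreal_less_iff)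
    define e where "e = min (min x y) ((x + y - z) / 2) / 2"
    have e: "0 < e" "e < x" "e < y" "2 * e < x + y - z"
      using xy \<open>z < x + y\<close> by (auto simp: e_def min_def field_simps)
    have "ennreal (x - e) < a" "ennreal (y - e) < b" "r < ennreal (x - e) + ennreal (y - e)"
      using e xy z by (auto simp flip: ennreal_plus simp: ennreal_less_iff)
    then show ?thesis by blast
  qed
next
  show "r < a \<Longrightarrow> r < a + b" by (simp add: order_less_le_trans)
  show "r < b \<Longrightarrow> r < a + b" by (simp add: add_increasing order_less_le_trans)
  show "p < a \<Longrightarrow> q < b \<Longrightarrow> r < p + q \<Longrightarrow> r < a + b" for p q
    by (meson add_mono order_less_imp_le order_less_le_trans)
qed

lemma lsc_add:
  assumes "lsc T f" "lsc T g" shows "lsc T (\<lambda>x. f x + g x)"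
  unfolding lsc_def
proof
  fix r
  let ?O = "\<lambda>h r. {x \<in> topspace T. r < (h x :: ennreal)}"
  have "{x \<in> topspace T. r < f x + g x} =
      ?O f r \<union> ?O g r \<union> (\<Union>pq\<in>{pq. r < fst pq + snd pq}. ?O f (fst pq) \<inter> ?O g (snd pq))"
  proof (rule set_eqI)
    fix x
    show "x \<in> {x \<in> topspace T. r < f x + g x} \<longleftrightarrow>
        x \<in> ?O f r \<union> ?O g r \<union> (\<Union>pq\<in>{pq. r < fst pq + snd pq}. ?O f (fst pq) \<inter> ?O g (snd pq))"
      using less_add_ennreal_iff[of r "f x" "g x"] by auto
  qed
  moreover have "openin T (?O f p)" "openin T (?O g p)" for p
    using assms by (auto simp: lsc_def)
  ultimately show "openin T {x \<in> topspace T. r < f x + g x}"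
    by (auto intro!: openin_Union openin_Un openin_Int)
qed

lemma lsc_sum: "finite I \<Longrightarrow> (\<And>i. i \<in> I \<Longrightarrow> lsc T (f i)) \<Longrightarrow> lsc T (\<lambda>x. \<Sum>i\<in>I. f i x)"
  by (induction I rule: finite_induct) (auto intro: lsc_const lsc_add)

lemma lsc_compose:
  assumes g: "continuous_map S T g" and f: "lsc T f" shows "lsc S (\<lambda>x. f (g x))"
  unfolding lsc_def
proof
  fix r
  have "{x \<in> topspace S. r < f (g x)} = {x \<in> topspace S. g x \<in> {y \<in> topspace T. r < f y}}"
    using continuous_map_image_subset_topspace[OF g] by auto
  then show "openin S {x \<in> topspace S. r < f (g x)}"
    using openin_continuous_map_preimage[OF g, of "{y \<in> topspace T. r < f y}"] f by (simp add: lsc_def)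
qed

lemma lsc_cmult:
  assumes f: "lsc T f" shows "lsc T (\<lambda>x. ennreal c * f x)"
proof (cases "c \<le> 0")
  case True then show ?thesis by (simp add: ennreal_neg lsc_const)
next
  case False
  then have "r < ennreal c * y \<longleftrightarrow> r / ennreal c < y" for r y
    by (subst divide_less_ennreal) (auto simp: mult.commute)
  then show ?thesis using f by (simp add: lsc_def)
qed

lemma lsc_indicator: "openin T U \<Longrightarrow> lsc T (indicator U)"
  unfolding lsc_def
proof
  fix r :: ennreal assume U: "openin T U"
  have "{x \<in> topspace T. r < indicator U x} = (if r < 1 then U \<inter> topspace T else {}) "
    by (auto simp: indicator_def split: if_splits)
  then show "openin T {x \<in> topspace T. r < indicator U x}"
    using U by auto
qed

lemma lsc_min_const: assumes "lsc T f" shows "lsc T (\<lambda>x. min c (f x))"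
  unfolding lsc_def
proof
  fix r
  have "{x \<in> topspace T. r < min c (f x)} = (if r < c then {x \<in> topspace T. r < f x} else {})"
    by auto
  then show "openin T {x \<in> topspace T. r < min c (f x)}" using assms by (simp add: lsc_def)
qed

lemma lsc_of_closed_sublevel:
  assumes "\<And>r. r < \<infinity> \<Longrightarrow> closedin T {x \<in> topspace T. f x \<le> r}"
  shows "lsc T f"
  unfolding lsc_def
proof
  fix r
  have "{x \<in> topspace T. r < f x} = topspace T - {x \<in> topspace T. f x \<le> r}" by auto
  moreover have "{x \<in> topspace T. r < f x} = {}" if "\<not> r < \<infinity>" using that by (auto simp: less_top[symmetric])
  ultimately show "openin T {x \<in> topspace T. r < f x}"
    using assms[of r] by (metis openin_diff openin_empty openin_topspace)
qed

lemma lsc_closedin_sublevel: "lsc T f \<Longrightarrow> closedin T {x \<in> topspace T. f x \<le> r}"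
proof -
  assume "lsc T f"
  then have "openin T {x \<in> topspace T. r < f x}" by (simp add: lsc_def)
  then have "closedin T (topspace T - {x \<in> topspace T. r < f x})" by blast
  moreover have "topspace T - {x \<in> topspace T. r < f x} = {x \<in> topspace T. f x \<le> r}" by auto
  ultimately show ?thesis by simp
qed

text \<open>
  Cantor's intersection theorem for chains, the step from sets of near-minimisers to a minimiser.
\<close>

lemma compactin_chain_Inter_nonempty:
  assumes T: "Hausdorff_space T" and ne: "\<C> \<noteq> {}"
    and cpt: "\<And>C. C \<in> \<C> \<Longrightarrow> compactin T C" and C: "\<And>C. C \<in> \<C> \<Longrightarrow> C \<noteq> {}"
    and chain: "\<And>C D. C \<in> \<C> \<Longrightarrow> D \<in> \<C> \<Longrightarrow> C \<subseteq> D \<or> D \<subseteq> C"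
  shows "\<Inter>\<C> \<noteq> {}"
proof -
  have min: "\<Inter>\<F> \<in> \<F>" if "finite \<F>" "\<F> \<noteq> {}" "\<F> \<subseteq> \<C>" for \<F>
    using that
  proof (induction \<F> rule: finite_ne_induct)
    case (insert C \<F>)
    then have "C \<subseteq> \<Inter>\<F> \<or> \<Inter>\<F> \<subseteq> C" using chain by blast
    then show ?case using insert by (auto simp: Int_absorb1 Int_absorb2 inf.absorb1 inf.absorb2)
  qed simp
  obtain C0 where C0: "C0 \<in> \<C>" using ne by blast
  have "C0 \<inter> \<Inter>\<C> \<noteq> {}"
  proof -
    have "\<forall>\<U>. (\<forall>C\<in>\<U>. closedin T C) \<and> (\<forall>\<F>. finite \<F> \<and> \<F> \<subseteq> \<U> \<longrightarrow> C0 \<inter> \<Inter>\<F> \<noteq> {}) \<longrightarrow> C0 \<inter> \<Inter>\<U> \<noteq> {}"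
      using cpt[OF C0] unfolding compactin_fip by blast
    moreover have "\<forall>C\<in>\<C>. closedin T C"
      using cpt T compactin_imp_closedin by blast
    moreover have "C0 \<inter> \<Inter>\<F> \<noteq> {}" if "finite \<F>" "\<F> \<subseteq> \<C>" for \<F>
      using min[of "insert C0 \<F>"] that C0 C by fastforce
    ultimately show ?thesis by blast
  qed
  then show ?thesis by blast
qed

subsection \<open>Inf-compact functions of two variables\<close>

text \<open>
  The counterpart of \<^const>\<open>K_inf_compact\<close> for \<^typ>\<open>ennreal\<close>, where sublevel sets at \<open>\<infinity>\<close>
  must be excluded because they are everything.
\<close>

definition K_inf_compact_nn :: "'s topology \<Rightarrow> 'a topology \<Rightarrow> ('s \<times> 'a \<Rightarrow> ennreal) \<Rightarrow> bool" where
  "K_inf_compact_nn S A w \<longleftrightarrow> (\<forall>K r. compactin S K \<and> r < \<infinity> \<longrightarrow>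
     compactin (prod_topology S A) {p \<in> K \<times> topspace A. w p \<le> r})"

text \<open>
  Closedness of sublevel sets is tested on compact sets of pairs, and such a set lies in the strip
  over its projection, where sublevel sets are compact.
\<close>

lemma K_inf_compact_nn_lsc:
  assumes S: "metrizable_space S" and A: "metrizable_space A" and w: "K_inf_compact_nn S A w"
  shows "lsc (prod_topology S A) w"
proof (rule lsc_of_closed_sublevel, rule closedin_of_compact_slices)
  show m: "metrizable_space (prod_topology S A)"
    using S A by (simp add: metrizable_space_prod_topology)
  fix r :: ennreal and K assume r: "r < \<infinity>" and K: "compactin (prod_topology S A) K"
  have K1: "compactin S (fst ` K)"
    using K by (rule image_compactin) (rule continuous_map_fst)
  have Kt: "K \<subseteq> topspace S \<times> topspace A" using compactin_subset_topspace[OF K] by simp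
  have "compactin (prod_topology S A) {p \<in> fst ` K \<times> topspace A. w p \<le> r}"
    using w K1 r by (simp add: K_inf_compact_nn_def)
  then have "compactin (prod_topology S A) (K \<inter> {p \<in> fst ` K \<times> topspace A. w p \<le> r})"
    using K metrizable_imp_Hausdorff_space[OF m] by (simp add: compactin_Int)
  moreover have "K \<inter> {p \<in> fst ` K \<times> topspace A. w p \<le> r} = K \<inter> {p \<in> topspace (prod_topology S A). w p \<le> r}"
    using Kt by force
  ultimately show "compactin (prod_topology S A) (K \<inter> {p \<in> topspace (prod_topology S A). w p \<le> r})" by simp
qed auto

lemma K_inf_compact_nn_mono:
  assumes w: "K_inf_compact_nn S A w" and v: "lsc (prod_topology S A) v"
    and le: "\<And>p. p \<in> topspace S \<times> topspace A \<Longrightarrow> w p \<le> v p"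
  shows "K_inf_compact_nn S A v"
  unfolding K_inf_compact_nn_def
proof (intro allI impI)
  fix K and r :: ennreal assume Kr: "compactin S K \<and> r < \<infinity>"
  have "compactin (prod_topology S A) ({p \<in> topspace (prod_topology S A). v p \<le> r} \<inter> {p \<in> K \<times> topspace A. w p \<le> r})"
    using lsc_closedin_sublevel[OF v] w Kr by (intro closed_Int_compactin) (auto simp: K_inf_compact_nn_def)
  moreover have "{p \<in> topspace (prod_topology S A). v p \<le> r} \<inter> {p \<in> K \<times> topspace A. w p \<le> r} =
      {p \<in> K \<times> topspace A. v p \<le> r}"
    using le compactin_subset_topspace[of S K] Kr by (auto intro: order_trans)
  ultimately show "compactin (prod_topology S A) {p \<in> K \<times> topspace A. v p \<le> r}" by simp
qed

context
  fixes S :: "'s topology" and A :: "'a topology" and w :: "'s \<times> 'a \<Rightarrow> ennreal"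
  assumes S: "metrizable_space S" and A: "metrizable_space A" and w: "K_inf_compact_nn S A w"
begin

lemma compactin_action_sublevel:
  assumes F: "closedin A F" and s: "s \<in> topspace S" and r: "r < \<infinity>"
  shows "compactin A {a \<in> F. w (s, a) \<le> r}"
proof -
  have "compactin (prod_topology S A) {p \<in> {s} \<times> topspace A. w p \<le> r}"
    using w r s by (simp add: K_inf_compact_nn_def)
  then have "compactin A (snd ` {p \<in> {s} \<times> topspace A. w p \<le> r})"
    by (rule image_compactin) (rule continuous_map_snd)
  then have "compactin A (F \<inter> snd ` {p \<in> {s} \<times> topspace A. w p \<le> r})"
    using F by (rule closed_Int_compactin[rotated])
  moreover have "F \<inter> snd ` {p \<in> {s} \<times> topspace A. w p \<le> r} = {a \<in> F. w (s, a) \<le> r}"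
    using closedin_subset[OF F] by force
  ultimately show ?thesis by simp
qed

text \<open>The sublevel sets above a finite infimum are compact and nested; a common point attains it.\<close>

lemma INF_attained:
  assumes F: "closedin A F" and ne: "F \<noteq> {}" and s: "s \<in> topspace S"
  shows "\<exists>a\<in>F. w (s, a) = (INF a\<in>F. w (s, a))"
proof (cases "(INF a\<in>F. w (s, a)) = \<infinity>")
  case True
  obtain a where a: "a \<in> F" using ne by blast
  then have "(INF a\<in>F. w (s, a)) \<le> w (s, a)" by (rule INF_lower)
  then show ?thesis using True a by (intro bexI[of _ a]) (auto simp: top_unique)
next
  case False
  define m where "m = (INF a\<in>F. w (s, a))"
  have m: "m < \<infinity>" using False unfolding m_def[symmetric] by (simp add: less_top)
  have "\<Inter>((\<lambda>r. {a \<in> F. w (s, a) \<le> r}) ` {m<..<\<infinity>}) \<noteq> {}"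
  proof (rule compactin_chain_Inter_nonempty[OF metrizable_imp_Hausdorff_space[OF A]])
    obtain r0 where "m < r0" "r0 < \<infinity>" using dense[OF m] by blast
    then have "r0 \<in> {m<..<\<infinity>}" by simp
    then show "(\<lambda>r. {a \<in> F. w (s, a) \<le> r}) ` {m<..<\<infinity>} \<noteq> {}" by blast
    fix C assume "C \<in> (\<lambda>r. {a \<in> F. w (s, a) \<le> r}) ` {m<..<\<infinity>}"
    then obtain r where r: "m < r" "r < \<infinity>" and C: "C = {a \<in> F. w (s, a) \<le> r}" by auto
    show "compactin A C" unfolding C by (rule compactin_action_sublevel[OF F s r(2)])
    obtain a where "a \<in> F" "w (s, a) < r" using r(1) unfolding m_def INF_less_iff by blast
    then show "C \<noteq> {}" using less_imp_le unfolding C by blast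
  next
    fix C D assume "C \<in> (\<lambda>r. {a \<in> F. w (s, a) \<le> r}) ` {m<..<\<infinity>}" "D \<in> (\<lambda>r. {a \<in> F. w (s, a) \<le> r}) ` {m<..<\<infinity>}"
    then obtain r r' where "C = {a \<in> F. w (s, a) \<le> r}" "D = {a \<in> F. w (s, a) \<le> r'}" by auto
    then show "C \<subseteq> D \<or> D \<subseteq> C" by (cases "r \<le> r'") (auto intro: order_trans)
  qed
  then obtain a where "a \<in> \<Inter>((\<lambda>r. {a \<in> F. w (s, a) \<le> r}) ` {m<..<\<infinity>})" by blast
  then have a: "a \<in> F \<and> w (s, a) \<le> r" if "m < r" "r < \<infinity>" for r using that by simp
  have "a \<in> F" using a dense[OF m] by blast
  moreover have "w (s, a) \<le> m" using a m by (metis dense_le_bounded dense_ge_bounded)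
  moreover have "m \<le> w (s, a)" unfolding m_def using \<open>a \<in> F\<close> by (rule INF_lower)
  ultimately show ?thesis unfolding m_def[symmetric] by force
qed

text \<open>
  A sublevel set of the infimum is the projection of a compact sublevel set because minimisers
  exist. Arbitrary closed \<open>F\<close> are needed for the measurability of the set of minimisers.
\<close>

lemma lsc_INF_closedin:
  assumes F: "closedin A F"
  shows "lsc S (\<lambda>s. INF a\<in>F. w (s, a))"
proof (cases "F = {}")
  case True then show ?thesis by (simp add: lsc_const)
next
  case False
  show ?thesis
  proof (rule lsc_of_closed_sublevel, rule closedin_of_compact_slices[OF S])
    fix r :: ennreal and K assume r: "r < \<infinity>" and K: "compactin S K"
    have "compactin (prod_topology S A) {p \<in> K \<times> topspace A. w p \<le> r}"
      using w K r by (simp add: K_inf_compact_nn_def)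
    then have "compactin (prod_topology S A) ((topspace S \<times> F) \<inter> {p \<in> K \<times> topspace A. w p \<le> r})"
      using F by (intro closed_Int_compactin) (auto simp: closedin_prod_Times_iff)
    then have "compactin S (fst ` ((topspace S \<times> F) \<inter> {p \<in> K \<times> topspace A. w p \<le> r}))"
      by (rule image_compactin) (rule continuous_map_fst)
    moreover have "fst ` ((topspace S \<times> F) \<inter> {p \<in> K \<times> topspace A. w p \<le> r}) =
        K \<inter> {s \<in> topspace S. (INF a\<in>F. w (s, a)) \<le> r}"
    proof (intro equalityI subsetI)
      fix s assume s: "s \<in> K \<inter> {s \<in> topspace S. (INF a\<in>F. w (s, a)) \<le> r}"
      then obtain a where "a \<in> F" "w (s, a) = (INF a\<in>F. w (s, a))"
        using INF_attained[OF F False, of s] by auto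
      with s closedin_subset[OF F] show "s \<in> fst ` ((topspace S \<times> F) \<inter> {p \<in> K \<times> topspace A. w p \<le> r})"
        by (intro image_eqI[of _ _ "(s, a)"]) auto
    qed (auto intro: INF_lower2)
    ultimately show "compactin S (K \<inter> {s \<in> topspace S. (INF a\<in>F. w (s, a)) \<le> r})" by simp
  qed auto
qed

end

subsection \<open>Selection\<close>

text \<open>
  The selector minimises the members of a countable point-separating family of continuous functions
  one after the other; the sets of minimisers shrink to a point, and each stage inherits
  measurability because minimality need only be tested at rational levels.
\<close>

primrec lex_min :: "(nat \<Rightarrow> 'a \<Rightarrow> real) \<Rightarrow> 'a set \<Rightarrow> nat \<Rightarrow> 'a set" where
  "lex_min h D 0 = D"
| "lex_min h D (Suc k) = {a \<in> lex_min h D k. \<forall>b \<in> lex_min h D k. h k a \<le> h k b}"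

lemma lex_min_antimono: "i \<le> j \<Longrightarrow> lex_min h D j \<subseteq> lex_min h D i"
  by (induction rule: dec_induct) auto

lemma compactin_real_sublevel:
  assumes "compactin A D" "continuous_map A euclideanreal h"
  shows "compactin A {a \<in> D. h a \<le> (r::real)}"
proof -
  have "closedin A {a \<in> topspace A. h a \<in> {..r}}"
    using assms(2) by (rule closedin_continuous_map_preimage) simp
  then have "compactin A (D \<inter> {a \<in> topspace A. h a \<in> {..r}})"
    using assms(1) by (rule compact_Int_closedin[rotated])
  moreover have "D \<inter> {a \<in> topspace A. h a \<in> {..r}} = {a \<in> D. h a \<le> r}"
    using compactin_subset_topspace[OF assms(1)] by auto
  ultimately show ?thesis by simp
qed

lemma exists_min_of_rational_levels:
  fixes m :: real
  assumes A: "Hausdorff_space A" and D: "compactin A D" and h: "continuous_map A euclideanreal h"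
    and ne: "\<And>r. r \<in> \<rat> \<Longrightarrow> m < r \<Longrightarrow> {a \<in> D. h a \<le> r} \<noteq> {}"
  shows "\<exists>a\<in>D. h a \<le> m"
proof -
  have "\<Inter>((\<lambda>r. {a \<in> D. h a \<le> r}) ` {r \<in> \<rat>. m < r}) \<noteq> {}"
  proof (rule compactin_chain_Inter_nonempty[OF A])
    show "(\<lambda>r. {a \<in> D. h a \<le> r}) ` {r \<in> \<rat>. m < r} \<noteq> {}"
      using Rats_dense_in_real[of m "m + 1"] by auto
    fix C assume "C \<in> (\<lambda>r. {a \<in> D. h a \<le> r}) ` {r \<in> \<rat>. m < r}"
    then show "compactin A C" "C \<noteq> {}" using ne compactin_real_sublevel[OF D h] by auto
  next
    fix C C' assume "C \<in> (\<lambda>r. {a \<in> D. h a \<le> r}) ` {r \<in> \<rat>. m < r}" "C' \<in> (\<lambda>r. {a \<in> D. h a \<le> r}) ` {r \<in> \<rat>. m < r}"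
    then obtain r r' where "C = {a \<in> D. h a \<le> r}" "C' = {a \<in> D. h a \<le> r'}" by auto
    then show "C \<subseteq> C' \<or> C' \<subseteq> C" by (cases "r \<le> r'") (auto intro: order_trans)
  qed
  then obtain a where a: "\<And>r. r \<in> \<rat> \<Longrightarrow> m < r \<Longrightarrow> a \<in> D \<and> h a \<le> r" by auto
  have "a \<in> D" using a Rats_dense_in_real[of m "m + 1"] by auto
  moreover have "h a \<le> m"
  proof (rule ccontr)
    assume "\<not> h a \<le> m"
    then obtain r where "r \<in> \<rat>" "m < r" "r < h a" using Rats_dense_in_real[of m "h a"] by auto
    then show False using a by force
  qed
  ultimately show ?thesis by blast
qed

lemma exists_min_compactin:
  assumes A: "Hausdorff_space A" and D: "compactin A D" "D \<noteq> {}" and h: "continuous_map A euclideanreal h"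
  shows "\<exists>a\<in>D. \<forall>b\<in>D. h a \<le> (h b :: real)"
proof -
  have "compact (h ` D)" "h ` D \<noteq> {}" using image_compactin[OF D(1) h] D(2) by auto
  then show ?thesis using compact_attains_inf[of "h ` D"] by auto
qed

lemma lex_min_compactin:
  assumes A: "Hausdorff_space A" and D: "compactin A D" "D \<noteq> {}"
    and h: "\<And>k. continuous_map A euclideanreal (h k)"
  shows "compactin A (lex_min h D k) \<and> lex_min h D k \<noteq> {}"
proof (induction k)
  case (Suc k)
  then obtain a where a: "a \<in> lex_min h D k" "\<And>b. b \<in> lex_min h D k \<Longrightarrow> h k a \<le> h k b"
    using exists_min_compactin[OF A _ _ h[of k], of "lex_min h D k"] by blast
  then have "lex_min h D (Suc k) = {b \<in> lex_min h D k. h k b \<le> h k a}"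
    by (auto intro: order_trans)
  moreover have "compactin A {b \<in> lex_min h D k. h k b \<le> h k a}"
    using compactin_real_sublevel[OF _ h[of k]] Suc by blast
  ultimately show ?case using a by auto
qed (use D in simp)

proposition measurable_selection_compact:
  fixes A :: "'a topology" and \<Psi> :: "'s \<Rightarrow> 'a set"
  assumes A: "separable_metrizable A"
    and \<Psi>: "\<And>s. s \<in> space N \<Longrightarrow> compactin A (\<Psi> s) \<and> \<Psi> s \<noteq> {}"
    and meas: "\<And>F. closedin A F \<Longrightarrow> {s \<in> space N. \<Psi> s \<inter> F \<noteq> {}} \<in> sets N"
  shows "\<exists>\<phi>\<in>N \<rightarrow>\<^sub>M borel_of A. \<forall>s\<in>space N. \<phi> s \<in> \<Psi> s"
proof -
  have Hd: "Hausdorff_space A" using A metrizable_imp_Hausdorff_space by (auto simp: separable_metrizable_def)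
  obtain F :: "('a \<Rightarrow> real) set" where F: "countable F" "(\<lambda>_. 0) \<in> F"
    "\<And>f. f \<in> F \<Longrightarrow> continuous_map A euclideanreal f"
    "\<And>U x. openin A U \<Longrightarrow> x \<in> U \<Longrightarrow> \<exists>f\<in>F. f x = 1 \<and> (\<forall>y\<in>topspace A - U. f y = 0)"
    using countable_Urysohn_family[OF A] by metis
  define h where "h = from_nat_into F"
  have hF: "h k \<in> F" for k using F(2) by (auto simp: h_def intro!: from_nat_into)
  have h: "continuous_map A euclideanreal (h k)" for k using F(3) hF .
  have sep: "\<exists>k. h k x \<noteq> h k y" if xy: "x \<in> topspace A" "y \<in> topspace A" "x \<noteq> y" for x y
  proof -
    obtain U V where "openin A U" "x \<in> U" "y \<in> V" "disjnt U V"
      using Hd xy unfolding Hausdorff_space_def by metis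
    then obtain f where f: "f \<in> F" "f x = 1" "f y = 0"
      using F(4)[of U x] xy by (auto simp: disjnt_iff)
    moreover obtain k where "h k = f" using f(1) F(1) by (metis h_def from_nat_into_surj)
    ultimately show ?thesis by (intro exI[of _ k]) auto
  qed
  define L where "L s k = lex_min h (\<Psi> s) k" for s k
  have L: "compactin A (L s k)" "L s k \<noteq> {}" if "s \<in> space N" for s k
    using lex_min_compactin[OF Hd _ _ h] \<Psi>[OF that] by (auto simp: L_def)
  have Lchain: "L s i \<subseteq> L s j \<or> L s j \<subseteq> L s i" for s i j
    unfolding L_def by (metis lex_min_antimono nat_le_linear)
  have measL: "{s \<in> space N. L s k \<inter> F \<noteq> {}} \<in> sets N" if "closedin A F" for k F
    using that
  proof (induction k arbitrary: F)
    case 0 then show ?case using meas by (simp add: L_def)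
  next
    case (Suc k)
    let ?le = "\<lambda>r. {a \<in> topspace A. h k a \<in> {..r}}"
    have cl: "closedin A (?le r)" for r :: real
      using h by (rule closedin_continuous_map_preimage) simp
    \<comment> \<open>\<open>F\<close> contains a minimiser iff no rational level separates the minima over \<open>L s k\<close> and \<open>L s k \<inter> F\<close>\<close>
    have iff: "L s (Suc k) \<inter> F \<noteq> {} \<longleftrightarrow>
        (\<forall>r\<in>\<rat>. L s k \<inter> ?le r \<noteq> {} \<longrightarrow> L s k \<inter> (F \<inter> ?le r) \<noteq> {})" if s: "s \<in> space N" for s
    proof
      assume "L s (Suc k) \<inter> F \<noteq> {}"
      then obtain a where "a \<in> L s k" "a \<in> F" "\<And>b. b \<in> L s k \<Longrightarrow> h k a \<le> h k b" by (auto simp: L_def)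
      then have a: "a \<in> L s k" "a \<in> F \<inter> ?le r" if "b \<in> L s k \<inter> ?le r" for b r
        using that closedin_subset[OF Suc.prems] by (auto intro: order_trans)
      show "\<forall>r\<in>\<rat>. L s k \<inter> ?le r \<noteq> {} \<longrightarrow> L s k \<inter> (F \<inter> ?le r) \<noteq> {}"
        using a by blast
    next
      assume R: "\<forall>r\<in>\<rat>. L s k \<inter> ?le r \<noteq> {} \<longrightarrow> L s k \<inter> (F \<inter> ?le r) \<noteq> {}"
      obtain a where a: "a \<in> L s k" "\<And>b. b \<in> L s k \<Longrightarrow> h k a \<le> h k b"
        using exists_min_compactin[OF Hd L[OF s] h[of k]] by blast
      have aA: "a \<in> topspace A" using a(1) compactin_subset_topspace[OF L(1)[OF s]] by blast
      have "\<exists>b\<in>F \<inter> L s k. h k b \<le> h k a"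
      proof (rule exists_min_of_rational_levels[OF Hd _ h])
        show "compactin A (F \<inter> L s k)" using Suc.prems L(1)[OF s] by (rule closed_Int_compactin)
        fix r :: real assume r: "r \<in> \<rat>" "h k a < r"
        then have "a \<in> L s k \<inter> ?le r" using a(1) aA by auto
        then show "{b \<in> F \<inter> L s k. h k b \<le> r} \<noteq> {}" using R r(1) by blast
      qed
      then show "L s (Suc k) \<inter> F \<noteq> {}" using a by (auto simp: L_def intro: order_trans)
    qed
    have "{s \<in> space N. L s (Suc k) \<inter> F \<noteq> {}} = {s \<in> space N. \<forall>r\<in>\<rat>.
        s \<in> {s \<in> space N. L s k \<inter> ?le r \<noteq> {}} \<longrightarrow> s \<in> {s \<in> space N. L s k \<inter> (F \<inter> ?le r) \<noteq> {}}}"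
    proof (rule Collect_cong, rule conj_cong[OF refl])
      fix s assume s: "s \<in> space N"
      then show "L s (Suc k) \<inter> F \<noteq> {} \<longleftrightarrow> (\<forall>r\<in>\<rat>.
          s \<in> {s \<in> space N. L s k \<inter> ?le r \<noteq> {}} \<longrightarrow> s \<in> {s \<in> space N. L s k \<inter> (F \<inter> ?le r) \<noteq> {}})"
        unfolding iff[OF s] mem_Collect_eq by blast
    qed
    also have "\<dots> \<in> sets N"
    proof (rule sets.sets_Collect_countable_All'[OF _ countable_rat])
      fix r :: real
      have "{s \<in> space N. L s k \<inter> ?le r \<noteq> {}} \<in> sets N" "{s \<in> space N. L s k \<inter> (F \<inter> ?le r) \<noteq> {}} \<in> sets N"
        using Suc.IH cl Suc.prems by (auto intro!: closedin_Int)
      then show "{s \<in> space N. s \<in> {s \<in> space N. L s k \<inter> ?le r \<noteq> {}} \<longrightarrow>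
          s \<in> {s \<in> space N. L s k \<inter> (F \<inter> ?le r) \<noteq> {}}} \<in> sets N"
        by measurable
    qed
    finally show ?case .
  qed
  define \<phi> where "\<phi> s = (SOME a. a \<in> (\<Inter>k. L s k))" for s
  have chain: "\<Inter>(range (\<lambda>k. L s k \<inter> F)) \<noteq> {}"
    if "s \<in> space N" "closedin A F" "\<And>k. L s k \<inter> F \<noteq> {}" for s F
  proof (rule compactin_chain_Inter_nonempty[OF Hd])
    show "compactin A C" if "C \<in> range (\<lambda>k. L s k \<inter> F)" for C
      using that L(1)[OF \<open>s \<in> space N\<close>] \<open>closedin A F\<close> by (auto intro!: compact_Int_closedin)
    show "C \<noteq> {}" if "C \<in> range (\<lambda>k. L s k \<inter> F)" for C
      using that \<open>\<And>k. L s k \<inter> F \<noteq> {}\<close> by auto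
    show "C \<subseteq> D \<or> D \<subseteq> C" if CD: "C \<in> range (\<lambda>k. L s k \<inter> F)" "D \<in> range (\<lambda>k. L s k \<inter> F)" for C D
    proof -
      obtain i j where "C = L s i \<inter> F" "D = L s j \<inter> F" using CD by blast
      then show ?thesis using Lchain[of s i j] by blast
    qed
  qed auto
  have \<phi>: "\<phi> s \<in> L s k" if s: "s \<in> space N" for s k
  proof -
    have "L s k \<inter> topspace A \<noteq> {}" for k
      using L[OF s] compactin_subset_topspace by (metis inf.absorb1)
    then have "\<exists>a. a \<in> (\<Inter>k. L s k)" using chain[OF s closedin_topspace] by auto
    then have "\<phi> s \<in> (\<Inter>k. L s k)" unfolding \<phi>_def by (rule someI_ex)
    then show ?thesis by blast
  qed
  have uniq: "a = b" if s: "s \<in> space N" and "\<And>k. a \<in> L s k" "\<And>k. b \<in> L s k" for a b s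
  proof (rule ccontr)
    assume "a \<noteq> b"
    moreover have "a \<in> topspace A" "b \<in> topspace A"
      using that compactin_subset_topspace[OF L(1)[OF s]] by blast+
    ultimately obtain k where "h k a \<noteq> h k b" using sep by blast
    moreover have "h k a \<le> h k b" "h k b \<le> h k a"
      using that(2)[of "Suc k"] that(3)[of "Suc k"] that(2)[of k] that(3)[of k] by (auto simp: L_def)
    ultimately show False by simp
  qed
  have pre: "{s \<in> space N. \<phi> s \<in> F} = {s \<in> space N. \<forall>k. L s k \<inter> F \<noteq> {}}" if F: "closedin A F" for F
  proof (intro Collect_cong conj_cong refl iffI allI)
    show "L s k \<inter> F \<noteq> {}" if "s \<in> space N" "\<phi> s \<in> F" for s k using \<phi>[OF that(1)] that(2) by blast
    fix s assume s: "s \<in> space N" "\<forall>k. L s k \<inter> F \<noteq> {}"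
    then obtain a where "a \<in> F" "\<And>k. a \<in> L s k" using chain[OF s(1) F] by auto
    then show "\<phi> s \<in> F" using uniq[OF s(1), of a "\<phi> s"] \<phi>[OF s(1)] by auto
  qed
  have "\<phi> \<in> N \<rightarrow>\<^sub>M borel_of A"
    unfolding borel_of_def
  proof (rule measurable_measure_of)
    show "\<phi> \<in> space N \<rightarrow> topspace A"
      using \<phi> L compactin_subset_topspace by fastforce
    fix U assume "U \<in> {U. openin A U}"
    then have cl: "closedin A (topspace A - U)" by blast
    have "{s \<in> space N. \<phi> s \<in> topspace A - U} \<in> sets N"
      unfolding pre[OF cl] using measL[OF cl] by (auto intro!: sets.sets_Collect_countable_All)
    then have "space N - {s \<in> space N. \<phi> s \<in> topspace A - U} \<in> sets N" by (rule sets.compl_sets)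
    moreover have "space N - {s \<in> space N. \<phi> s \<in> topspace A - U} = \<phi> -` U \<inter> space N"
      using \<open>\<phi> \<in> space N \<rightarrow> topspace A\<close> by auto
    ultimately show "\<phi> -` U \<inter> space N \<in> sets N" by simp
  qed (auto dest: openin_subset)
  moreover have "\<forall>s\<in>space N. \<phi> s \<in> \<Psi> s" using \<phi>[of _ 0] by (simp add: L_def)
  ultimately show ?thesis by blast
qed

section \<open>Weak convergence\<close>

lemma prob_measures_eq_space: "prob_measures T = space (prob_algebra (borel_of T))"
  by (auto simp: prob_measures_def space_prob_algebra)

lemma prob_measuresD:
  assumes "\<mu> \<in> prob_measures T"
  shows "prob_space \<mu>" "sets \<mu> = sets (borel_of T)" "space \<mu> = topspace T"
  using assms sets_eq_imp_space_eq[of \<mu> "borel_of T"] by (auto simp: prob_measures_def)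

lemma prob_measures_integrable:
  fixes f :: "'a \<Rightarrow> real"
  assumes "\<mu> \<in> prob_measures T" "f \<in> borel_measurable (borel_of T)" "\<And>x. x \<in> topspace T \<Longrightarrow> \<bar>f x\<bar> \<le> B"
  shows "integrable \<mu> f"
proof -
  interpret prob_space \<mu> using prob_measuresD(1)[OF assms(1)] .
  show ?thesis
    by (rule integrable_const_bound[of _ B])
      (use assms prob_measuresD[OF assms(1)] in \<open>auto cong: measurable_cong_sets\<close>)
qed

lemma prob_measures_integral_bounds:
  fixes f :: "'a \<Rightarrow> real"
  assumes "\<mu> \<in> prob_measures T" "f \<in> borel_measurable (borel_of T)" "\<And>x. x \<in> topspace T \<Longrightarrow> a \<le> f x \<and> f x \<le> b"
  shows "a \<le> (\<integral>x. f x \<partial>\<mu>)" "(\<integral>x. f x \<partial>\<mu>) \<le> b"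
proof -
  interpret prob_space \<mu> using prob_measuresD(1)[OF assms(1)] .
  have i: "integrable \<mu> f"
    by (rule prob_measures_integrable[OF assms(1,2), of "max \<bar>a\<bar> \<bar>b\<bar>"]) (use assms(3) in force)
  show "a \<le> (\<integral>x. f x \<partial>\<mu>)" by (rule integral_ge_const[OF i]) (use assms prob_measuresD[OF assms(1)] in auto)
  show "(\<integral>x. f x \<partial>\<mu>) \<le> b" by (rule integral_le_const[OF i]) (use assms prob_measuresD[OF assms(1)] in auto)
qed

subsection \<open>Integrals of semicontinuous functions\<close>

text \<open>Counting the levels strictly below \<open>y\<close> rounds \<open>y\<close> down to the grid of mesh \<open>c / n\<close>.\<close>

lemma card_levels_below:
  fixes y c :: real and n :: nat
  assumes "0 \<le> y" "y \<le> c" "0 < c" "0 < n"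
  defines "k \<equiv> card {i \<in> {1..n}. c / n * i < y}"
  shows "c / n * k \<le> y" "y \<le> c / n * k + c / n"
proof -
  define t where "t = y * n / c"
  have y: "y = c / n * t" using assms by (simp add: t_def)
  have t: "0 \<le> t" "t \<le> n" using assms by (auto simp: t_def field_simps)
  have cn: "0 < c / n" using assms by simp
  have iff: "c / n * i < y \<longleftrightarrow> real i < t" for i :: nat
    unfolding y using cn by (simp only: mult_less_cancel_left_pos)
  have "{i \<in> {1..n}. c / n * i < y} = {1..<nat \<lceil>t\<rceil>}"
  proof -
    have "real i < t \<longleftrightarrow> i < nat \<lceil>t\<rceil>" for i using t(1) by linarith
    moreover have "nat \<lceil>t\<rceil> \<le> n" using t by linarith
    ultimately show ?thesis unfolding iff by (intro set_eqI) (simp only: mem_Collect_eq atLeastAtMost_iff atLeastLessThan_iff, linarith)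
  qed
  then have "k = nat \<lceil>t\<rceil> - 1" by (simp add: k_def)
  then have "real k \<le> t" "t \<le> real k + 1" using t(1) by linarith+
  then have "c / n * k \<le> c / n * t" "c / n * t \<le> c / n * (k + 1)"
    using cn mult_left_mono[of "real k" t "c / n"] mult_left_mono[of t "real k + 1" "c / n"]
    by (simp_all add: add.commute)
  then show "c / n * k \<le> y" "y \<le> c / n * k + c / n"
    unfolding y by (simp_all add: distrib_left)
qed

text \<open>
  Staircase approximation from below: an integral of a semicontinuous function is a supremum of
  finite sums of measures of open sets. The topology \<open>W\<close> is arbitrary because the lemma serves both
  to identify the weak topology and to work in it.
\<close>

lemma lsc_nn_integral_of_open_sets:
  assumes W: "topspace W \<subseteq> prob_measures T"
    and U: "\<And>U. openin T U \<Longrightarrow> lsc W (\<lambda>\<mu>. emeasure \<mu> U)"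
    and g: "lsc T g"
  shows "lsc W (\<lambda>\<mu>. \<integral>\<^sup>+x. g x \<partial>\<mu>)"
proof -
  define h where "h m x = min (of_nat m) (g x)" for m x
  have h: "lsc T (h m)" for m unfolding h_def by (rule lsc_min_const[OF g])
  have h_meas: "h m \<in> borel_measurable (borel_of T)" for m by (rule lsc_measurable[OF h])
  have g_eq: "g x = (SUP m. h m x)" for x
    unfolding h_def inf_min[symmetric] by (simp add: SUP_inf[symmetric] ennreal_SUP_of_nat_eq_top)
  define c where "c m = real m + 1" for m :: nat
  define V where "V m n i = {x \<in> topspace T. ennreal (c m / real n * real i) < h m x}" for m n i
  have V: "openin T (V m n i)" for m n i using h unfolding V_def lsc_def by blast
  define s where "s m n x = (\<Sum>i\<in>{1..n}. ennreal (c m / real n) * indicator (V m n i) x)" for m n and x :: 'a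
  have s: "s m n x \<le> h m x \<and> h m x \<le> s m n x + ennreal (c m / n)" if x: "x \<in> topspace T" and n: "0 < n" for m n x
  proof -
    have "h m x \<le> ennreal (real m)" by (simp add: h_def ennreal_of_nat_eq_real_of_nat)
    then obtain y where y: "h m x = ennreal y" "0 \<le> y" "y \<le> c m"
      by (cases "h m x") (auto simp: c_def top_unique)
    have "s m n x = (\<Sum>i\<in>{1..n}. if c m / n * i < y then ennreal (c m / n) else 0)"
      unfolding s_def using x y by (intro sum.cong refl) (auto simp: V_def c_def ennreal_less_iff)
    also have "\<dots> = of_nat (card {i \<in> {1..n}. c m / n * i < y}) * ennreal (c m / n)"
      by (simp add: sum.If_cases Int_def)
    also have "\<dots> = ennreal (c m / n * card {i \<in> {1..n}. c m / n * i < y})"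
      by (simp add: ennreal_of_nat_eq_real_of_nat mult.commute c_def flip: ennreal_mult)
    finally show ?thesis
      using card_levels_below[OF y(2,3) _ n] by (simp add: y c_def flip: ennreal_plus)
  qed
  have s_int: "(\<integral>\<^sup>+x. s m n x \<partial>\<mu>) = (\<Sum>i\<in>{1..n}. ennreal (c m / n) * emeasure \<mu> (V m n i))"
    if "\<mu> \<in> topspace W" for m n \<mu>
  proof -
    have "V m n i \<in> sets \<mu>" for i
      using prob_measuresD(2)[of \<mu> T] that W borel_of_openin[OF V] by auto
    then show ?thesis unfolding s_def
      by (subst nn_integral_sum) (simp_all add: nn_integral_cmult)
  qed
  have h_int: "(\<integral>\<^sup>+x. h m x \<partial>\<mu>) = (SUP n. \<integral>\<^sup>+x. s m (Suc n) x \<partial>\<mu>)" if \<mu>: "\<mu> \<in> topspace W" for m \<mu>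
  proof (rule antisym)
    have sp: "space \<mu> = topspace T" "prob_space \<mu>" "sets \<mu> = sets (borel_of T)"
      using prob_measuresD[of \<mu> T] \<mu> W by auto
    show "(SUP n. \<integral>\<^sup>+x. s m (Suc n) x \<partial>\<mu>) \<le> (\<integral>\<^sup>+x. h m x \<partial>\<mu>)"
      using s sp by (intro SUP_least nn_integral_mono) auto
    show "(\<integral>\<^sup>+x. h m x \<partial>\<mu>) \<le> (SUP n. \<integral>\<^sup>+x. s m (Suc n) x \<partial>\<mu>)"
    proof (rule ennreal_le_epsilon)
      fix e :: real assume e: "0 < e"
      obtain n :: nat where "c m / e < n" using reals_Archimedean2 by blast
      then have n: "c m / Suc n \<le> e" using e by (simp add: field_simps c_def)
      have "(\<integral>\<^sup>+x. h m x \<partial>\<mu>) \<le> (\<integral>\<^sup>+x. s m (Suc n) x + ennreal (c m / Suc n) \<partial>\<mu>)"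
        using s[of _ "Suc n" m] sp by (intro nn_integral_mono) (simp del: of_nat_Suc)
      also have "\<dots> = (\<integral>\<^sup>+x. s m (Suc n) x \<partial>\<mu>) + ennreal (c m / Suc n)"
      proof -
        have "s m (Suc n) \<in> borel_measurable \<mu>"
          unfolding s_def using borel_of_openin[OF V] sp(3)
          by (intro borel_measurable_sum borel_measurable_times_ennreal borel_measurable_indicator) auto
        then show ?thesis
          using prob_space.emeasure_space_1[OF sp(2)] by (simp add: nn_integral_add)
      qed
      also have "\<dots> \<le> (SUP n. \<integral>\<^sup>+x. s m (Suc n) x \<partial>\<mu>) + ennreal e"
        using n by (intro add_mono SUP_upper ennreal_leI) auto
      finally show "(\<integral>\<^sup>+x. h m x \<partial>\<mu>) \<le> (SUP n. \<integral>\<^sup>+x. s m (Suc n) x \<partial>\<mu>) + ennreal e" .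
    qed
  qed
  have g_int: "(\<integral>\<^sup>+x. g x \<partial>\<mu>) = (SUP m. SUP n. \<Sum>i\<in>{1..Suc n}. ennreal (c m / Suc n) * emeasure \<mu> (V m (Suc n) i))"
    if \<mu>: "\<mu> \<in> topspace W" for \<mu>
  proof -
    have "incseq h"
    proof (intro incseq_SucI le_funI)
      show "h m x \<le> h (Suc m) x" for m x
        unfolding h_def by (rule min.mono) (simp_all only: of_nat_mono le_SucI order_refl)
    qed
    then have "(\<integral>\<^sup>+x. g x \<partial>\<mu>) = (SUP m. \<integral>\<^sup>+x. h m x \<partial>\<mu>)"
      unfolding g_eq using h_meas prob_measuresD(2)[of \<mu> T] \<mu> W
      by (intro nn_integral_monotone_convergence_SUP) (auto cong: measurable_cong_sets)
    then show ?thesis using h_int[OF \<mu>] s_int[OF \<mu>] by simp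
  qed
  have "lsc W (\<lambda>\<mu>. SUP m. SUP n. \<Sum>i\<in>{1..Suc n}. ennreal (c m / Suc n) * emeasure \<mu> (V m (Suc n) i))"
    by (intro lsc_SUP lsc_sum lsc_cmult U V) auto
  then show ?thesis by (subst lsc_cong[OF g_int])
qed

subsection \<open>The weak topology is separable and metrizable\<close>

lemma openin_weak_topology_integral:
  assumes "continuous_map T euclideanreal f" "bounded (f ` topspace T)" "open U"
  shows "openin (weak_topology T) {\<mu> \<in> prob_measures T. (\<integral>x. f x \<partial>\<mu>) \<in> U}"
  unfolding weak_topology_def by (rule topology_generated_by_Basis) (use assms in blast)

lemma nn_integral_eq_ennreal_integral:
  fixes f :: "'a \<Rightarrow> real"
  assumes \<mu>: "\<mu> \<in> prob_measures T" and f: "f \<in> borel_measurable (borel_of T)"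
    and b: "\<And>x. x \<in> topspace T \<Longrightarrow> 0 \<le> f x \<and> f x \<le> B"
  shows "(\<integral>\<^sup>+x. ennreal (f x) \<partial>\<mu>) = ennreal (\<integral>x. f x \<partial>\<mu>)"
  by (rule nn_integral_eq_integral)
    (use b prob_measures_integrable[OF \<mu> f, of B] prob_measuresD[OF \<mu>] in \<open>auto simp: abs_le_iff\<close>)

lemma lsc_continuous_ennreal:
  assumes f: "continuous_map T euclideanreal f"
  shows "lsc T (\<lambda>x. ennreal (f x))"
  unfolding lsc_def
proof
  fix r
  show "openin T {x \<in> topspace T. r < ennreal (f x)}"
  proof (cases r)
    case (real t)
    then have "{x \<in> topspace T. r < ennreal (f x)} = {x \<in> topspace T. f x \<in> {t<..}}"
      by (auto simp: ennreal_less_iff)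
    then show ?thesis using openin_continuous_map_preimage[OF f, of "{t<..}"] by simp
  qed simp
qed

text \<open>
  Monotone convergence along the approximating functions exhibits the measure of an open set as a
  supremum of integrals that are semicontinuous by assumption.
\<close>

lemma lsc_emeasure_of_family:
  assumes W: "topspace W \<subseteq> prob_measures T"
    and "approximating_family T E"
    and open_E: "\<And>f r. f \<in> E \<Longrightarrow> openin W {\<mu> \<in> topspace W. r < (\<integral>x. f x \<partial>\<mu>)}"
    and U: "openin T U"
  shows "lsc W (\<lambda>\<mu>. emeasure \<mu> U)"
proof -
  note E = approximating_familyD(3-5)[OF assms(2)]
  obtain g :: "nat \<Rightarrow> 'a \<Rightarrow> real" where g: "\<And>n. g n \<in> E" "\<And>x. x \<in> topspace T \<Longrightarrow> incseq (\<lambda>n::nat. g n x)"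
    "\<And>x. x \<in> topspace T \<Longrightarrow> (\<lambda>n. g n x) \<longlonglongrightarrow> indicator U x"
    using E(3)[OF U] by (metis range_subsetD)
  have gm: "g n \<in> borel_measurable (borel_of T)" for n
    by (rule measurable_euclideanreal_borel_of[OF E(1)[OF g(1)]])
  have eq: "emeasure \<mu> U = (SUP n. ennreal (\<integral>x. g n x \<partial>\<mu>))" if \<mu>: "\<mu> \<in> topspace W" for \<mu>
  proof -
    have \<mu>': "\<mu> \<in> prob_measures T" using \<mu> W by blast
    note pm = prob_measuresD[OF \<mu>']
    have "emeasure \<mu> U = (\<integral>\<^sup>+x. indicator U x \<partial>\<mu>)"
      using borel_of_openin[OF U] pm by simp
    also have "\<dots> = (\<integral>\<^sup>+x. (SUP n. ennreal (g n x)) \<partial>\<mu>)"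
    proof (rule nn_integral_cong)
      fix x assume "x \<in> space \<mu>"
      then have x: "x \<in> topspace T" using pm by simp
      have "(\<lambda>n. ennreal (g n x)) \<longlonglongrightarrow> ennreal (indicator U x)"
        using g(3)[OF x] by (rule tendsto_ennrealI)
      moreover have "incseq (\<lambda>n. ennreal (g n x))"
        using g(2)[OF x] by (auto simp: incseq_def intro: ennreal_leI)
      ultimately show "indicator U x = (SUP n. ennreal (g n x))"
        using LIMSEQ_SUP LIMSEQ_unique by (metis ennreal_indicator)
    qed
    also have "\<dots> = (SUP n. \<integral>\<^sup>+x. ennreal (g n x) \<partial>\<mu>)"
    proof (rule nn_integral_monotone_convergence_SUP_AE)
      show "AE x in \<mu>. ennreal (g i x) \<le> ennreal (g (Suc i) x)" for i
        using g(2) pm by (auto simp: incseq_def intro!: AE_I2 ennreal_leI)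
      show "(\<lambda>x. ennreal (g i x)) \<in> borel_measurable \<mu>" for i
        using gm[of i] pm by (auto cong: measurable_cong_sets)
    qed
    also have "\<dots> = (SUP n. ennreal (\<integral>x. g n x \<partial>\<mu>))"
      using nn_integral_eq_ennreal_integral[OF \<mu>' gm, of _ 1] E(2)[OF g(1)] by simp
    finally show ?thesis .
  qed
  have "lsc W (\<lambda>\<mu>. ennreal (\<integral>x. g n x \<partial>\<mu>))" for n
    unfolding lsc_def
  proof
    fix r show "openin W {\<mu> \<in> topspace W. r < ennreal (\<integral>x. g n x \<partial>\<mu>)}"
      using open_E[OF g(1)] by (cases r) (auto simp: ennreal_less_iff)
  qed
  then have "lsc W (\<lambda>\<mu>. SUP n. ennreal (\<integral>x. g n x \<partial>\<mu>))" by (intro lsc_SUP)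
  then show ?thesis by (subst lsc_cong[OF eq])
qed

theorem lsc_nn_integral_weak:
  assumes T: "separable_metrizable T" and g: "lsc T g"
  shows "lsc (weak_topology T) (\<lambda>\<mu>. \<integral>\<^sup>+x. g x \<partial>\<mu>)"
proof -
  obtain E where "approximating_family T E" using exists_approximating_family[OF T] ..
  note E = this approximating_familyD[OF this]
  show ?thesis
  proof (rule lsc_nn_integral_of_open_sets[OF _ _ g])
    fix U assume U: "openin T U"
    show "lsc (weak_topology T) (\<lambda>\<mu>. emeasure \<mu> U)"
    proof (rule lsc_emeasure_of_family[OF _ E(1) _ U])
      fix f r assume f: "f \<in> E"
      have "bounded (f ` topspace T)"
        using E(5)[OF f] by (intro boundedI[of _ 1]) auto
      from openin_weak_topology_integral[OF E(4)[OF f] this, of "{r<..}"]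
      show "openin (weak_topology T) {\<mu> \<in> topspace (weak_topology T). r < (\<integral>x. f x \<partial>\<mu>)}" by simp
    qed simp
  qed auto
qed

lemma prob_measures_eqI_open:
  assumes \<mu>: "\<mu> \<in> prob_measures T" and \<nu>: "\<nu> \<in> prob_measures T"
    and eq: "\<And>U. openin T U \<Longrightarrow> emeasure \<mu> U = emeasure \<nu> U"
  shows "\<mu> = \<nu>"
proof (rule measure_eqI_generator_eq[of "{U. openin T U}" "topspace T" \<mu> \<nu> "\<lambda>_. topspace T"])
  interpret prob_space \<mu> using prob_measuresD(1)[OF \<mu>] .
  show "emeasure \<mu> (topspace T) \<noteq> \<infinity>" for i :: nat by simp
qed (use eq prob_measuresD[OF \<mu>] prob_measuresD[OF \<nu>] in
    \<open>auto simp: Int_stable_def sets_borel_of openin_subset openin_subset[THEN subsetD]\<close>)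

text \<open>
  The topology pulled back along the integrals of a countable approximating family makes the
  measures of open sets semicontinuous, hence the integrals of all semicontinuous functions. A
  bounded continuous function is semicontinuous from both sides, so its integral is continuous
  for the pulled-back topology, which therefore is the weak topology.
\<close>

proposition weak_topology_embedding:
  fixes T :: "'a topology"
  assumes T: "separable_metrizable T"
  obtains e :: "nat \<Rightarrow> 'a \<Rightarrow> real" where
    "\<And>n. continuous_map T euclideanreal (e n)"
    "\<And>n x. x \<in> topspace T \<Longrightarrow> 0 \<le> e n x \<and> e n x \<le> 1"
    "homeomorphic_map (weak_topology T)
       (top_of_set ((\<lambda>\<mu> n. \<integral>x. e n x \<partial>\<mu>) ` prob_measures T)) (\<lambda>\<mu> n. \<integral>x. e n x \<partial>\<mu>)"
proof -
  obtain E where "approximating_family T E" using exists_approximating_family[OF T] ..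
  note E = this approximating_familyD[OF this]
  define e where "e = from_nat_into E"
  have eE: "e n \<in> E" for n by (simp add: e_def from_nat_into E(3))
  have range_e: "range e = E" by (simp add: e_def E)
  have e: "continuous_map T euclideanreal (e n)" "\<And>x. x \<in> topspace T \<Longrightarrow> 0 \<le> e n x \<and> e n x \<le> 1" for n
    using E eE by auto
  define \<Phi> where "\<Phi> \<mu> = (\<lambda>n. \<integral>x. e n x \<partial>\<mu>)" for \<mu>
  let ?P = "prob_measures T"
  define W where "W = pullback_topology ?P \<Phi> euclidean"
  have W: "openin W V \<longleftrightarrow> (\<exists>U. open U \<and> V = \<Phi> -` U \<inter> ?P)" for V
    by (simp add: W_def openin_pullback_topology)
  have topW: "topspace W = ?P" by (simp add: W_def topspace_pullback_topology)
  have coord: "openin W {\<mu> \<in> ?P. (\<integral>x. e n x \<partial>\<mu>) \<in> U}" if "open U" for n U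
  proof -
    have "open ((\<lambda>y::nat \<Rightarrow> real. y n) -` U)"
      using that by (intro open_vimage continuous_on_product_coordinates)
    then show ?thesis unfolding W by (intro exI[of _ "(\<lambda>y::nat \<Rightarrow> real. y n) -` U"]) (auto simp: \<Phi>_def)
  qed
  have lscW: "lsc W (\<lambda>\<mu>. \<integral>\<^sup>+x. g x \<partial>\<mu>)" if g: "lsc T g" for g
  proof (rule lsc_nn_integral_of_open_sets[OF _ _ g])
    fix U assume U: "openin T U"
    show "lsc W (\<lambda>\<mu>. emeasure \<mu> U)"
    proof (rule lsc_emeasure_of_family[OF _ E(1) _ U])
      fix f r assume "f \<in> E"
      then obtain n where "f = e n" using range_e by auto
      then show "openin W {\<mu> \<in> topspace W. r < (\<integral>x. f x \<partial>\<mu>)}"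
        using coord[of "{r<..}" n] by (simp add: topW)
    qed (simp add: topW)
  qed (auto simp: topW)
  have gt: "openin W {\<mu> \<in> ?P. r < (\<integral>x. f x \<partial>\<mu>)}"
    if f: "continuous_map T euclideanreal f" "\<And>x. x \<in> topspace T \<Longrightarrow> \<bar>f x\<bar> \<le> B" for f r B
  proof -
    have fm: "f \<in> borel_measurable (borel_of T)" by (rule measurable_euclideanreal_borel_of[OF f(1)])
    have eq: "r < (\<integral>x. f x \<partial>\<mu>) \<longleftrightarrow> r + B < 0 \<or> ennreal (r + B) < (\<integral>\<^sup>+x. ennreal (f x + B) \<partial>\<mu>)" if \<mu>: "\<mu> \<in> ?P" for \<mu>
    proof -
      interpret prob_space \<mu> using prob_measuresD(1)[OF \<mu>] .
      have "integrable \<mu> f" by (rule prob_measures_integrable[OF \<mu> fm f(2)])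
      then have "(\<integral>x. f x + B \<partial>\<mu>) = (\<integral>x. f x \<partial>\<mu>) + B" by (simp add: prob_space)
      moreover have "(\<integral>\<^sup>+x. ennreal (f x + B) \<partial>\<mu>) = ennreal (\<integral>x. f x + B \<partial>\<mu>)"
      proof (rule nn_integral_eq_ennreal_integral[OF \<mu>])
        show "(\<lambda>x. f x + B) \<in> borel_measurable (borel_of T)" using fm by simp
        show "0 \<le> f x + B \<and> f x + B \<le> 2 * B" if "x \<in> topspace T" for x using f(2)[OF that] by linarith
      qed
      moreover have "0 \<le> f x + B" if "x \<in> topspace T" for x using f(2)[OF that] by linarith
      then have "0 \<le> (\<integral>x. f x + B \<partial>\<mu>)"
        using prob_measuresD[OF \<mu>] by (intro integral_nonneg_AE AE_I2) auto
      ultimately show ?thesis by (cases "r + B < 0") (auto simp: ennreal_less_iff)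
    qed
    have "lsc W (\<lambda>\<mu>. \<integral>\<^sup>+x. ennreal (f x + B) \<partial>\<mu>)"
      using f(1) by (intro lscW lsc_continuous_ennreal continuous_intros) auto
    then have "openin W {\<mu> \<in> topspace W. ennreal (r + B) < (\<integral>\<^sup>+x. ennreal (f x + B) \<partial>\<mu>)}"
      by (simp add: lsc_def)
    moreover have "{\<mu> \<in> ?P. r < (\<integral>x. f x \<partial>\<mu>)} = (if r + B < 0 then topspace W else
        {\<mu> \<in> topspace W. ennreal (r + B) < (\<integral>\<^sup>+x. ennreal (f x + B) \<partial>\<mu>)})"
      using eq by (auto simp: topW)
    ultimately show ?thesis by simp
  qed
  have "weak_topology T = W"
  proof (rule topology_eq[THEN iffD2], intro allI iffI)
    fix V assume V: "openin W V"
    have "continuous_map (weak_topology T) euclidean \<Phi>"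
    proof -
      have "continuous_map (weak_topology T) (powertop_real UNIV) \<Phi>"
        unfolding continuous_map_componentwise_UNIV
      proof
        fix n
        have "bounded (e n ` topspace T)" using e(2) by (intro boundedI[of _ 1]) auto
        then show "continuous_map (weak_topology T) euclideanreal (\<lambda>\<mu>. \<Phi> \<mu> n)"
          using openin_weak_topology_integral[OF e(1)]
          by (auto simp: continuous_map_def \<Phi>_def)
      qed
      then show ?thesis by (simp add: euclidean_product_topology)
    qed
    moreover obtain U where "open U" "V = \<Phi> -` U \<inter> ?P" using V W by blast
    ultimately show "openin (weak_topology T) V"
      using openin_continuous_map_preimage[of "weak_topology T" euclidean \<Phi> U]
      by (simp add: vimage_def Int_def conj_commute)
  next
    fix V assume "openin (weak_topology T) V"
    then have "generate_topology_on {{\<mu> \<in> ?P. (\<integral>s. f s \<partial>\<mu>) \<in> U} | f U.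
        continuous_map T euclideanreal f \<and> bounded (f ` topspace T) \<and> open U} V"
      unfolding weak_topology_def by (rule openin_topology_generated_by)
    then show "openin W V"
    proof (rule generate_topology_on_coarsest[rotated 2])
      fix V assume "V \<in> {{\<mu> \<in> ?P. (\<integral>s. f s \<partial>\<mu>) \<in> U} | f U.
        continuous_map T euclideanreal f \<and> bounded (f ` topspace T) \<and> open U}"
      then obtain f U where f: "continuous_map T euclideanreal f" and b: "bounded (f ` topspace T)" and U: "open U"
        and V: "V = {\<mu> \<in> ?P. (\<integral>s. f s \<partial>\<mu>) \<in> U}" by blast
      obtain B where B: "\<And>x. x \<in> topspace T \<Longrightarrow> \<bar>f x\<bar> \<le> B" using b by (auto simp: bounded_iff)
      have "continuous_map W euclideanreal (\<lambda>\<mu>. \<integral>x. f x \<partial>\<mu>)"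
        unfolding continuous_map_upper_lower_semicontinuous_lt
      proof (intro conjI allI)
        fix r
        show "openin W {\<mu> \<in> topspace W. r < (\<integral>x. f x \<partial>\<mu>)}" using gt[OF f B] by (simp add: topW)
        show "openin W {\<mu> \<in> topspace W. (\<integral>x. f x \<partial>\<mu>) < r}"
          using gt[of "\<lambda>x. - f x" B "- r"] f B by (simp add: topW continuous_map_minus)
      qed
      then show "openin W V" using openin_continuous_map_preimage[of W euclideanreal _ U] U by (simp add: V topW)
    qed auto
  qed
  have inj: "inj_on \<Phi> ?P"
  proof (rule inj_onI)
    fix \<mu> \<nu> assume \<mu>: "\<mu> \<in> ?P" and \<nu>: "\<nu> \<in> ?P" and eq: "\<Phi> \<mu> = \<Phi> \<nu>"
    show "\<mu> = \<nu>"
    proof (rule prob_measures_eqI_open[OF \<mu> \<nu>])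
      fix U assume U: "openin T U"
      let ?I = "\<lambda>\<mu>. \<integral>\<^sup>+x. indicator U x \<partial>\<mu> :: ennreal"
      have "r < ?I \<mu> \<longleftrightarrow> r < ?I \<nu>" for r
      proof -
        have "openin W {\<mu> \<in> topspace W. r < ?I \<mu>}"
          using lscW[OF lsc_indicator[OF U]] by (simp only: lsc_def)
        then obtain U' where "{\<mu> \<in> ?P. r < ?I \<mu>} = \<Phi> -` U' \<inter> ?P"
          unfolding W topW by blast
        then have "\<And>\<mu>. \<mu> \<in> ?P \<Longrightarrow> r < ?I \<mu> \<longleftrightarrow> \<Phi> \<mu> \<in> U'" by blast
        then show ?thesis using \<mu> \<nu> eq by metis
      qed
      then have "?I \<mu> = ?I \<nu>" by (metis linorder_neqE order_less_irrefl)
      then show "emeasure \<mu> U = emeasure \<nu> U"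
        using prob_measuresD(2)[OF \<mu>] prob_measuresD(2)[OF \<nu>] borel_of_openin[OF U] by simp
    qed
  qed
  have "homeomorphic_map W (top_of_set (\<Phi> ` ?P)) \<Phi>"
  proof (rule bijective_open_imp_homeomorphic_map)
    show "continuous_map W (top_of_set (\<Phi> ` ?P)) \<Phi>"
      unfolding continuous_map_in_subtopology
      using continuous_map_pullback[of euclidean euclidean id ?P \<Phi>] by (auto simp: W_def topspace_pullback_topology)
    show "open_map W (top_of_set (\<Phi> ` ?P)) \<Phi>"
      unfolding open_map_def
    proof (intro allI impI)
      fix V assume "openin W V"
      then obtain U where "open U" "V = \<Phi> -` U \<inter> ?P" using W by blast
      then have "\<Phi> ` V = U \<inter> \<Phi> ` ?P" by auto
      then show "openin (top_of_set (\<Phi> ` ?P)) (\<Phi> ` V)"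
        using \<open>open U\<close> by (auto simp: openin_open)
    qed
  qed (auto simp: topW inj)
  then show ?thesis
    using that[of e] e unfolding \<open>weak_topology T = W\<close> \<Phi>_def by blast
qed

corollary separable_metrizable_weak_topology:
  assumes "separable_metrizable T" shows "separable_metrizable (weak_topology T)"
proof -
  obtain e :: "nat \<Rightarrow> 'a \<Rightarrow> real" where "homeomorphic_map (weak_topology T)
       (top_of_set ((\<lambda>\<mu> n. \<integral>x. e n x \<partial>\<mu>) ` prob_measures T)) (\<lambda>\<mu> n. \<integral>x. e n x \<partial>\<mu>)"
    by (rule weak_topology_embedding[OF assms])
  then have "weak_topology T homeomorphic_space top_of_set ((\<lambda>\<mu> n. \<integral>x. e n x \<partial>\<mu>) ` prob_measures T)"
    by (rule homeomorphic_map_imp_homeomorphic_space)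
  then show ?thesis
    using separable_metrizable_top_of_set[of "(\<lambda>\<mu> n. \<integral>x. e n x \<partial>\<mu>) ` prob_measures T"]
      homeomorphic_metrizable_space homeomorphic_space_second_countability
    unfolding separable_metrizable_def by blast
qed

text \<open>Countably many test functions allow null sets to be discarded once for all of them.\<close>

lemma weak_convergence_determining_family:
  fixes T :: "'a topology"
  assumes T: "separable_metrizable T"
  obtains e :: "nat \<Rightarrow> 'a \<Rightarrow> real" where
    "\<And>n. continuous_map T euclideanreal (e n)"
    "\<And>n x. x \<in> topspace T \<Longrightarrow> 0 \<le> e n x \<and> e n x \<le> 1"
    "\<And>\<mu> \<nu>. range \<mu> \<subseteq> prob_measures T \<Longrightarrow> \<nu> \<in> prob_measures T \<Longrightarrow>
       (\<And>n. (\<lambda>i. \<integral>x. e n x \<partial>\<mu> i) \<longlonglongrightarrow> (\<integral>x. e n x \<partial>\<nu>)) \<Longrightarrow>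
       limitin (weak_topology T) \<mu> \<nu> sequentially"
proof (rule weak_topology_embedding[OF T])
  fix e :: "nat \<Rightarrow> 'a \<Rightarrow> real"
  let ?\<Phi> = "\<lambda>\<mu> n. \<integral>x. e n x \<partial>\<mu>" and ?P = "prob_measures T"
  assume e: "\<And>n. continuous_map T euclideanreal (e n)" "\<And>n x. x \<in> topspace T \<Longrightarrow> 0 \<le> e n x \<and> e n x \<le> 1"
    and hom: "homeomorphic_map (weak_topology T) (top_of_set (?\<Phi> ` ?P)) ?\<Phi>"
  obtain g where g: "homeomorphic_maps (weak_topology T) (top_of_set (?\<Phi> ` ?P)) ?\<Phi> g"
    using hom homeomorphic_map_maps by blast
  have "limitin (weak_topology T) \<mu> \<nu> sequentially"
    if \<mu>: "range \<mu> \<subseteq> ?P" and \<nu>: "\<nu> \<in> ?P"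
      and lim: "\<And>n. (\<lambda>i. \<integral>x. e n x \<partial>\<mu> i) \<longlonglongrightarrow> (\<integral>x. e n x \<partial>\<nu>)" for \<mu> \<nu>
  proof -
    have "limitin (powertop_real UNIV) (\<lambda>i. ?\<Phi> (\<mu> i)) (?\<Phi> \<nu>) sequentially"
      using lim by (simp add: limitin_componentwise)
    then have "limitin euclidean (\<lambda>i. ?\<Phi> (\<mu> i)) (?\<Phi> \<nu>) sequentially"
      by (simp add: euclidean_product_topology)
    then have "limitin (top_of_set (?\<Phi> ` ?P)) (\<lambda>i. ?\<Phi> (\<mu> i)) (?\<Phi> \<nu>) sequentially"
      using \<mu> \<nu> by (auto simp: limitin_subtopology intro!: always_eventually)
    then have "limitin (weak_topology T) (g \<circ> (\<lambda>i. ?\<Phi> (\<mu> i))) (g (?\<Phi> \<nu>)) sequentially"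
      using g by (intro continuous_map_limit[of "top_of_set (?\<Phi> ` ?P)"]) (auto simp: homeomorphic_maps_def)
    moreover have "g \<circ> (\<lambda>i. ?\<Phi> (\<mu> i)) = \<mu>" "g (?\<Phi> \<nu>) = \<nu>"
      using g \<mu> \<nu> by (auto simp: homeomorphic_maps_def fun_eq_iff)
    ultimately show ?thesis by simp
  qed
  then show thesis using that[of e] e by blast
qed

lemma lsc_emeasure_weak:
  assumes T: "separable_metrizable T" and U: "openin T U"
  shows "lsc (weak_topology T) (\<lambda>\<mu>. emeasure \<mu> U)"
proof -
  have "emeasure \<mu> U = (\<integral>\<^sup>+x. indicator U x \<partial>\<mu>)" if "\<mu> \<in> topspace (weak_topology T)" for \<mu>
    using prob_measuresD(2)[of \<mu> T] that borel_of_openin[OF U] by simp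
  then show ?thesis
    using lsc_nn_integral_weak[OF T lsc_indicator[OF U]] by (subst lsc_cong)
qed

lemma measurable_weak_topology_prob_algebra:
  assumes T: "separable_metrizable T"
  shows "(\<lambda>\<mu>. \<mu>) \<in> borel_of (weak_topology T) \<rightarrow>\<^sub>M prob_algebra (borel_of T)"
proof (rule measurable_prob_algebra_generated[where \<Omega> = "topspace T" and G = "{U. openin T U}"])
  fix U assume "U \<in> {U. openin T U}"
  then show "(\<lambda>\<mu>. emeasure \<mu> U) \<in> borel_measurable (borel_of (weak_topology T))"
    using lsc_measurable[OF lsc_emeasure_weak[OF T]] by simp
qed (auto simp: sets_borel_of Int_stable_def prob_measures_def openin_subset openin_subset[THEN subsetD])

text \<open>
  Along the embedding, a weakly open set is the preimage of an open set under countably many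
  integrals, which are measurable for the evaluations. Maps into the beliefs are thereby Borel
  exactly if they are kernels.
\<close>

theorem sets_borel_of_weak_topology:
  fixes T :: "'a topology"
  assumes T: "separable_metrizable T"
  shows "sets (borel_of (weak_topology T)) = sets (prob_algebra (borel_of T))"
proof
  let ?P = "prob_measures T"
  show "sets (borel_of (weak_topology T)) \<subseteq> sets (prob_algebra (borel_of T))"
    unfolding sets_borel_of[of "weak_topology T"]
  proof (rule sets.sigma_sets_subset', safe)
    fix V assume V: "openin (weak_topology T) V"
    show "V \<in> sets (prob_algebra (borel_of T))"
    proof (rule weak_topology_embedding[OF T])
      fix e :: "nat \<Rightarrow> 'a \<Rightarrow> real"
      let ?\<Phi> = "\<lambda>\<mu> n. \<integral>x. e n x \<partial>\<mu>"
      assume e: "\<And>n. continuous_map T euclideanreal (e n)" "\<And>n x. x \<in> topspace T \<Longrightarrow> 0 \<le> e n x \<and> e n x \<le> 1"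
        and hom: "homeomorphic_map (weak_topology T) (top_of_set (?\<Phi> ` ?P)) ?\<Phi>"
      have VP: "V \<subseteq> ?P" using openin_subset[OF V] by simp
      have "openin (top_of_set (?\<Phi> ` ?P)) (?\<Phi> ` V)"
        using homeomorphic_map_openness[OF hom] V VP by simp
      then obtain U where U: "open U" "?\<Phi> ` V = ?\<Phi> ` ?P \<inter> U" by (auto simp: openin_open)
      have "inj_on ?\<Phi> ?P" using homeomorphic_imp_injective_map[OF hom] by simp
      then have V_eq: "V = ?\<Phi> -` U \<inter> space (prob_algebra (borel_of T))"
        unfolding prob_measures_eq_space[symmetric] using U(2) VP by (auto simp: inj_on_def) blast
      have "(\<lambda>\<mu>. \<mu>) \<in> prob_algebra (borel_of T) \<rightarrow>\<^sub>M subprob_algebra (borel_of T)"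
        by (rule measurable_prob_algebraD) simp
      from measurable_compose[OF this integral_measurable_subprob_algebra[OF measurable_euclideanreal_borel_of[OF e(1)]]]
      have "(\<lambda>\<mu>. \<integral>x. e n x \<partial>\<mu>) \<in> borel_measurable (prob_algebra (borel_of T))" for n .
      then have "?\<Phi> \<in> prob_algebra (borel_of T) \<rightarrow>\<^sub>M borel"
        by (intro measurable_coordinatewise_then_product)
      then show ?thesis unfolding V_eq by (rule measurable_sets) (use U in simp)
    qed
  qed (simp add: prob_measures_eq_space)
  show "sets (prob_algebra (borel_of T)) \<subseteq> sets (borel_of (weak_topology T))"
  proof
    fix B assume B: "B \<in> sets (prob_algebra (borel_of T))"
    from measurable_sets[OF measurable_weak_topology_prob_algebra[OF T] this]
    show "B \<in> sets (borel_of (weak_topology T))"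
      using sets.sets_into_space[OF B] by (simp add: prob_measures_eq_space Int_absorb2)
  qed
qed

lemma stochastic_kernel_prob_algebra:
  "stochastic_kernel T1 T2 K \<longleftrightarrow> K \<in> borel_of T2 \<rightarrow>\<^sub>M prob_algebra (borel_of T1)"
proof
  assume K: "stochastic_kernel T1 T2 K"
  show "K \<in> borel_of T2 \<rightarrow>\<^sub>M prob_algebra (borel_of T1)"
    using measurable_stochastic_kernel[OF K] K
    by (intro measurable_prob_algebraI) (auto simp: stochastic_kernel_def prob_measures_def)
next
  assume "K \<in> borel_of T2 \<rightarrow>\<^sub>M prob_algebra (borel_of T1)"
  then show "stochastic_kernel T1 T2 K"
    unfolding stochastic_kernel_def using measurable_space[of K "borel_of T2" "prob_algebra (borel_of T1)"]
    by (auto simp: prob_measures_eq_space intro: measurable_compose[OF _ measurable_measure_prob_algebra])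
qed

subsection \<open>Passing to the limit under varying measures\<close>

text \<open>
  Fatou's lemma when the measures converge weakly and the integrands converge along convergent
  arguments. The lower envelopes of the tails of \<open>h\<close> are semicontinuous, lie below all later
  \<open>h n\<close> and increase to a function above \<open>g\<close>.
\<close>

theorem nn_integral_Fatou_weak:
  fixes h :: "nat \<Rightarrow> 'a \<Rightarrow> ennreal"
  assumes T: "separable_metrizable T" and lim: "limitin (weak_topology T) \<mu> \<nu> sequentially"
    and \<mu>: "range \<mu> \<subseteq> prob_measures T"
    and h: "\<And>s x. range s \<subseteq> topspace T \<Longrightarrow> limitin T s x sequentially \<Longrightarrow> g x \<le> liminf (\<lambda>n. h n (s n))"
  shows "(\<integral>\<^sup>+x. g x \<partial>\<nu>) \<le> liminf (\<lambda>n. \<integral>\<^sup>+x. h n x \<partial>\<mu> n)"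
proof -
  have \<nu>: "\<nu> \<in> prob_measures T" using limitin_topspace[OF lim] by simp
  have fc: "first_countable T" using T metrizable_imp_first_countable by (auto simp: separable_metrizable_def)
  define R where "R k x = {r. \<exists>U. openin T U \<and> x \<in> U \<and> (\<forall>n\<ge>k. \<forall>y\<in>U. r \<le> h n y)}" for k :: nat and x
  define L where "L k x = Sup (R k x)" for k x
  have lscL: "lsc T (L k)" for k
    unfolding lsc_def
  proof
    fix r
    show "openin T {x \<in> topspace T. r < L k x}"
    proof (subst openin_subopen, safe)
      fix x assume x: "x \<in> topspace T" "r < L k x"
      then obtain r' U where r': "r < r'" "openin T U" "x \<in> U" "\<forall>n\<ge>k. \<forall>y\<in>U. r' \<le> h n y"
        unfolding L_def less_Sup_iff R_def by blast
      have "r < L k y" if "y \<in> U" for y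
        unfolding L_def less_Sup_iff R_def using r' that by blast
      then show "\<exists>U. openin T U \<and> x \<in> U \<and> U \<subseteq> {x \<in> topspace T. r < L k x}"
        using r' openin_subset[OF r'(2)] by blast
    qed
  qed
  have L_le: "L k x \<le> h n x" if "k \<le> n" for k n x
    unfolding L_def R_def using that by (intro Sup_least) blast
  have L_inc: "incseq L"
  proof (intro incseq_SucI le_funI)
    show "L k x \<le> L (Suc k) x" for k x
      unfolding L_def by (rule Sup_subset_mono) (auto simp: R_def)
  qed
  have g_le: "g x \<le> (SUP k. L k x)" if x: "x \<in> topspace T" for x
  proof (rule ccontr)
    assume "\<not> g x \<le> (SUP k. L k x)"
    then obtain r where r: "(SUP k. L k x) < r" "r < g x" using dense by (auto simp: not_le)
    have "\<exists>U (k::nat). openin T U \<and> x \<in> U \<and> (\<forall>n\<ge>k. \<forall>y\<in>U. r \<le> h n y)"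
    proof (rule eventually_near_of_sequences[OF fc x, where P = "\<lambda>n y. r \<le> h n y"])
      fix s assume "range s \<subseteq> topspace T" "limitin T s x sequentially"
      then have "r < liminf (\<lambda>n. h n (s n))" using h r(2) by (metis order_less_le_trans)
      then show "\<forall>\<^sub>F n in sequentially. r \<le> h n (s n)"
        by (auto dest!: less_LiminfD elim: eventually_mono)
    qed
    then obtain k where "r \<in> R k x" by (auto simp: R_def)
    then have "r \<le> L k x" unfolding L_def by (rule Sup_upper)
    also have "\<dots> \<le> (SUP k. L k x)" by (rule SUP_upper) simp
    finally show False using r(1) by simp
  qed
  have L_lim: "(\<integral>\<^sup>+x. L k x \<partial>\<nu>) \<le> liminf (\<lambda>n. \<integral>\<^sup>+x. h n x \<partial>\<mu> n)" for k
    unfolding le_Liminf_iff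
  proof (intro allI impI)
    fix r assume r: "r < (\<integral>\<^sup>+x. L k x \<partial>\<nu>)"
    have "openin (weak_topology T) {\<mu> \<in> topspace (weak_topology T). r < (\<integral>\<^sup>+x. L k x \<partial>\<mu>)}"
      using lsc_nn_integral_weak[OF T lscL] unfolding lsc_def by blast
    moreover have "\<nu> \<in> {\<mu> \<in> topspace (weak_topology T). r < (\<integral>\<^sup>+x. L k x \<partial>\<mu>)}"
      using \<nu> r by simp
    ultimately have "\<forall>\<^sub>F n in sequentially. \<mu> n \<in> {\<mu> \<in> topspace (weak_topology T). r < (\<integral>\<^sup>+x. L k x \<partial>\<mu>)}"
      using lim unfolding limitin_def by blast
    then show "\<forall>\<^sub>F n in sequentially. r < (\<integral>\<^sup>+x. h n x \<partial>\<mu> n)"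
      using eventually_ge_at_top[of k]
    proof eventually_elim
      case (elim n)
      then have "r < (\<integral>\<^sup>+x. L k x \<partial>\<mu> n)" by simp
      also have "\<dots> \<le> (\<integral>\<^sup>+x. h n x \<partial>\<mu> n)" using elim by (intro nn_integral_mono L_le)
      finally show ?case .
    qed
  qed
  have "(\<integral>\<^sup>+x. g x \<partial>\<nu>) \<le> (\<integral>\<^sup>+x. (SUP k. L k x) \<partial>\<nu>)"
    using g_le prob_measuresD[OF \<nu>] by (intro nn_integral_mono) simp
  also have "\<dots> = (SUP k. \<integral>\<^sup>+x. L k x \<partial>\<nu>)"
    using L_inc lsc_measurable[OF lscL] prob_measuresD(2)[OF \<nu>]
    by (intro nn_integral_monotone_convergence_SUP) (auto cong: measurable_cong_sets)
  also have "\<dots> \<le> liminf (\<lambda>n. \<integral>\<^sup>+x. h n x \<partial>\<mu> n)"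
    using L_lim by (intro SUP_least)
  finally show ?thesis .
qed

text \<open>
  Fatou's lemma applied to \<open>B + g n\<close> and to \<open>B - g n\<close>. Continuous convergence of the integrands, as
  opposed to pointwise convergence, is essential because the measures may move their mass.
\<close>

lemma tendsto_integral_weak:
  fixes g :: "nat \<Rightarrow> 'a \<Rightarrow> real"
  assumes T: "separable_metrizable T" and lim: "limitin (weak_topology T) \<mu> \<nu> sequentially"
    and \<mu>: "range \<mu> \<subseteq> prob_measures T"
    and gm: "\<And>n. g n \<in> borel_measurable (borel_of T)" "g0 \<in> borel_measurable (borel_of T)"
    and B: "\<And>n x. x \<in> topspace T \<Longrightarrow> \<bar>g n x\<bar> \<le> B" "\<And>x. x \<in> topspace T \<Longrightarrow> \<bar>g0 x\<bar> \<le> B"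
    and g: "\<And>s x. range s \<subseteq> topspace T \<Longrightarrow> limitin T s x sequentially \<Longrightarrow> (\<lambda>n. g n (s n)) \<longlonglongrightarrow> g0 x"
  shows "(\<lambda>n. \<integral>x. g n x \<partial>\<mu> n) \<longlonglongrightarrow> (\<integral>x. g0 x \<partial>\<nu>)"
proof -
  have \<nu>: "\<nu> \<in> prob_measures T" using limitin_topspace[OF lim] by simp
  have \<mu>n: "\<mu> n \<in> prob_measures T" for n using \<mu> by auto
  have shift: "(\<integral>\<^sup>+x. ennreal (B + f x) \<partial>\<rho>) = ennreal (B + (\<integral>x. f x \<partial>\<rho>)) \<and> 0 \<le> B + (\<integral>x. f x \<partial>\<rho>)"
    if \<rho>: "\<rho> \<in> prob_measures T" and fm: "f \<in> borel_measurable (borel_of T)"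
      and f: "\<And>x. x \<in> topspace T \<Longrightarrow> \<bar>f x\<bar> \<le> B" for f \<rho>
  proof -
    interpret prob_space \<rho> using prob_measuresD(1)[OF \<rho>] .
    have pos: "0 \<le> B + f x \<and> B + f x \<le> 2 * B" if "x \<in> topspace T" for x using f[OF that] by linarith
    have i: "(\<integral>x. B + f x \<partial>\<rho>) = B + (\<integral>x. f x \<partial>\<rho>)"
      using prob_measures_integrable[OF \<rho> fm f] by (simp add: prob_space)
    have "0 \<le> (\<integral>x. B + f x \<partial>\<rho>)"
      using prob_measures_integral_bounds(1)[OF \<rho>, of "\<lambda>x. B + f x" 0 "2 * B"] fm pos by simp
    moreover have "(\<integral>\<^sup>+x. ennreal (B + f x) \<partial>\<rho>) = ennreal (\<integral>x. B + f x \<partial>\<rho>)"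
      by (rule nn_integral_eq_ennreal_integral[OF \<rho> _ pos]) (use fm in simp)
    ultimately show ?thesis using i by simp
  qed
  \<comment> \<open>one half; the other half is the same statement for the negated integrands\<close>
  have half: "\<forall>\<^sub>F n in sequentially. r < (\<integral>x. f n x \<partial>\<mu> n)"
    if fm: "\<And>n. f n \<in> borel_measurable (borel_of T)" "f0 \<in> borel_measurable (borel_of T)"
      and fB: "\<And>n x. x \<in> topspace T \<Longrightarrow> \<bar>f n x\<bar> \<le> B" "\<And>x. x \<in> topspace T \<Longrightarrow> \<bar>f0 x\<bar> \<le> B"
      and f: "\<And>s x. range s \<subseteq> topspace T \<Longrightarrow> limitin T s x sequentially \<Longrightarrow> (\<lambda>n. f n (s n)) \<longlonglongrightarrow> f0 x"
      and r: "r < (\<integral>x. f0 x \<partial>\<nu>)" for f f0 r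
  proof (cases "B + r < 0")
    case True
    have "r < (\<integral>x. f n x \<partial>\<mu> n)" for n using shift[OF \<mu>n fm(1) fB(1)] True by (smt (verit))
    then show ?thesis by simp
  next
    case False
    have "ennreal (B + r) < (\<integral>\<^sup>+x. ennreal (B + f0 x) \<partial>\<nu>)"
      using shift[OF \<nu> fm(2) fB(2)] False r by (simp add: ennreal_less_iff)
    also have "\<dots> \<le> liminf (\<lambda>n. \<integral>\<^sup>+x. ennreal (B + f n x) \<partial>\<mu> n)"
    proof (rule nn_integral_Fatou_weak[OF T lim \<mu>])
      fix s x assume "range s \<subseteq> topspace T" "limitin T s x sequentially"
      then have "(\<lambda>n. ennreal (B + f n (s n))) \<longlonglongrightarrow> ennreal (B + f0 x)"
        using f by (intro tendsto_ennrealI tendsto_intros)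
      then show "ennreal (B + f0 x) \<le> liminf (\<lambda>n. ennreal (B + f n (s n)))"
        by (simp add: lim_imp_Liminf)
    qed
    finally have "\<forall>\<^sub>F n in sequentially. ennreal (B + r) < (\<integral>\<^sup>+x. ennreal (B + f n x) \<partial>\<mu> n)"
      by (rule less_LiminfD)
    then show ?thesis
    proof eventually_elim
      case (elim n)
      then show ?case using shift[OF \<mu>n fm(1) fB(1), of n n] False by (simp add: ennreal_less_iff)
    qed
  qed
  show ?thesis
  proof (rule order_tendstoI)
    show "\<forall>\<^sub>F n in sequentially. r < (\<integral>x. g n x \<partial>\<mu> n)" if "r < (\<integral>x. g0 x \<partial>\<nu>)" for r
      by (rule half[OF gm B g that])
    show "\<forall>\<^sub>F n in sequentially. (\<integral>x. g n x \<partial>\<mu> n) < r" if r: "(\<integral>x. g0 x \<partial>\<nu>) < r" for r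
      using half[of "\<lambda>n x. - g n x" "\<lambda>x. - g0 x" "- r"] gm B g r by (simp add: tendsto_minus)
  qed
qed

section \<open>Weak continuity of the filter\<close>

text \<open>
  Test functions with values in the unit interval are integrable for every probability measure and
  pass through \<^typ>\<open>ennreal\<close>-valued integrals without side conditions; they suffice, since
  products, kernel integrals and distances of such functions are again of this kind.
\<close>

definition unit_valued :: "'a topology \<Rightarrow> ('a \<Rightarrow> real) \<Rightarrow> bool" where
  "unit_valued T f \<longleftrightarrow> f \<in> borel_measurable (borel_of T) \<and> (\<forall>x\<in>topspace T. 0 \<le> f x \<and> f x \<le> 1)"

lemma unit_valuedD:
  assumes "unit_valued T f"
  shows "f \<in> borel_measurable (borel_of T)" "x \<in> topspace T \<Longrightarrow> 0 \<le> f x" "x \<in> topspace T \<Longrightarrow> f x \<le> 1"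
    "x \<in> topspace T \<Longrightarrow> \<bar>f x\<bar> \<le> 1"
  using assms by (auto simp: unit_valued_def)

lemma unit_valued_mult: "unit_valued T f \<Longrightarrow> unit_valued T g \<Longrightarrow> unit_valued T (\<lambda>x. f x * g x)"
  by (auto simp: unit_valued_def intro!: mult_le_one)

lemma unit_valued_abs_diff: "unit_valued T f \<Longrightarrow> unit_valued T g \<Longrightarrow> unit_valued T (\<lambda>x. \<bar>f x - g x\<bar>)"
proof -
  assume f: "unit_valued T f" and g: "unit_valued T g"
  have "\<bar>f x - g x\<bar> \<le> 1" if "x \<in> topspace T" for x
    using unit_valuedD(2,3)[OF f that] unit_valuedD(2,3)[OF g that] by linarith
  moreover have "(\<lambda>x. \<bar>f x - g x\<bar>) \<in> borel_measurable (borel_of T)"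
    using unit_valuedD(1)[OF f] unit_valuedD(1)[OF g] by measurable
  ultimately show ?thesis by (simp add: unit_valued_def)
qed

lemma unit_valued_const: "0 \<le> c \<Longrightarrow> c \<le> 1 \<Longrightarrow> unit_valued T (\<lambda>_. c)"
  by (auto simp: unit_valued_def)

lemma unit_valued_kernel_integral:
  assumes K: "K \<in> borel_of T \<rightarrow>\<^sub>M prob_algebra (borel_of S)" and f: "unit_valued S f"
  shows "unit_valued T (\<lambda>x. \<integral>y. f y \<partial>K x)"
  unfolding unit_valued_def
proof (intro conjI ballI)
  show "(\<lambda>x. \<integral>y. f y \<partial>K x) \<in> borel_measurable (borel_of T)"
    by (rule measurable_compose[OF measurable_prob_algebraD[OF K]
          integral_measurable_subprob_algebra[OF unit_valuedD(1)[OF f]]])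
  fix x assume x: "x \<in> topspace T"
  have Kx: "K x \<in> prob_measures S"
    using measurable_space[OF K] x by (simp add: prob_measures_eq_space)
  show "0 \<le> (\<integral>y. f y \<partial>K x)" "(\<integral>y. f y \<partial>K x) \<le> 1"
    using prob_measures_integral_bounds[OF Kx unit_valuedD(1)[OF f], of 0 1] f
    by (auto simp: unit_valued_def)
qed

lemma unit_valued_nn_integral:
  assumes "\<mu> \<in> prob_measures T" "unit_valued T f"
  shows "(\<integral>\<^sup>+x. ennreal (f x) \<partial>\<mu>) = ennreal (\<integral>x. f x \<partial>\<mu>)" "0 \<le> (\<integral>x. f x \<partial>\<mu>)" "(\<integral>x. f x \<partial>\<mu>) \<le> 1"
    "integrable \<mu> f"
proof -
  have f: "f \<in> borel_measurable (borel_of T)" "\<And>x. x \<in> topspace T \<Longrightarrow> 0 \<le> f x \<and> f x \<le> 1"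
    "\<And>x. x \<in> topspace T \<Longrightarrow> \<bar>f x\<bar> \<le> 1"
    using assms(2) by (auto simp: unit_valued_def)
  show "(\<integral>\<^sup>+x. ennreal (f x) \<partial>\<mu>) = ennreal (\<integral>x. f x \<partial>\<mu>)"
    by (rule nn_integral_eq_ennreal_integral[OF assms(1) f(1,2)])
  show "0 \<le> (\<integral>x. f x \<partial>\<mu>)" "(\<integral>x. f x \<partial>\<mu>) \<le> 1"
    by (rule prob_measures_integral_bounds[OF assms(1) f(1,2)]; assumption)+
  show "integrable \<mu> f" by (rule prob_measures_integrable[OF assms(1) f(1,3)])
qed

lemma tendsto_of_subsequences:
  fixes u :: "nat \<Rightarrow> 'a::metric_space"
  assumes "\<And>r::nat \<Rightarrow> nat. strict_mono r \<Longrightarrow> \<exists>r'::nat \<Rightarrow> nat. strict_mono r' \<and> (\<lambda>n. u (r (r' n))) \<longlonglongrightarrow> l"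
  shows "u \<longlonglongrightarrow> l"
proof (rule tendstoI, rule ccontr)
  fix e :: real assume e: "0 < e" and "\<not> (\<forall>\<^sub>F n in sequentially. dist (u n) l < e)"
  then obtain r :: "nat \<Rightarrow> nat" where r: "strict_mono r" "\<And>n. \<not> dist (u (r n)) l < e"
    using not_eventually_sequentiallyD by blast
  obtain r' :: "nat \<Rightarrow> nat" where "(\<lambda>n. u (r (r' n))) \<longlonglongrightarrow> l" using assms[OF r(1)] by blast
  from tendstoD[OF this e] obtain n where "dist (u (r (r' n))) l < e"
    by (auto simp: eventually_sequentially)
  then show False using r(2) by blast
qed

text \<open>Compactness of the Hilbert cube, as a substitute for a diagonal argument.\<close>

lemma convergent_coordinates_subsequence:
  fixes v :: "nat \<Rightarrow> nat \<Rightarrow> real"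
  assumes "\<And>n k. 0 \<le> v n k \<and> v n k \<le> 1"
  obtains r :: "nat \<Rightarrow> nat" where "strict_mono r" "\<And>k. convergent (\<lambda>n. v (r n) k)"
proof -
  have "compactin (powertop_real UNIV) (PiE UNIV (\<lambda>_::nat. {0..1::real}))"
    by (simp add: compactin_PiE)
  then have "compact (PiE UNIV (\<lambda>_::nat. {0..1::real}))"
    by (simp add: euclidean_product_topology)
  then have "seq_compact (PiE UNIV (\<lambda>_::nat. {0..1::real}))" by (rule compact_imp_seq_compact)
  moreover have "v n \<in> PiE UNIV (\<lambda>_::nat. {0..1::real})" for n using assms by auto
  ultimately obtain l r where r: "strict_mono r" and l: "(v \<circ> r) \<longlonglongrightarrow> l"
    by (metis seq_compactE)
  have "limitin (powertop_real UNIV) (v \<circ> r) l sequentially"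
    using l by (simp add: euclidean_product_topology)
  then have "(\<lambda>n. v (r n) k) \<longlonglongrightarrow> l k" for k
    by (simp add: limitin_componentwise)
  then show ?thesis using that[OF r] by (auto simp: convergent_def)
qed

lemma tv_gap_bounds:
  assumes \<mu>: "\<mu> \<in> prob_measures T" and \<nu>: "\<nu> \<in> prob_measures T" and s: "unit_valued T s"
  shows "\<bar>(\<integral>x. s x \<partial>\<mu>) - (\<integral>x. s x \<partial>\<nu>)\<bar> \<le> tv_gap T \<mu> \<nu>"
proof -
  let ?F = "{f \<in> borel_measurable (borel_of T). f ` topspace T \<subseteq> {-1..1::real}}"
  let ?d = "\<lambda>f. (\<integral>s. f s \<partial>\<mu>) - (\<integral>s. f s \<partial>\<nu>)"
  have "bdd_above (?d ` ?F)"
  proof (rule bdd_aboveI2[of _ _ 2])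
    fix f assume f: "f \<in> ?F"
    then have b: "\<And>x. x \<in> topspace T \<Longrightarrow> -1 \<le> f x \<and> f x \<le> 1" by auto
    show "?d f \<le> 2"
      using prob_measures_integral_bounds[OF \<mu> _ b] prob_measures_integral_bounds[OF \<nu> _ b] f by force
  qed
  then have le: "?d f \<le> tv_gap T \<mu> \<nu>" if "f \<in> ?F" for f
    unfolding tv_gap_def using that by (rule cSUP_upper[rotated])
  have "s \<in> ?F" "(\<lambda>x. - s x) \<in> ?F" using s by (auto simp: unit_valued_def)
  from le[OF this(1)] le[OF this(2)] show ?thesis by simp
qed

locale continuous_filter =
  fixes M :: "('x::polish_space, 'y::polish_space, 'a::polish_space) pomdp"
    and H :: "'x measure \<times> 'a \<times> 'y \<Rightarrow> 'x measure"
  assumes M: "is_pomdp M" and H: "filter_kernel M H"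
    and P_cont: "weakly_continuous (state_top M) (prod_topology (state_top M) (action_top M)) (trans_kernel M)"
    and Q_cont: "tv_continuous (obs_top M) (prod_topology (action_top M) (state_top M)) (obs_kernel M)"
begin

abbreviation "X \<equiv> state_top M"
abbreviation "Y \<equiv> obs_top M"
abbreviation "A \<equiv> action_top M"
abbreviation "P \<equiv> trans_kernel M"
abbreviation "Q \<equiv> obs_kernel M"
abbreviation "R' \<equiv> next_obs_kernel M"

lemma sm: "separable_metrizable X" "separable_metrizable Y" "separable_metrizable A"
  by (rule separable_metrizable_top_of_set)+

lemma P_kernel: "a \<in> action_set M \<Longrightarrow> (\<lambda>x. P (x, a)) \<in> borel_of X \<rightarrow>\<^sub>M prob_algebra (borel_of X)"
proof -
  assume a: "a \<in> action_set M"
  have "(\<lambda>x. (x, a)) \<in> borel_of X \<rightarrow>\<^sub>M borel_of (prod_topology X A)"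
    by (rule measurable_continuous_map_borel_of)
      (use a in \<open>auto simp: continuous_map_pairedI intro!: continuous_intros\<close>)
  moreover have "P \<in> borel_of (prod_topology X A) \<rightarrow>\<^sub>M prob_algebra (borel_of X)"
    using M by (simp add: is_pomdp_def stochastic_kernel_prob_algebra)
  ultimately show ?thesis by (rule measurable_compose)
qed

lemma Q_kernel: "a \<in> action_set M \<Longrightarrow> (\<lambda>x. Q (a, x)) \<in> borel_of X \<rightarrow>\<^sub>M prob_algebra (borel_of Y)"
proof -
  assume a: "a \<in> action_set M"
  have "(\<lambda>x. (a, x)) \<in> borel_of X \<rightarrow>\<^sub>M borel_of (prod_topology A X)"
    by (rule measurable_continuous_map_borel_of)
      (use a in \<open>auto simp: continuous_map_pairedI intro!: continuous_intros\<close>)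
  moreover have "Q \<in> borel_of (prod_topology A X) \<rightarrow>\<^sub>M prob_algebra (borel_of Y)"
    using M by (simp add: is_pomdp_def stochastic_kernel_prob_algebra)
  ultimately show ?thesis by (rule measurable_compose)
qed

lemma H_kernel:
  assumes z: "z \<in> prob_measures X" and a: "a \<in> action_set M"
  shows "(\<lambda>y. H (z, a, y)) \<in> borel_of Y \<rightarrow>\<^sub>M prob_algebra (borel_of X)"
proof -
  have "(\<lambda>y. (z, a, y)) \<in> borel_of Y \<rightarrow>\<^sub>M borel_of (prod_topology (belief_top M) (prod_topology A Y))"
    by (rule measurable_continuous_map_borel_of)
      (use z a in \<open>auto simp: continuous_map_pairedI intro!: continuous_intros\<close>)
  moreover have "H \<in> borel_of (prod_topology (belief_top M) (prod_topology A Y)) \<rightarrow>\<^sub>M prob_algebra (borel_of X)"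
    using H by (simp add: filter_kernel_def stochastic_kernel_prob_algebra)
  ultimately show ?thesis by (rule measurable_compose)
qed

text \<open>
  The integral of \<open>f(x') s(y)\<close> against the joint law of the next state \<open>x'\<close> and observation \<open>y\<close>,
  written as an iterated integral, the form in which the continuity of \<open>P\<close> and \<open>Q\<close> can be used.
\<close>

definition joint_integral :: "'x measure \<times> 'a \<Rightarrow> ('x \<Rightarrow> real) \<Rightarrow> ('y \<Rightarrow> real) \<Rightarrow> real" where
  "joint_integral = (\<lambda>(z, a) f s. \<integral>x. (\<integral>x'. f x' * (\<integral>y. s y \<partial>Q (a, x')) \<partial>P (x, a)) \<partial>z)"

lemma joint_inner_kernel:
  assumes a: "a \<in> action_set M"
  shows "(\<lambda>x'. distr (Q (a, x')) (borel_of X \<Otimes>\<^sub>M borel_of Y) (Pair x'))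
    \<in> borel_of X \<rightarrow>\<^sub>M prob_algebra (borel_of X \<Otimes>\<^sub>M borel_of Y)"
  by (rule measurable_distr_prob_space2[OF Q_kernel[OF a]]) simp

lemma nn_integral_joint:
  assumes z: "z \<in> prob_measures X" and a: "a \<in> action_set M"
    and g: "g \<in> borel_measurable (borel_of X \<Otimes>\<^sub>M borel_of Y)"
  shows "(\<integral>\<^sup>+w. g w \<partial>joint_kernel M (z, a)) = (\<integral>\<^sup>+x. \<integral>\<^sup>+x'. \<integral>\<^sup>+y. g (x', y) \<partial>Q (a, x') \<partial>P (x, a) \<partial>z)"
    "joint_kernel M (z, a) \<in> space (prob_algebra (borel_of X \<Otimes>\<^sub>M borel_of Y))"
proof -
  let ?D = "\<lambda>x'. distr (Q (a, x')) (borel_of X \<Otimes>\<^sub>M borel_of Y) (Pair x')"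
  have D: "?D \<in> borel_of X \<rightarrow>\<^sub>M prob_algebra (borel_of X \<Otimes>\<^sub>M borel_of Y)"
    by (rule joint_inner_kernel[OF a])
  have k: "(\<lambda>x. P (x, a) \<bind> ?D) \<in> borel_of X \<rightarrow>\<^sub>M prob_algebra (borel_of X \<Otimes>\<^sub>M borel_of Y)"
    by (rule measurable_bind_prob_space[OF P_kernel[OF a] D])
  have zs: "sets z = sets (borel_of X)" "space z = topspace X" using prob_measuresD[OF z] by auto
  have kz: "(\<lambda>x. P (x, a) \<bind> ?D) \<in> z \<rightarrow>\<^sub>M prob_algebra (borel_of X \<Otimes>\<^sub>M borel_of Y)"
    using k by (simp add: measurable_cong_sets[OF zs(1) refl])
  show "joint_kernel M (z, a) \<in> space (prob_algebra (borel_of X \<Otimes>\<^sub>M borel_of Y))"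
    unfolding joint_kernel_def prod.case
    by (rule measurable_space[OF measurable_bind_prob_space[OF measurable_ident_sets[OF refl] k]])
      (use z in \<open>simp add: prob_measures_eq_space\<close>)
  have "(\<integral>\<^sup>+w. g w \<partial>joint_kernel M (z, a)) = (\<integral>\<^sup>+x. \<integral>\<^sup>+w. g w \<partial>(P (x, a) \<bind> ?D) \<partial>z)"
    unfolding joint_kernel_def prod.case by (rule nn_integral_bind[OF g measurable_prob_algebraD[OF kz]])
  also have "\<dots> = (\<integral>\<^sup>+x. \<integral>\<^sup>+x'. \<integral>\<^sup>+y. g (x', y) \<partial>Q (a, x') \<partial>P (x, a) \<partial>z)"
  proof (rule nn_integral_cong)
    fix x assume "x \<in> space z"
    then have x: "x \<in> space (borel_of X)" using zs by simp
    have Ps: "sets (P (x, a)) = sets (borel_of X)" "space (P (x, a)) = topspace X"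
      using measurable_space[OF P_kernel[OF a] x] sets_eq_imp_space_eq[of "P (x, a)" "borel_of X"]
      by (auto simp: space_prob_algebra)
    have DP: "?D \<in> P (x, a) \<rightarrow>\<^sub>M subprob_algebra (borel_of X \<Otimes>\<^sub>M borel_of Y)"
      using measurable_prob_algebraD[OF D] by (simp add: measurable_cong_sets[OF Ps(1) refl])
    have "(\<integral>\<^sup>+w. g w \<partial>(P (x, a) \<bind> ?D)) = (\<integral>\<^sup>+x'. \<integral>\<^sup>+w. g w \<partial>?D x' \<partial>P (x, a))"
      by (rule nn_integral_bind[OF g DP])
    also have "\<dots> = (\<integral>\<^sup>+x'. \<integral>\<^sup>+y. g (x', y) \<partial>Q (a, x') \<partial>P (x, a))"
    proof (rule nn_integral_cong)
      fix x' assume "x' \<in> space (P (x, a))"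
      then have x': "x' \<in> space (borel_of X)" using Ps by simp
      have "sets (Q (a, x')) = sets (borel_of Y)"
        using measurable_space[OF Q_kernel[OF a] x'] by (simp add: space_prob_algebra)
      then have "Pair x' \<in> Q (a, x') \<rightarrow>\<^sub>M borel_of X \<Otimes>\<^sub>M borel_of Y"
        using x' by (simp add: measurable_cong_sets[of "Q (a, x')" "borel_of Y"])
      then show "(\<integral>\<^sup>+w. g w \<partial>?D x') = (\<integral>\<^sup>+y. g (x', y) \<partial>Q (a, x'))"
        by (rule nn_integral_distr) (use g in simp)
    qed
    finally show "(\<integral>\<^sup>+w. g w \<partial>(P (x, a) \<bind> ?D)) = (\<integral>\<^sup>+x'. \<integral>\<^sup>+y. g (x', y) \<partial>Q (a, x') \<partial>P (x, a))" .
  qed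
  finally show "(\<integral>\<^sup>+w. g w \<partial>joint_kernel M (z, a)) = (\<integral>\<^sup>+x. \<integral>\<^sup>+x'. \<integral>\<^sup>+y. g (x', y) \<partial>Q (a, x') \<partial>P (x, a) \<partial>z)" .
qed

lemma unit_valued_inner:
  assumes a: "a \<in> action_set M" and f: "unit_valued X f" and s: "unit_valued Y s"
  shows "unit_valued X (\<lambda>x'. f x' * (\<integral>y. s y \<partial>Q (a, x')))"
    "unit_valued X (\<lambda>x. \<integral>x'. f x' * (\<integral>y. s y \<partial>Q (a, x')) \<partial>P (x, a))"
proof -
  show *: "unit_valued X (\<lambda>x'. f x' * (\<integral>y. s y \<partial>Q (a, x')))"
    by (intro unit_valued_mult f unit_valued_kernel_integral[OF Q_kernel[OF a] s])
  show "unit_valued X (\<lambda>x. \<integral>x'. f x' * (\<integral>y. s y \<partial>Q (a, x')) \<partial>P (x, a))"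
    by (rule unit_valued_kernel_integral[OF P_kernel[OF a] *])
qed

lemma in_prob_measures:
  assumes "z \<in> prob_measures X" "a \<in> action_set M"
  shows "x \<in> state_set M \<Longrightarrow> P (x, a) \<in> prob_measures X" "x \<in> state_set M \<Longrightarrow> Q (a, x) \<in> prob_measures Y"
    "y \<in> obs_set M \<Longrightarrow> H (z, a, y) \<in> prob_measures X"
  using measurable_space[OF P_kernel[OF assms(2)], of x] measurable_space[OF Q_kernel[OF assms(2)], of x]
    measurable_space[OF H_kernel[OF assms], of y]
  by (auto simp: prob_measures_eq_space)

lemma joint_integral_eq:
  assumes z: "z \<in> prob_measures X" and a: "a \<in> action_set M" and f: "unit_valued X f" and s: "unit_valued Y s"
  shows "(\<integral>\<^sup>+w. ennreal (f (fst w) * s (snd w)) \<partial>joint_kernel M (z, a)) = ennreal (joint_integral (z, a) f s)"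
proof -
  note [measurable] = unit_valuedD(1)[OF f] unit_valuedD(1)[OF s]
  have "(\<integral>\<^sup>+w. ennreal (f (fst w) * s (snd w)) \<partial>joint_kernel M (z, a)) =
      (\<integral>\<^sup>+x. \<integral>\<^sup>+x'. \<integral>\<^sup>+y. ennreal (f x' * s y) \<partial>Q (a, x') \<partial>P (x, a) \<partial>z)"
    by (subst nn_integral_joint(1)[OF z a]) simp_all
  also have "\<dots> = (\<integral>\<^sup>+x. \<integral>\<^sup>+x'. ennreal (f x' * (\<integral>y. s y \<partial>Q (a, x'))) \<partial>P (x, a) \<partial>z)"
  proof (intro nn_integral_cong)
    fix x x' assume "x \<in> space z" "x' \<in> space (P (x, a))"
    then have x': "x' \<in> state_set M"
      using prob_measuresD(3)[OF z] prob_measuresD(3)[OF in_prob_measures(1)[OF z a]] by auto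
    note Qx = in_prob_measures(2)[OF z a x']
    have f0: "0 \<le> f x'" using unit_valuedD(2)[OF f] x' by simp
    have "(\<integral>\<^sup>+y. ennreal (f x' * s y) \<partial>Q (a, x')) = (\<integral>\<^sup>+y. ennreal (f x') * ennreal (s y) \<partial>Q (a, x'))"
      using f0 unit_valuedD(2)[OF s] prob_measuresD(3)[OF Qx] by (intro nn_integral_cong) (simp add: ennreal_mult)
    also have "\<dots> = ennreal (f x') * ennreal (\<integral>y. s y \<partial>Q (a, x'))"
      using prob_measuresD(2)[OF Qx]
      by (subst nn_integral_cmult) (auto simp: unit_valued_nn_integral[OF Qx s] cong: measurable_cong_sets)
    finally show "(\<integral>\<^sup>+y. ennreal (f x' * s y) \<partial>Q (a, x')) = ennreal (f x' * (\<integral>y. s y \<partial>Q (a, x')))"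
      using f0 unit_valued_nn_integral(2)[OF Qx s] by (simp add: ennreal_mult)
  qed
  also have "\<dots> = (\<integral>\<^sup>+x. ennreal (\<integral>x'. f x' * (\<integral>y. s y \<partial>Q (a, x')) \<partial>P (x, a)) \<partial>z)"
    using prob_measuresD(3)[OF z]
    by (intro nn_integral_cong unit_valued_nn_integral(1)[OF in_prob_measures(1)[OF z a] unit_valued_inner(1)[OF a f s]]) simp
  also have "\<dots> = ennreal (joint_integral (z, a) f s)"
    unfolding joint_integral_def prod.case
    by (rule unit_valued_nn_integral(1)[OF z unit_valued_inner(2)[OF a f s]])
  finally show ?thesis .
qed

lemma joint_integral_nonneg:
  assumes "z \<in> prob_measures X" "a \<in> action_set M" "unit_valued X f" "unit_valued Y s"
  shows "0 \<le> joint_integral (z, a) f s"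
  unfolding joint_integral_def prod.case
  by (rule unit_valued_nn_integral(2)[OF assms(1) unit_valued_inner(2)[OF assms(2-4)]])

lemma next_obs_prob:
  assumes z: "z \<in> prob_measures X" and a: "a \<in> action_set M"
  shows "R' (z, a) \<in> prob_measures Y"
proof -
  have J: "joint_kernel M (z, a) \<in> space (prob_algebra (borel_of X \<Otimes>\<^sub>M borel_of Y))"
    by (rule nn_integral_joint(2)[OF z a, of "\<lambda>_. 0"]) simp
  then interpret prob_space "joint_kernel M (z, a)" by (simp add: space_prob_algebra)
  have "snd \<in> joint_kernel M (z, a) \<rightarrow>\<^sub>M borel_of Y"
    using J by (simp add: space_prob_algebra measurable_cong_sets[of "joint_kernel M (z, a)" "borel_of X \<Otimes>\<^sub>M borel_of Y"])
  then show ?thesis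
    unfolding next_obs_kernel_def prob_measures_def by (simp add: prob_space_distr)
qed

lemma nn_integral_next_obs:
  assumes z: "z \<in> prob_measures X" and a: "a \<in> action_set M" and g: "g \<in> borel_measurable (borel_of Y)"
  shows "(\<integral>\<^sup>+y. g y \<partial>R' (z, a)) = (\<integral>\<^sup>+x. \<integral>\<^sup>+x'. \<integral>\<^sup>+y. g y \<partial>Q (a, x') \<partial>P (x, a) \<partial>z)"
proof -
  have J: "joint_kernel M (z, a) \<in> space (prob_algebra (borel_of X \<Otimes>\<^sub>M borel_of Y))"
    by (rule nn_integral_joint(2)[OF z a, of "\<lambda>_. 0"]) simp
  have "snd \<in> joint_kernel M (z, a) \<rightarrow>\<^sub>M borel_of Y"
    using J by (simp add: space_prob_algebra measurable_cong_sets[of "joint_kernel M (z, a)" "borel_of X \<Otimes>\<^sub>M borel_of Y"])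
  then have "(\<integral>\<^sup>+y. g y \<partial>R' (z, a)) = (\<integral>\<^sup>+w. g (snd w) \<partial>joint_kernel M (z, a))"
    unfolding next_obs_kernel_def using g by (intro nn_integral_distr) auto
  also have "\<dots> = (\<integral>\<^sup>+x. \<integral>\<^sup>+x'. \<integral>\<^sup>+y. g y \<partial>Q (a, x') \<partial>P (x, a) \<partial>z)"
    using g by (subst nn_integral_joint(1)[OF z a]) simp_all
  finally show ?thesis .
qed

lemma integral_next_obs:
  assumes z: "z \<in> prob_measures X" and a: "a \<in> action_set M" and s: "unit_valued Y s"
  shows "(\<integral>y. s y \<partial>R' (z, a)) = joint_integral (z, a) (\<lambda>_. 1) s"
proof -
  note u = unit_valued_const[of 1 X, simplified] and [measurable] = unit_valuedD(1)[OF s]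
  have "ennreal (\<integral>y. s y \<partial>R' (z, a)) = (\<integral>\<^sup>+y. ennreal (s y) \<partial>R' (z, a))"
    using unit_valued_nn_integral(1)[OF next_obs_prob[OF z a] s] by simp
  also have "\<dots> = (\<integral>\<^sup>+w. ennreal (1 * s (snd w)) \<partial>joint_kernel M (z, a))"
    by (subst nn_integral_next_obs[OF z a], simp, subst nn_integral_joint(1)[OF z a]) simp_all
  also have "\<dots> = ennreal (joint_integral (z, a) (\<lambda>_. 1) s)"
    using joint_integral_eq[OF z a u s] by simp
  finally show ?thesis
    using unit_valued_nn_integral(2)[OF next_obs_prob[OF z a] s] joint_integral_nonneg[OF z a u s] by simp
qed

text \<open>A filter is specified on rectangles, which are stable under intersection and generate.\<close>

lemma joint_kernel_disintegration:
  assumes z: "z \<in> prob_measures X" and a: "a \<in> action_set M"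
  shows "joint_kernel M (z, a) =
    R' (z, a) \<bind> (\<lambda>y. distr (H (z, a, y)) (borel_of X \<Otimes>\<^sub>M borel_of Y) (\<lambda>x. (x, y)))"
    "(\<lambda>y. distr (H (z, a, y)) (borel_of X \<Otimes>\<^sub>M borel_of Y) (\<lambda>x. (x, y)))
      \<in> R' (z, a) \<rightarrow>\<^sub>M prob_algebra (borel_of X \<Otimes>\<^sub>M borel_of Y)"
proof -
  let ?D = "\<lambda>y. distr (H (z, a, y)) (borel_of X \<Otimes>\<^sub>M borel_of Y) (\<lambda>x. (x, y))"
  have Rp: "R' (z, a) \<in> prob_measures Y" by (rule next_obs_prob[OF z a])
  have J: "joint_kernel M (z, a) \<in> space (prob_algebra (borel_of X \<Otimes>\<^sub>M borel_of Y))"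
    by (rule nn_integral_joint(2)[OF z a, of "\<lambda>_. 0"]) simp
  then interpret J: prob_space "joint_kernel M (z, a)" by (simp add: space_prob_algebra)
  have "?D \<in> borel_of Y \<rightarrow>\<^sub>M prob_algebra (borel_of X \<Otimes>\<^sub>M borel_of Y)"
    by (rule measurable_distr_prob_space2[OF H_kernel[OF z a]]) simp
  then show D: "?D \<in> R' (z, a) \<rightarrow>\<^sub>M prob_algebra (borel_of X \<Otimes>\<^sub>M borel_of Y)"
    by (simp add: measurable_cong_sets[OF prob_measuresD(2)[OF Rp] refl])
  have ne: "space (R' (z, a)) \<noteq> {}" using M prob_measuresD(3)[OF Rp] by (simp add: is_pomdp_def)
  show "joint_kernel M (z, a) = R' (z, a) \<bind> ?D"
  proof (rule measure_eqI_generator_eq[OF Int_stable_pair_measure_generator[of "borel_of X" "borel_of Y"]])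
    show "sets (joint_kernel M (z, a)) = sigma_sets (space (borel_of X) \<times> space (borel_of Y))
        {a \<times> b |a b. a \<in> sets (borel_of X) \<and> b \<in> sets (borel_of Y)}"
      using J by (simp add: space_prob_algebra sets_pair_measure)
    have "sets (R' (z, a) \<bind> ?D) = sets (borel_of X \<Otimes>\<^sub>M borel_of Y)"
      by (rule sets_bind_measurable[OF measurable_prob_algebraD[OF D] ne])
    then show "sets (R' (z, a) \<bind> ?D) = sigma_sets (space (borel_of X) \<times> space (borel_of Y))
        {a \<times> b |a b. a \<in> sets (borel_of X) \<and> b \<in> sets (borel_of Y)}"
      by (simp add: sets_pair_measure)
    fix W assume "W \<in> {a \<times> b |a b. a \<in> sets (borel_of X) \<and> b \<in> sets (borel_of Y)}"
    then obtain B C where W: "W = B \<times> C" and B: "B \<in> sets (borel_of X)" and C: "C \<in> sets (borel_of Y)" by blast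
    have "emeasure (R' (z, a) \<bind> ?D) W = (\<integral>\<^sup>+y. emeasure (?D y) W \<partial>R' (z, a))"
      using B C W by (intro emeasure_bind[OF ne measurable_prob_algebraD[OF D]]) simp
    also have "\<dots> = (\<integral>\<^sup>+y\<in>C. emeasure (H (z, a, y)) B \<partial>R' (z, a))"
    proof (rule nn_integral_cong)
      fix y assume "y \<in> space (R' (z, a))"
      then have y: "y \<in> obs_set M" using prob_measuresD(3)[OF Rp] by simp
      note Hp = prob_measuresD[OF in_prob_measures(3)[OF z a y]]
      have "(\<lambda>x. (x, y)) \<in> H (z, a, y) \<rightarrow>\<^sub>M borel_of X \<Otimes>\<^sub>M borel_of Y"
        using y by (simp add: measurable_cong_sets[OF Hp(2) refl])
      then have "emeasure (?D y) W = emeasure (H (z, a, y)) ((\<lambda>x. (x, y)) -` W \<inter> space (H (z, a, y)))"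
        using B C W by (intro emeasure_distr) auto
      also have "(\<lambda>x. (x, y)) -` W \<inter> space (H (z, a, y)) = (if y \<in> C then B else {})"
        using sets.sets_into_space[OF B] Hp(3) W by auto
      finally show "emeasure (?D y) W = emeasure (H (z, a, y)) B * indicator C y" by simp
    qed
    also have "\<dots> = emeasure (joint_kernel M (z, a)) W"
      using H z a B C W by (simp add: filter_kernel_def)
    finally show "emeasure (joint_kernel M (z, a)) W = emeasure (R' (z, a) \<bind> ?D) W" by simp
  next
    show "range (\<lambda>_. space (borel_of X) \<times> space (borel_of Y)) \<subseteq>
        {a \<times> b |a b. a \<in> sets (borel_of X) \<and> b \<in> sets (borel_of Y)}" by blast
    show "{a \<times> b |a b. a \<in> sets (borel_of X) \<and> b \<in> sets (borel_of Y)}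
        \<subseteq> Pow (space (borel_of X) \<times> space (borel_of Y))" by (rule pair_measure_closed)
  qed simp_all
qed

lemma integral_filter:
  assumes z: "z \<in> prob_measures X" and a: "a \<in> action_set M" and f: "unit_valued X f" and s: "unit_valued Y s"
  shows "(\<integral>y. s y * (\<integral>x. f x \<partial>H (z, a, y)) \<partial>R' (z, a)) = joint_integral (z, a) f s"
proof -
  note [measurable] = unit_valuedD(1)[OF f] unit_valuedD(1)[OF s]
  have Rp: "R' (z, a) \<in> prob_measures Y" by (rule next_obs_prob[OF z a])
  have u: "unit_valued Y (\<lambda>y. s y * (\<integral>x. f x \<partial>H (z, a, y)))"
    by (intro unit_valued_mult s unit_valued_kernel_integral[OF H_kernel[OF z a] f])
  have "ennreal (joint_integral (z, a) f s) =
      (\<integral>\<^sup>+y. \<integral>\<^sup>+w. ennreal (f (fst w) * s (snd w)) \<partial>distr (H (z, a, y)) (borel_of X \<Otimes>\<^sub>M borel_of Y) (\<lambda>x. (x, y)) \<partial>R' (z, a))"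
    unfolding joint_integral_eq[OF z a f s, symmetric] joint_kernel_disintegration(1)[OF z a]
    by (rule nn_integral_bind[OF _ measurable_prob_algebraD[OF joint_kernel_disintegration(2)[OF z a]]]) simp
  also have "\<dots> = (\<integral>\<^sup>+y. ennreal (s y * (\<integral>x. f x \<partial>H (z, a, y))) \<partial>R' (z, a))"
  proof (rule nn_integral_cong)
    fix y assume "y \<in> space (R' (z, a))"
    then have y: "y \<in> obs_set M" using prob_measuresD(3)[OF Rp] by simp
    note Hy = in_prob_measures(3)[OF z a y]
    note Hp = prob_measuresD[OF Hy]
    have s0: "0 \<le> s y" using unit_valuedD(2)[OF s] y by simp
    have "(\<lambda>x. (x, y)) \<in> H (z, a, y) \<rightarrow>\<^sub>M borel_of X \<Otimes>\<^sub>M borel_of Y"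
      using y by (simp add: measurable_cong_sets[OF Hp(2) refl])
    then have "(\<integral>\<^sup>+w. ennreal (f (fst w) * s (snd w)) \<partial>distr (H (z, a, y)) (borel_of X \<Otimes>\<^sub>M borel_of Y) (\<lambda>x. (x, y))) =
        (\<integral>\<^sup>+x. ennreal (f (fst (x, y)) * s (snd (x, y))) \<partial>H (z, a, y))"
      by (rule nn_integral_distr) measurable
    also have "\<dots> = (\<integral>\<^sup>+x. ennreal (f x * s y) \<partial>H (z, a, y))" by simp
    also have "\<dots> = (\<integral>\<^sup>+x. ennreal (s y) * ennreal (f x) \<partial>H (z, a, y))"
      using s0 unit_valuedD(2)[OF f] Hp(3) by (intro nn_integral_cong) (simp add: ennreal_mult mult.commute)
    also have "\<dots> = ennreal (s y) * ennreal (\<integral>x. f x \<partial>H (z, a, y))"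
      using Hp(2) by (subst nn_integral_cmult) (auto simp: unit_valued_nn_integral[OF Hy f] cong: measurable_cong_sets)
    finally show "(\<integral>\<^sup>+w. ennreal (f (fst w) * s (snd w)) \<partial>distr (H (z, a, y)) (borel_of X \<Otimes>\<^sub>M borel_of Y) (\<lambda>x. (x, y))) =
        ennreal (s y * (\<integral>x. f x \<partial>H (z, a, y)))"
      using s0 unit_valued_nn_integral(2)[OF Hy f] by (simp add: ennreal_mult)
  qed
  also have "\<dots> = ennreal (\<integral>y. s y * (\<integral>x. f x \<partial>H (z, a, y)) \<partial>R' (z, a))"
    by (rule unit_valued_nn_integral(1)[OF Rp u])
  finally show ?thesis
    using unit_valued_nn_integral(2)[OF Rp u] joint_integral_nonneg[OF z a f s] by simp
qed

subsection \<open>Continuity in the belief and the action\<close>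

lemma Q_integral_near:
  assumes "a \<in> action_set M" "b \<in> action_set M" "x \<in> state_set M" "y \<in> state_set M" "unit_valued Y s"
  shows "\<bar>(\<integral>w. s w \<partial>Q (a, x)) - (\<integral>w. s w \<partial>Q (b, y))\<bar> \<le> tv_gap Y (Q (a, x)) (Q (b, y))"
  using measurable_space[OF Q_kernel[OF assms(1)], of x] measurable_space[OF Q_kernel[OF assms(2)], of y] assms(3,4)
  by (intro tv_gap_bounds assms(5)) (auto simp: prob_measures_eq_space)

lemma tv_gap_tendsto:
  assumes "range a \<subseteq> action_set M" "limitin A a a0 sequentially" "range x \<subseteq> state_set M" "limitin X x x0 sequentially"
  shows "(\<lambda>n. tv_gap Y (Q (a n, x n)) (Q (a0, x0))) \<longlonglongrightarrow> 0"
proof -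
  have "limitin (prod_topology A X) (\<lambda>n. (a n, x n)) (a0, x0) sequentially"
    using assms unfolding limitin_pairwise o_def by simp
  moreover have "range (\<lambda>n. (a n, x n)) \<subseteq> topspace (prod_topology A X)" using assms by auto
  ultimately show ?thesis using Q_cont unfolding tv_continuous_def by blast
qed

text \<open>
  An Arzela-Ascoli argument: for fixed action the functions \<open>x \<mapsto> \<integral> s n dQ(a, x)\<close> are
  equicontinuous, because total variation bounds all test functions at once.
\<close>

lemma Q_integral_convergent_subsequence:
  assumes a: "a \<in> action_set M" and s: "\<And>n. unit_valued Y (s n)"
  obtains r :: "nat \<Rightarrow> nat" and \<psi> where "strict_mono r"
    "\<And>x. x \<in> state_set M \<Longrightarrow> (\<lambda>n. \<integral>y. s (r n) y \<partial>Q (a, x)) \<longlonglongrightarrow> \<psi> x"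
proof -
  define v where "v n x = (\<integral>y. s n y \<partial>Q (a, x))" for n x
  obtain D where D: "countable D" "D \<subseteq> state_set M" "state_set M \<subseteq> closure D"
    using separable by blast
  have "D \<noteq> {}" using D(3) M by (auto simp: is_pomdp_def)
  define d where "d = from_nat_into D"
  have d: "d k \<in> D" for k using from_nat_into[OF \<open>D \<noteq> {}\<close>] by (simp add: d_def)
  have v01: "0 \<le> v n x \<and> v n x \<le> 1" if "x \<in> state_set M" for n x
    using unit_valued_kernel_integral[OF Q_kernel[OF a] s[of n]] that by (auto simp: v_def unit_valued_def)
  obtain r :: "nat \<Rightarrow> nat" where r: "strict_mono r" "\<And>k. convergent (\<lambda>n. v (r n) (d k))"
    using convergent_coordinates_subsequence[of "\<lambda>n k. v n (d k)"] v01 d D(2) by blast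
  have "convergent (\<lambda>n. v (r n) x)" if x: "x \<in> state_set M" for x
  proof (rule Cauchy_convergent, rule metric_CauchyI)
    fix e :: real assume e: "0 < e"
    have "\<exists>U (k::nat). openin X U \<and> x \<in> U \<and> (\<forall>n\<ge>k. \<forall>y\<in>U. y \<in> state_set M \<and> tv_gap Y (Q (a, y)) (Q (a, x)) < e / 3)"
    proof (rule eventually_near_of_sequences[where P = "\<lambda>_ y. y \<in> state_set M \<and> tv_gap Y (Q (a, y)) (Q (a, x)) < e / 3"])
      show "first_countable X" using sm(1) by (simp add: separable_metrizable_def metrizable_imp_first_countable)
      fix w assume w: "range w \<subseteq> topspace X" "limitin X w x sequentially"
      have "(\<lambda>n. tv_gap Y (Q (a, w n)) (Q (a, x))) \<longlonglongrightarrow> 0"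
        using a w by (intro tv_gap_tendsto) auto
      from order_tendstoD(2)[OF this, of "e / 3"] w(1) e
      show "\<forall>\<^sub>F n in sequentially. w n \<in> state_set M \<and> tv_gap Y (Q (a, w n)) (Q (a, x)) < e / 3"
        by (auto elim!: eventually_mono)
    qed (use x in auto)
    then obtain U where U: "openin X U" "x \<in> U"
      and Uy: "\<And>y. y \<in> U \<Longrightarrow> y \<in> state_set M \<and> tv_gap Y (Q (a, y)) (Q (a, x)) < e / 3" by blast
    obtain V where V: "open V" "U = state_set M \<inter> V" using U(1) by (auto simp: openin_open)
    then have "V \<inter> D \<noteq> {}" using U(2) D(3) V x open_Int_closure_eq_empty[OF V(1), of D] by blast
    then obtain y where y: "y \<in> D" "y \<in> U" using V(2) D(2) by blast
    then obtain k where k: "y = d k" using D(1) by (metis d_def from_nat_into_surj)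
    have near: "\<bar>v n y - v n x\<bar> < e / 3" for n
      using Q_integral_near[OF a a _ x s, of y n] Uy[OF y(2)] unfolding v_def by linarith
    have "Cauchy (\<lambda>n. v (r n) y)" using r(2)[of k] by (simp add: k convergent_Cauchy)
    then obtain N where N: "\<And>m n. m \<ge> N \<Longrightarrow> n \<ge> N \<Longrightarrow> dist (v (r m) y) (v (r n) y) < e / 3"
      using e metric_CauchyD[of _ "e / 3"] by (metis divide_pos_pos zero_less_numeral)
    have "dist (v (r m) x) (v (r n) x) < e" if "m \<ge> N" "n \<ge> N" for m n
      using N[OF that] near[of "r m"] near[of "r n"] unfolding dist_real_def by linarith
    then show "\<exists>N. \<forall>m\<ge>N. \<forall>n\<ge>N. dist (v (r m) x) (v (r n) x) < e" by blast
  qed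
  then show ?thesis
    using that[OF r(1), of "\<lambda>x. lim (\<lambda>n. v (r n) x)"] by (auto simp: v_def convergent_LIMSEQ_iff)
qed

text \<open>
  The integrands converge continuously at every level: the observation kernel in total variation,
  then the transition kernel weakly, so the limit theorem for weakly converging measures applies
  first to \<open>P\<close> and then to the belief. The test functions \<open>s n\<close> may vary with \<open>n\<close>, as long as their
  integrals under \<open>Q(a0, x)\<close> converge for each \<open>x\<close>.
\<close>

lemma joint_integral_tendsto:
  assumes z: "range z \<subseteq> prob_measures X" "limitin (belief_top M) z z0 sequentially"
    and a: "range a \<subseteq> action_set M" "limitin A a a0 sequentially"
    and f: "continuous_map X euclideanreal f" "unit_valued X f"
    and s: "\<And>n. unit_valued Y (s n)"
    and \<psi>: "\<And>x. x \<in> state_set M \<Longrightarrow> (\<lambda>n. \<integral>y. s n y \<partial>Q (a0, x)) \<longlonglongrightarrow> \<psi> x"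
  shows "(\<lambda>n. joint_integral (z n, a n) f (s n)) \<longlonglongrightarrow> (\<integral>x. (\<integral>x'. f x' * \<psi> x' \<partial>P (x, a0)) \<partial>z0)"
proof -
  have a0: "a0 \<in> action_set M" using limitin_topspace[OF a(2)] by simp
  have an: "a n \<in> action_set M" for n using a(1) by auto
  define g where "g n x' = f x' * (\<integral>y. s n y \<partial>Q (a n, x'))" for n x'
  define G where "G n x = (\<integral>x'. g n x' \<partial>P (x, a n))" for n x
  define g0 where "g0 x' = f x' * \<psi> x'" for x'
  define G0 where "G0 x = (\<integral>x'. g0 x' \<partial>P (x, a0))" for x
  have g: "unit_valued X (g n)" "unit_valued X (G n)" for n
    unfolding g_def G_def by (rule unit_valued_inner[OF an f(2) s])+
  have q: "unit_valued X (\<lambda>x. \<integral>y. s n y \<partial>Q (a0, x))" for n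
    by (rule unit_valued_kernel_integral[OF Q_kernel[OF a0] s])
  have "unit_valued X \<psi>"
    unfolding unit_valued_def
  proof (intro conjI ballI)
    show "\<psi> \<in> borel_measurable (borel_of X)"
      by (rule borel_measurable_LIMSEQ_real[OF _ unit_valuedD(1)[OF q]]) (use \<psi> in simp)
    fix x assume "x \<in> topspace X"
    then have x: "x \<in> state_set M" by simp
    show "0 \<le> \<psi> x" by (rule LIMSEQ_le_const[OF \<psi>[OF x]]) (use unit_valuedD(2)[OF q] x in simp)
    show "\<psi> x \<le> 1" by (rule LIMSEQ_le_const2[OF \<psi>[OF x]]) (use unit_valuedD(3)[OF q] x in simp)
  qed
  then have g0: "unit_valued X g0" unfolding g0_def by (rule unit_valued_mult[OF f(2)])
  then have G0: "unit_valued X G0" unfolding G0_def by (rule unit_valued_kernel_integral[OF P_kernel[OF a0]])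
  have g_lim: "(\<lambda>n. g n (x n)) \<longlonglongrightarrow> g0 x0" if x: "range x \<subseteq> topspace X" "limitin X x x0 sequentially" for x x0
  proof -
    have x0: "x0 \<in> state_set M" using limitin_topspace[OF x(2)] by simp
    have xn: "x n \<in> state_set M" for n using x(1) by auto
    have "(\<lambda>n. (\<integral>y. s n y \<partial>Q (a n, x n)) - (\<integral>y. s n y \<partial>Q (a0, x0))) \<longlonglongrightarrow> 0"
    proof (rule Lim_null_comparison[OF always_eventually])
      show "\<forall>n. norm ((\<integral>y. s n y \<partial>Q (a n, x n)) - (\<integral>y. s n y \<partial>Q (a0, x0))) \<le> tv_gap Y (Q (a n, x n)) (Q (a0, x0))"
        using Q_integral_near[OF an a0 xn x0 s] by simp
      show "(\<lambda>n. tv_gap Y (Q (a n, x n)) (Q (a0, x0))) \<longlonglongrightarrow> 0"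
        using a x by (intro tv_gap_tendsto) auto
    qed
    from tendsto_add[OF this \<psi>[OF x0]] have "(\<lambda>n. \<integral>y. s n y \<partial>Q (a n, x n)) \<longlonglongrightarrow> \<psi> x0" by simp
    moreover have "(\<lambda>n. f (x n)) \<longlonglongrightarrow> f x0"
      using continuous_map_limit[OF f(1) x(2)] by (simp add: o_def)
    ultimately show ?thesis unfolding g_def g0_def by (rule tendsto_mult[rotated])
  qed
  have G_lim: "(\<lambda>n. G n (x n)) \<longlonglongrightarrow> G0 x0" if x: "range x \<subseteq> topspace X" "limitin X x x0 sequentially" for x x0
    unfolding G_def G0_def
  proof (rule tendsto_integral_weak[OF sm(1), where B = 1])
    have "limitin (prod_topology X A) (\<lambda>n. (x n, a n)) (x0, a0) sequentially"
      using x a unfolding limitin_pairwise o_def by simp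
    moreover have "range (\<lambda>n. (x n, a n)) \<subseteq> topspace (prod_topology X A)" using x a by auto
    ultimately show "limitin (weak_topology X) (\<lambda>n. P (x n, a n)) (P (x0, a0)) sequentially"
      using P_cont unfolding weakly_continuous_def by blast
    show "range (\<lambda>n. P (x n, a n)) \<subseteq> prob_measures X"
      using measurable_space[OF P_kernel[OF an]] x(1) by (fastforce simp: prob_measures_eq_space)
  qed (use g_lim unit_valuedD[OF g(1)] unit_valuedD[OF g0] in auto)
  have "(\<lambda>n. \<integral>x. G n x \<partial>z n) \<longlonglongrightarrow> (\<integral>x. G0 x \<partial>z0)"
    by (rule tendsto_integral_weak[OF sm(1) z(2,1), where B = 1])
      (use G_lim unit_valuedD[OF g(2)] unit_valuedD[OF G0] in auto)
  then show ?thesis by (simp add: joint_integral_def G_def G0_def g_def g0_def)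
qed

context
  fixes z :: "nat \<Rightarrow> 'x measure" and z0 and a :: "nat \<Rightarrow> 'a" and a0
  assumes z: "range z \<subseteq> prob_measures X" "limitin (belief_top M) z z0 sequentially"
    and a: "range a \<subseteq> action_set M" "limitin A a a0 sequentially"
begin

lemma zn: "z n \<in> prob_measures X" "a n \<in> action_set M" "z0 \<in> prob_measures X" "a0 \<in> action_set M"
  using z(1) a(1) limitin_topspace[OF z(2)] limitin_topspace[OF a(2)] by auto

text \<open>
  Along a subsequence the integrals of \<open>s n\<close> under \<open>Q(a0, x)\<close> converge, and then both terms have the
  same limit. As the sequence \<open>s\<close> is arbitrary, this is convergence in total variation of the joint
  law in its observation coordinate.
\<close>

proposition joint_integral_diff:
  assumes f: "continuous_map X euclideanreal f" "unit_valued X f" and s: "\<And>n. unit_valued Y (s n)"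
  shows "(\<lambda>n. joint_integral (z n, a n) f (s n) - joint_integral (z0, a0) f (s n)) \<longlonglongrightarrow> 0"
proof (rule tendsto_of_subsequences)
  fix r :: "nat \<Rightarrow> nat" assume r: "strict_mono r"
  obtain r' :: "nat \<Rightarrow> nat" and \<psi> where r': "strict_mono r'"
    and \<psi>: "\<And>x. x \<in> state_set M \<Longrightarrow> (\<lambda>n. \<integral>y. s (r (r' n)) y \<partial>Q (a0, x)) \<longlonglongrightarrow> \<psi> x"
    using Q_integral_convergent_subsequence[OF zn(4), of "\<lambda>n. s (r n)"] s by metis
  have rr: "strict_mono (r \<circ> r')" using r r' by (rule strict_mono_o)
  have "(\<lambda>n. joint_integral (z (r (r' n)), a (r (r' n))) f (s (r (r' n)))) \<longlonglongrightarrow> (\<integral>x. (\<integral>x'. f x' * \<psi> x' \<partial>P (x, a0)) \<partial>z0)"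
  proof (rule joint_integral_tendsto[OF _ _ _ _ f s \<psi>])
    show "limitin (belief_top M) (\<lambda>n. z (r (r' n))) z0 sequentially" "limitin A (\<lambda>n. a (r (r' n))) a0 sequentially"
      using limitin_subsequence[OF rr z(2)] limitin_subsequence[OF rr a(2)] by (simp_all add: o_def)
  qed (use zn in auto)
  moreover have "(\<lambda>n. joint_integral (z0, a0) f (s (r (r' n)))) \<longlonglongrightarrow> (\<integral>x. (\<integral>x'. f x' * \<psi> x' \<partial>P (x, a0)) \<partial>z0)"
    by (rule joint_integral_tendsto[OF _ _ _ _ f s \<psi>]) (use zn in \<open>auto simp: limitin_const\<close>)
  ultimately have "(\<lambda>n. joint_integral (z (r (r' n)), a (r (r' n))) f (s (r (r' n))) - joint_integral (z0, a0) f (s (r (r' n)))) \<longlonglongrightarrow> 0"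
    using tendsto_diff by fastforce
  then show "\<exists>r'. strict_mono r' \<and> (\<lambda>n. joint_integral (z (r (r' n)), a (r (r' n))) f (s (r (r' n))) -
      joint_integral (z0, a0) f (s (r (r' n)))) \<longlonglongrightarrow> 0"
    using r' by blast
qed

corollary next_obs_integral_diff:
  assumes s: "\<And>n. unit_valued Y (s n)"
  shows "(\<lambda>n. (\<integral>y. s n y \<partial>R' (z n, a n)) - (\<integral>y. s n y \<partial>R' (z0, a0))) \<longlonglongrightarrow> 0"
  using joint_integral_diff[of "\<lambda>_. 1", OF _ _ s] integral_next_obs[OF zn(1,2) s] integral_next_obs[OF zn(3,4) s]
  by (simp add: unit_valued_const)

text \<open>
  The joint law and the marginal law of the observation both converge uniformly over test functions
  of \<open>y\<close>. Hence the marginal for \<open>(z n, a n)\<close> can be replaced by the one for \<open>(z0, a0)\<close>, after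
  which both filter integrals are densities with respect to one and the same measure.
\<close>

lemma filter_L1_tendsto:
  assumes f: "continuous_map X euclideanreal f" "unit_valued X f"
  shows "(\<lambda>n. \<integral>y. \<bar>(\<integral>x. f x \<partial>H (z n, a n, y)) - (\<integral>x. f x \<partial>H (z0, a0, y))\<bar> \<partial>R' (z0, a0)) \<longlonglongrightarrow> 0"
proof -
  define \<phi> where "\<phi> n y = (\<integral>x. f x \<partial>H (z n, a n, y))" for n y
  define \<phi>0 where "\<phi>0 y = (\<integral>x. f x \<partial>H (z0, a0, y))" for y
  have \<phi>: "unit_valued Y (\<phi> n)" for n unfolding \<phi>_def by (rule unit_valued_kernel_integral[OF H_kernel[OF zn(1,2)] f(2)])
  have \<phi>0: "unit_valued Y \<phi>0" unfolding \<phi>0_def by (rule unit_valued_kernel_integral[OF H_kernel[OF zn(3,4)] f(2)])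
  note R0 = next_obs_prob[OF zn(3,4)]
  have test: "(\<lambda>n. (\<integral>y. t n y * \<phi> n y \<partial>R' (z0, a0)) - (\<integral>y. t n y * \<phi>0 y \<partial>R' (z0, a0))) \<longlonglongrightarrow> 0"
    if t: "\<And>n. unit_valued Y (t n)" for t
  proof -
    have "(\<lambda>n. (\<integral>y. t n y * \<phi> n y \<partial>R' (z n, a n)) - (\<integral>y. t n y * \<phi>0 y \<partial>R' (z0, a0))) \<longlonglongrightarrow> 0"
      using joint_integral_diff[OF f t]
      by (simp add: \<phi>_def \<phi>0_def integral_filter[OF zn(1,2) f(2) t] integral_filter[OF zn(3,4) f(2) t])
    moreover have "(\<lambda>n. (\<integral>y. t n y * \<phi> n y \<partial>R' (z n, a n)) - (\<integral>y. t n y * \<phi> n y \<partial>R' (z0, a0))) \<longlonglongrightarrow> 0"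
      by (rule next_obs_integral_diff) (intro unit_valued_mult t \<phi>)
    ultimately show ?thesis using tendsto_diff by fastforce
  qed
  \<comment> \<open>the absolute value is produced by testing with the set where the difference is nonnegative\<close>
  define t where "t n = (\<lambda>y. indicator {y \<in> space (borel_of Y). \<phi>0 y \<le> \<phi> n y} y :: real)" for n
  have t: "unit_valued Y (t n)" for n
  proof -
    note [measurable] = unit_valuedD(1)[OF \<phi>] unit_valuedD(1)[OF \<phi>0]
    have "t n \<in> borel_measurable (borel_of Y)" unfolding t_def by measurable
    then show ?thesis by (auto simp: unit_valued_def t_def)
  qed
  have "(\<integral>y. \<bar>\<phi> n y - \<phi>0 y\<bar> \<partial>R' (z0, a0)) =
      2 * ((\<integral>y. t n y * \<phi> n y \<partial>R' (z0, a0)) - (\<integral>y. t n y * \<phi>0 y \<partial>R' (z0, a0))) -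
      ((\<integral>y. 1 * \<phi> n y \<partial>R' (z0, a0)) - (\<integral>y. 1 * \<phi>0 y \<partial>R' (z0, a0)))" for n
  proof -
    note i = unit_valued_nn_integral(4)[OF R0]
    note ii = i[OF unit_valued_mult[OF t[of n] \<phi>[of n]]] i[OF unit_valued_mult[OF t[of n] \<phi>0]] i[OF \<phi>[of n]] i[OF \<phi>0]
    have "(\<integral>y. \<bar>\<phi> n y - \<phi>0 y\<bar> \<partial>R' (z0, a0)) =
        (\<integral>y. 2 * (t n y * \<phi> n y - t n y * \<phi>0 y) - (\<phi> n y - \<phi>0 y) \<partial>R' (z0, a0))"
      using prob_measuresD(3)[OF R0]
      by (intro Bochner_Integration.integral_cong refl) (auto simp: t_def indicator_def)
    also have "\<dots> = 2 * ((\<integral>y. t n y * \<phi> n y \<partial>R' (z0, a0)) - (\<integral>y. t n y * \<phi>0 y \<partial>R' (z0, a0))) -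
      ((\<integral>y. \<phi> n y \<partial>R' (z0, a0)) - (\<integral>y. \<phi>0 y \<partial>R' (z0, a0)))"
      using ii by simp
    finally show ?thesis by simp
  qed
  moreover have "(\<lambda>n. 2 * ((\<integral>y. t n y * \<phi> n y \<partial>R' (z0, a0)) - (\<integral>y. t n y * \<phi>0 y \<partial>R' (z0, a0))) -
      ((\<integral>y. 1 * \<phi> n y \<partial>R' (z0, a0)) - (\<integral>y. 1 * \<phi>0 y \<partial>R' (z0, a0)))) \<longlonglongrightarrow> 2 * 0 - 0"
    by (intro tendsto_diff tendsto_mult_left test[of t] test[of "\<lambda>_ _. 1"] t unit_valued_const) auto
  ultimately show ?thesis by (simp add: \<phi>_def \<phi>0_def)
qed

text \<open>
  Convergence in \<open>L\<^sup>1\<close> gives almost sure convergence along a subsequence; applied to a weighted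
  sum over a determining family it does so for all test functions at once.
\<close>

lemma filter_AE_subsequence:
  obtains r :: "nat \<Rightarrow> nat" where "strict_mono r"
    "AE y in R' (z0, a0). limitin (belief_top M) (\<lambda>n. H (z (r n), a (r n), y)) (H (z0, a0, y)) sequentially"
proof -
  obtain e :: "nat \<Rightarrow> 'x \<Rightarrow> real" where e: "\<And>n. continuous_map X euclideanreal (e n)"
    "\<And>n x. x \<in> topspace X \<Longrightarrow> 0 \<le> e n x \<and> e n x \<le> 1"
    and lim: "\<And>\<mu> \<nu>. range \<mu> \<subseteq> prob_measures X \<Longrightarrow> \<nu> \<in> prob_measures X \<Longrightarrow>
       (\<And>n. (\<lambda>i. \<integral>x. e n x \<partial>\<mu> i) \<longlonglongrightarrow> (\<integral>x. e n x \<partial>\<nu>)) \<Longrightarrow>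
       limitin (weak_topology X) \<mu> \<nu> sequentially"
    using weak_convergence_determining_family[OF sm(1)] by metis
  have eu: "unit_valued X (e m)" for m
    using e measurable_euclideanreal_borel_of[OF e(1)] by (auto simp: unit_valued_def)
  note R0 = next_obs_prob[OF zn(3,4)]
  define D where "D m n y = \<bar>(\<integral>x. e m x \<partial>H (z n, a n, y)) - (\<integral>x. e m x \<partial>H (z0, a0, y))\<bar>" for m n y
  have D: "unit_valued Y (D m n)" for m n
    unfolding D_def
    by (intro unit_valued_abs_diff unit_valued_kernel_integral[OF H_kernel[OF zn(1,2)] eu]
        unit_valued_kernel_integral[OF H_kernel[OF zn(3,4)] eu])
  define W where "W n y = (\<Sum>m. (1/2)^Suc m * D m n y)" for n y
  have summ: "summable (\<lambda>m. (1/2)^Suc m * D m n y)" if "y \<in> topspace Y" for n y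
    using unit_valuedD(2,3)[OF D that]
    by (intro summable_comparison_test'[OF power_half_series[THEN sums_summable], of 0]) (auto simp: abs_mult)
  have W: "unit_valued Y (W n)" for n
    unfolding unit_valued_def
  proof (intro conjI ballI)
    show "W n \<in> borel_measurable (borel_of Y)"
      unfolding W_def using unit_valuedD(1)[OF D] by (intro borel_measurable_suminf) auto
    fix y assume y: "y \<in> topspace Y"
    show "0 \<le> W n y" unfolding W_def using unit_valuedD(2)[OF D y] by (intro suminf_nonneg summ y) auto
    have "W n y \<le> (\<Sum>m. (1/2)^Suc m)"
      unfolding W_def using unit_valuedD(2,3)[OF D y]
      by (intro suminf_le summ y power_half_series[THEN sums_summable]) auto
    then show "W n y \<le> 1" using power_half_series sums_unique by fastforce
  qed
  have W_int: "(\<integral>y. W n y \<partial>R' (z0, a0)) = (\<Sum>m. (1/2)^Suc m * (\<integral>y. D m n y \<partial>R' (z0, a0)))" for n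
  proof -
    have "(\<integral>y. W n y \<partial>R' (z0, a0)) = (\<Sum>m. \<integral>y. (1/2)^Suc m * D m n y \<partial>R' (z0, a0))"
      unfolding W_def
    proof (rule integral_suminf)
      show "integrable (R' (z0, a0)) (\<lambda>y. (1/2)^Suc m * D m n y)" for m
        using unit_valued_nn_integral(4)[OF R0 D] by simp
      show "AE y in R' (z0, a0). summable (\<lambda>m. norm ((1/2)^Suc m * D m n y))"
        using summ unit_valuedD(2)[OF D] prob_measuresD(3)[OF R0] by (intro AE_I2) (simp add: abs_mult)
      have "0 \<le> (\<integral>y. D m n y \<partial>R' (z0, a0))" "(\<integral>y. D m n y \<partial>R' (z0, a0)) \<le> 1" for m
        using unit_valued_nn_integral(2,3)[OF R0 D] by auto
      moreover have "(\<integral>y. norm ((1/2)^Suc m * D m n y) \<partial>R' (z0, a0)) = (1/2)^Suc m * (\<integral>y. D m n y \<partial>R' (z0, a0))" for m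
      proof -
        have "(\<integral>y. norm ((1/2)^Suc m * D m n y) \<partial>R' (z0, a0)) = (\<integral>y. (1/2)^Suc m * D m n y \<partial>R' (z0, a0))"
          using unit_valuedD(2)[OF D] prob_measuresD(3)[OF R0]
          by (intro Bochner_Integration.integral_cong) (auto simp: abs_mult)
        then show ?thesis by simp
      qed
      ultimately show "summable (\<lambda>m. \<integral>y. norm ((1/2)^Suc m * D m n y) \<partial>R' (z0, a0))"
        by (intro summable_comparison_test'[OF power_half_series[THEN sums_summable], of 0]) (auto simp: abs_mult)
    qed
    then show ?thesis by simp
  qed
  have "(\<lambda>n. \<Sum>m. (1/2)^Suc m * (\<integral>y. D m n y \<partial>R' (z0, a0))) \<longlonglongrightarrow> (\<Sum>m. 0)"
  proof (rule tannerys_theorem[where M = "\<lambda>m. (1/2)^Suc m", THEN conjunct2, THEN conjunct2])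
    show "(\<lambda>n. (1/2)^Suc m * (\<integral>y. D m n y \<partial>R' (z0, a0))) \<longlonglongrightarrow> 0" for m
      using filter_L1_tendsto[OF e(1) eu] unfolding D_def by (intro tendsto_mult_right_zero)
    show "\<forall>\<^sub>F (m, n) in at_top \<times>\<^sub>F sequentially. norm ((1/2)^Suc m * (\<integral>y. D m n y \<partial>R' (z0, a0))) \<le> (1/2)^Suc m"
      using unit_valued_nn_integral(2,3)[OF R0 D] by (intro always_eventually) (auto simp: abs_mult)
    show "summable (\<lambda>m. (1/2::real)^Suc m)" by (rule power_half_series[THEN sums_summable])
  qed auto
  then have "(\<lambda>n. \<integral>y. norm (W n y) \<partial>R' (z0, a0)) \<longlonglongrightarrow> 0"
  proof -
    have "(\<integral>y. norm (W n y) \<partial>R' (z0, a0)) = (\<integral>y. W n y \<partial>R' (z0, a0))" for n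
      using unit_valuedD(2)[OF W] prob_measuresD(3)[OF R0] by (intro Bochner_Integration.integral_cong) auto
    then show ?thesis using \<open>_ \<longlonglongrightarrow> (\<Sum>m. 0)\<close> by (simp add: W_int)
  qed
  then obtain r :: "nat \<Rightarrow> nat" where r: "strict_mono r" "AE y in R' (z0, a0). (\<lambda>n. W (r n) y) \<longlonglongrightarrow> 0"
    using tendsto_L1_AE_subseq[of "R' (z0, a0)" W] unit_valued_nn_integral(4)[OF R0 W] by blast
  have "AE y in R' (z0, a0). limitin (belief_top M) (\<lambda>n. H (z (r n), a (r n), y)) (H (z0, a0, y)) sequentially"
    using r(2) AE_space
  proof eventually_elim
    case (elim y)
    then have y: "y \<in> topspace Y" using prob_measuresD(3)[OF R0] by simp
    show ?case
    proof (rule lim)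
      show "range (\<lambda>n. H (z (r n), a (r n), y)) \<subseteq> prob_measures X" "H (z0, a0, y) \<in> prob_measures X"
        using in_prob_measures(3)[OF zn(1,2)] in_prob_measures(3)[OF zn(3,4)] y by auto
      fix m
      have "(\<lambda>n. D m (r n) y) \<longlonglongrightarrow> 0"
      proof (rule tendsto_sandwich[OF always_eventually always_eventually tendsto_const])
        show "\<forall>n. 0 \<le> D m (r n) y" by (simp add: D_def)
        have "(1/2)^Suc m * D m (r n) y \<le> W (r n) y" for n
          unfolding W_def using unit_valuedD(2)[OF D y] summ[OF y]
          sum_le_suminf[of "\<lambda>m. (1/2)^Suc m * D m (r n) y" "{m}"] by simp
        then show "\<forall>n. D m (r n) y \<le> 2^Suc m * W (r n) y" by (simp add: power_divide field_simps)
        show "(\<lambda>n. 2^Suc m * W (r n) y) \<longlonglongrightarrow> 0" using elim(1) by (intro tendsto_mult_right_zero)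
      qed
      then have "(\<lambda>n. (\<integral>x. e m x \<partial>H (z (r n), a (r n), y)) - (\<integral>x. e m x \<partial>H (z0, a0, y))) \<longlonglongrightarrow> 0"
        unfolding D_def by (simp add: tendsto_rabs_zero_iff)
      then show "(\<lambda>n. \<integral>x. e m x \<partial>H (z (r n), a (r n), y)) \<longlonglongrightarrow> (\<integral>x. e m x \<partial>H (z0, a0, y))"
        by (simp add: LIM_zero_iff)
    qed
  qed
  with r(1) show ?thesis using that by blast
qed

end

lemma H_measurable_belief:
  assumes z: "z \<in> prob_measures X" and a: "a \<in> action_set M"
  shows "(\<lambda>y. H (z, a, y)) \<in> borel_of Y \<rightarrow>\<^sub>M borel_of (belief_top M)"
  using H_kernel[OF z a]
  by (simp add: measurable_cong_sets[OF refl sets_borel_of_weak_topology[OF sm(1)]])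

text \<open>
  Every subsequence has a further one along which the posterior beliefs converge almost surely, so
  dominated convergence settles the fixed observation law; the change of the observation law is
  negligible uniformly over the integrands.
\<close>

lemma filter_integral_tendsto:
  assumes z: "range z \<subseteq> prob_measures X" "limitin (belief_top M) z z0 sequentially"
    and a: "range a \<subseteq> action_set M" "limitin A a a0 sequentially"
    and F: "continuous_map (belief_top M) euclideanreal F" "unit_valued (belief_top M) F"
  shows "(\<lambda>n. \<integral>y. F (H (z n, a n, y)) \<partial>R' (z n, a n)) \<longlonglongrightarrow> (\<integral>y. F (H (z0, a0, y)) \<partial>R' (z0, a0))"
proof -
  note zn = zn[OF z a]
  note R0 = next_obs_prob[OF zn(3,4)]
  have FH: "unit_valued Y (\<lambda>y. F (H (w, b, y)))" if w: "w \<in> prob_measures X" and b: "b \<in> action_set M" for w b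
    unfolding unit_valued_def
  proof (intro conjI ballI)
    show "(\<lambda>y. F (H (w, b, y))) \<in> borel_measurable (borel_of Y)"
      by (rule measurable_compose[OF H_measurable_belief[OF w b] unit_valuedD(1)[OF F(2)]])
    fix y assume "y \<in> topspace Y"
    then have "H (w, b, y) \<in> topspace (belief_top M)" using in_prob_measures(3)[OF w b] by simp
    then show "0 \<le> F (H (w, b, y))" "F (H (w, b, y)) \<le> 1" using unit_valuedD(2,3)[OF F(2)] by auto
  qed
  have "(\<lambda>n. \<integral>y. F (H (z n, a n, y)) \<partial>R' (z0, a0)) \<longlonglongrightarrow> (\<integral>y. F (H (z0, a0, y)) \<partial>R' (z0, a0))"
  proof (rule tendsto_of_subsequences)
    fix r :: "nat \<Rightarrow> nat" assume r: "strict_mono r"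
    have "range (\<lambda>n. z (r n)) \<subseteq> prob_measures X" "limitin (belief_top M) (\<lambda>n. z (r n)) z0 sequentially"
      "range (\<lambda>n. a (r n)) \<subseteq> action_set M" "limitin A (\<lambda>n. a (r n)) a0 sequentially"
      using z a limitin_subsequence[OF r z(2)] limitin_subsequence[OF r a(2)] by (auto simp: o_def)
    from filter_AE_subsequence[OF this] obtain r' :: "nat \<Rightarrow> nat" where r': "strict_mono r'"
      and ae: "AE y in R' (z0, a0). limitin (belief_top M) (\<lambda>n. H (z (r (r' n)), a (r (r' n)), y)) (H (z0, a0, y)) sequentially"
      by blast
    have "(\<lambda>n. \<integral>y. F (H (z (r (r' n)), a (r (r' n)), y)) \<partial>R' (z0, a0)) \<longlonglongrightarrow> (\<integral>y. F (H (z0, a0, y)) \<partial>R' (z0, a0))"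
    proof (rule integral_dominated_convergence[where w = "\<lambda>_. 1"])
      show "(\<lambda>y. F (H (z0, a0, y))) \<in> borel_measurable (R' (z0, a0))"
        "(\<lambda>y. F (H (z (r (r' n)), a (r (r' n)), y))) \<in> borel_measurable (R' (z0, a0))" for n
        using unit_valuedD(1)[OF FH[OF zn(3,4)]] unit_valuedD(1)[OF FH[OF zn(1,2)]]
        by (simp_all add: measurable_cong_sets[OF prob_measuresD(2)[OF R0] refl])
      show "integrable (R' (z0, a0)) (\<lambda>_. 1 :: real)"
        by (rule unit_valued_nn_integral(4)[OF R0 unit_valued_const]) simp_all
      show "AE y in R' (z0, a0). (\<lambda>n. F (H (z (r (r' n)), a (r (r' n)), y))) \<longlonglongrightarrow> F (H (z0, a0, y))"
        using ae
      proof eventually_elim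
        case (elim y)
        then show ?case using continuous_map_limit[OF F(1) elim] by (simp add: o_def)
      qed
      show "AE y in R' (z0, a0). norm (F (H (z (r (r' n)), a (r (r' n)), y))) \<le> 1" for n
        using unit_valuedD(4)[OF FH[OF zn(1,2)]] prob_measuresD(3)[OF R0] by (intro AE_I2) simp
    qed
    then show "\<exists>r'. strict_mono r' \<and> (\<lambda>n. \<integral>y. F (H (z (r (r' n)), a (r (r' n)), y)) \<partial>R' (z0, a0))
        \<longlonglongrightarrow> (\<integral>y. F (H (z0, a0, y)) \<partial>R' (z0, a0))" using r' by blast
  qed
  moreover have "(\<lambda>n. (\<integral>y. F (H (z n, a n, y)) \<partial>R' (z n, a n)) - (\<integral>y. F (H (z n, a n, y)) \<partial>R' (z0, a0))) \<longlonglongrightarrow> 0"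
    by (rule next_obs_integral_diff[OF z a]) (rule FH[OF zn(1,2)])
  ultimately show ?thesis using tendsto_add by fastforce
qed

lemma belief_kernel_prob:
  assumes z: "z \<in> prob_measures X" and a: "a \<in> action_set M"
  shows "belief_kernel M H (z, a) \<in> prob_measures (belief_top M)"
proof -
  note R = next_obs_prob[OF z a]
  interpret prob_space "R' (z, a)" using prob_measuresD(1)[OF R] .
  have "(\<lambda>y. H (z, a, y)) \<in> R' (z, a) \<rightarrow>\<^sub>M borel_of (belief_top M)"
    using H_measurable_belief[OF z a] by (simp add: measurable_cong_sets[OF prob_measuresD(2)[OF R] refl])
  then show ?thesis by (simp add: belief_kernel_def prob_measures_def prob_space_distr)
qed

lemma nn_integral_belief_kernel:
  assumes z: "z \<in> prob_measures X" and a: "a \<in> action_set M"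
    and g: "g \<in> borel_measurable (borel_of (belief_top M))"
  shows "(\<integral>\<^sup>+w. g w \<partial>belief_kernel M H (z, a)) =
    (\<integral>\<^sup>+x. \<integral>\<^sup>+x'. \<integral>\<^sup>+y. g (H (z, a, y)) \<partial>Q (a, x') \<partial>P (x, a) \<partial>z)"
proof -
  note R = next_obs_prob[OF z a]
  have "(\<lambda>y. H (z, a, y)) \<in> R' (z, a) \<rightarrow>\<^sub>M borel_of (belief_top M)"
    using H_measurable_belief[OF z a] by (simp add: measurable_cong_sets[OF prob_measuresD(2)[OF R] refl])
  then have "(\<integral>\<^sup>+w. g w \<partial>belief_kernel M H (z, a)) = (\<integral>\<^sup>+y. g (H (z, a, y)) \<partial>R' (z, a))"
    unfolding belief_kernel_def prod.case using g by (intro nn_integral_distr) auto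
  also have "\<dots> = (\<integral>\<^sup>+x. \<integral>\<^sup>+x'. \<integral>\<^sup>+y. g (H (z, a, y)) \<partial>Q (a, x') \<partial>P (x, a) \<partial>z)"
    by (rule nn_integral_next_obs[OF z a measurable_compose[OF H_measurable_belief[OF z a] g]])
  finally show ?thesis .
qed

theorem belief_kernel_weakly_continuous:
  "weakly_continuous (belief_top M) (prod_topology (belief_top M) A) (belief_kernel M H)"
  unfolding weakly_continuous_def
proof (intro allI impI)
  fix s s0
  assume s: "range s \<subseteq> topspace (prod_topology (belief_top M) A) \<and> limitin (prod_topology (belief_top M) A) s s0 sequentially"
  define z a where "z n = fst (s n)" and "a n = snd (s n)" for n
  obtain z0 a0 where s0: "s0 = (z0, a0)" by (cases s0)
  have sn: "s n = (z n, a n)" for n by (simp add: z_def a_def)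
  have z: "range z \<subseteq> prob_measures X" "limitin (belief_top M) z z0 sequentially"
    and a: "range a \<subseteq> action_set M" "limitin A a a0 sequentially"
  proof -
    have "z n \<in> prob_measures X \<and> a n \<in> action_set M" for n
      using s sn[of n] by (metis SigmaE2 UNIV_I image_subset_iff topspace_euclidean_subtopology topspace_prod_topology topspace_weak_topology)
    then show "range z \<subseteq> prob_measures X" "range a \<subseteq> action_set M" by auto
    show "limitin (belief_top M) z z0 sequentially" "limitin A a a0 sequentially"
      using s unfolding limitin_pairwise s0 by (simp_all add: z_def[abs_def] a_def[abs_def] o_def)
  qed
  note zn = zn[OF z a]
  note sB = separable_metrizable_weak_topology[OF sm(1)]
  obtain e :: "nat \<Rightarrow> 'x measure \<Rightarrow> real" where e: "\<And>n. continuous_map (belief_top M) euclideanreal (e n)"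
    "\<And>n x. x \<in> topspace (belief_top M) \<Longrightarrow> 0 \<le> e n x \<and> e n x \<le> 1"
    and lim: "\<And>\<mu> \<nu>. range \<mu> \<subseteq> prob_measures (belief_top M) \<Longrightarrow> \<nu> \<in> prob_measures (belief_top M) \<Longrightarrow>
       (\<And>n. (\<lambda>i. \<integral>x. e n x \<partial>\<mu> i) \<longlonglongrightarrow> (\<integral>x. e n x \<partial>\<nu>)) \<Longrightarrow>
       limitin (weak_topology (belief_top M)) \<mu> \<nu> sequentially"
    using weak_convergence_determining_family[OF sB] by metis
  have eu: "unit_valued (belief_top M) (e m)" for m
    using e measurable_euclideanreal_borel_of[OF e(1)] by (auto simp: unit_valued_def)
  have int: "(\<integral>w. e m w \<partial>belief_kernel M H (w, b)) = (\<integral>y. e m (H (w, b, y)) \<partial>R' (w, b))"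
    if w: "w \<in> prob_measures X" and b: "b \<in> action_set M" for m w b
    unfolding belief_kernel_def prod.case
  proof (rule integral_distr[OF _ unit_valuedD(1)[OF eu]])
    show "(\<lambda>y. H (w, b, y)) \<in> R' (w, b) \<rightarrow>\<^sub>M borel_of (belief_top M)"
      using H_measurable_belief[OF w b] by (simp add: measurable_cong_sets[OF prob_measuresD(2)[OF next_obs_prob[OF w b]] refl])
  qed
  show "limitin (weak_topology (belief_top M)) (\<lambda>n. belief_kernel M H (s n)) (belief_kernel M H s0) sequentially"
    unfolding s0 sn
  proof (rule lim)
    show "range (\<lambda>n. belief_kernel M H (z n, a n)) \<subseteq> prob_measures (belief_top M)"
      "belief_kernel M H (z0, a0) \<in> prob_measures (belief_top M)"
      using belief_kernel_prob[OF zn(1,2)] belief_kernel_prob[OF zn(3,4)] by auto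
    show "(\<lambda>n. \<integral>w. e m w \<partial>belief_kernel M H (z n, a n)) \<longlonglongrightarrow> (\<integral>w. e m w \<partial>belief_kernel M H (z0, a0))" for m
      unfolding int[OF zn(1,2)] int[OF zn(3,4)] by (rule filter_integral_tendsto[OF z a e(1) eu])
  qed
qed

end

section \<open>Inf-compactness of the expected cost\<close>

lemma lsc_liminf:
  assumes f: "lsc T f" and s: "limitin T s x sequentially"
  shows "f x \<le> liminf (\<lambda>n. f (s n))"
  unfolding le_Liminf_iff
proof (intro allI impI)
  fix r assume r: "r < f x"
  have "openin T {y \<in> topspace T. r < f y}" using f by (simp add: lsc_def)
  moreover have "x \<in> {y \<in> topspace T. r < f y}" using r limitin_topspace[OF s] by simp
  ultimately have "\<forall>\<^sub>F n in sequentially. s n \<in> {y \<in> topspace T. r < f y}"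
    using s unfolding limitin_def by blast
  then show "\<forall>\<^sub>F n in sequentially. r < f (s n)" by (rule eventually_mono) simp
qed

text \<open>
  If the actions \<open>a n\<close> had no cluster point, the costs would tend to infinity along every convergent
  sequence of states, and Fatou's lemma would make the expected costs unbounded.
\<close>

theorem K_inf_compact_nn_expectation:
  fixes X :: "'x topology" and A :: "'a topology"
  assumes X: "separable_metrizable X" and A: "metrizable_space A" and C: "K_inf_compact_nn X A C"
  shows "K_inf_compact_nn (weak_topology X) A (\<lambda>(z, a). \<integral>\<^sup>+x. C (x, a) \<partial>z)"
  unfolding K_inf_compact_nn_def
proof (intro allI impI)
  fix K and \<rho> :: ennreal assume K\<rho>: "compactin (weak_topology X) K \<and> \<rho> < \<infinity>"
  have mX: "metrizable_space X" using X by (simp add: separable_metrizable_def)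
  have mW: "metrizable_space (weak_topology X)"
    using separable_metrizable_weak_topology[OF X] by (simp add: separable_metrizable_def)
  have mWA: "metrizable_space (prod_topology (weak_topology X) A)" and mXA: "metrizable_space (prod_topology X A)"
    using mW mX A by (simp_all add: metrizable_space_prod_topology)
  let ?D = "{p \<in> K \<times> topspace A. (case p of (z, a) \<Rightarrow> \<integral>\<^sup>+x. C (x, a) \<partial>z) \<le> \<rho>}"
  have KP: "K \<subseteq> prob_measures X" using compactin_subset_topspace[of "weak_topology X" K] K\<rho> by simp
  show "compactin (prod_topology (weak_topology X) A) ?D"
    unfolding metrizable_compactin_sequentially[OF mWA]
  proof (intro conjI allI impI)
    show "?D \<subseteq> topspace (prod_topology (weak_topology X) A)" using KP by auto
    fix \<sigma> :: "nat \<Rightarrow> 'x measure \<times> 'a" assume \<sigma>: "range \<sigma> \<subseteq> ?D"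
    define z a where "z n = fst (\<sigma> n)" and "a n = snd (\<sigma> n)" for n
    have \<sigma>n: "\<sigma> n = (z n, a n)" for n by (simp add: z_def a_def)
    have zK: "z n \<in> K" and aA: "a n \<in> topspace A" and cost: "(\<integral>\<^sup>+x. C (x, a n) \<partial>z n) \<le> \<rho>" for n
      using \<sigma> \<sigma>n[of n] by (auto simp: image_subset_iff dest!: spec[of _ n])
    obtain l r1 where l: "l \<in> K" and r1: "strict_mono r1" and zl: "limitin (weak_topology X) (z \<circ> r1) l sequentially"
    proof -
      have "range z \<subseteq> K" using zK by auto
      then show ?thesis using that K\<rho> unfolding metrizable_compactin_sequentially[OF mW] by blast
    qed
    have lP: "l \<in> prob_measures X" using l KP by blast
    have "\<exists>s x. range s \<subseteq> topspace X \<and> limitin X s x sequentially \<and> \<not> \<infinity> \<le> liminf (\<lambda>n. C (s n, a (r1 n)))"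
    proof (rule ccontr)
      assume neg: "\<not> ?thesis"
      have "(\<integral>\<^sup>+x. \<infinity> \<partial>l) \<le> liminf (\<lambda>n. \<integral>\<^sup>+x. C (x, a (r1 n)) \<partial>(z \<circ> r1) n)"
        by (rule nn_integral_Fatou_weak[OF X zl]) (use neg zK KP in auto)
      moreover have "(\<integral>\<^sup>+x. \<infinity> \<partial>l) = \<infinity>"
        using prob_space.emeasure_space_1[OF prob_measuresD(1)[OF lP]] by simp
      ultimately have "\<rho> < liminf (\<lambda>n. \<integral>\<^sup>+x. C (x, a (r1 n)) \<partial>(z \<circ> r1) n)"
        using K\<rho> by (simp add: top_unique)
      from less_LiminfD[OF this] obtain n where "\<rho> < (\<integral>\<^sup>+x. C (x, a (r1 n)) \<partial>z (r1 n))"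
        by (auto simp: eventually_sequentially)
      then show False using cost[of "r1 n"] by simp
    qed
    then obtain s x where s: "range s \<subseteq> topspace X" "limitin X s x sequentially"
      and "liminf (\<lambda>n. C (s n, a (r1 n))) < \<infinity>" by (auto simp: not_le)
    then obtain \<beta> where \<beta>: "liminf (\<lambda>n. C (s n, a (r1 n))) < \<beta>" "\<beta> < \<infinity>" using dense by blast
    have "\<not> (\<forall>\<^sub>F n in sequentially. \<beta> < C (s n, a (r1 n)))"
    proof
      assume "\<forall>\<^sub>F n in sequentially. \<beta> < C (s n, a (r1 n))"
      then have "\<beta> \<le> liminf (\<lambda>n. C (s n, a (r1 n)))"
        by (intro Liminf_bounded) (auto elim: eventually_mono)
      then show False using \<beta>(1) by simp
    qed
    from not_eventually_sequentiallyD[OF this] obtain r2 :: "nat \<Rightarrow> nat"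
      where r2: "strict_mono r2" "\<And>n. C (s (r2 n), a (r1 (r2 n))) \<le> \<beta>" by (auto simp: not_less)
    define L where "L = insert x (range s)"
    have "compactin X L" unfolding L_def by (rule compactin_sequence_with_limit[OF s(2) order_refl s(1)])
    then have "compactin (prod_topology X A) {p \<in> L \<times> topspace A. C p \<le> \<beta>}"
      using C \<beta>(2) by (simp add: K_inf_compact_nn_def)
    moreover have "range (\<lambda>n. (s (r2 n), a (r1 (r2 n)))) \<subseteq> {p \<in> L \<times> topspace A. C p \<le> \<beta>}"
      using r2(2) aA by (auto simp: L_def)
    ultimately obtain p r3 where r3: "strict_mono r3"
      and p: "limitin (prod_topology X A) ((\<lambda>n. (s (r2 n), a (r1 (r2 n)))) \<circ> r3) p sequentially"
      unfolding metrizable_compactin_sequentially[OF mXA] by meson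
    define r where "r = r1 \<circ> (r2 \<circ> r3)"
    have r: "strict_mono r" unfolding r_def using r1 r2(1) r3 by (intro strict_mono_o)
    have a_lim: "limitin A (\<lambda>n. a (r n)) (snd p) sequentially"
      using p unfolding limitin_pairwise by (simp add: o_def r_def)
    have z_lim: "limitin (weak_topology X) (\<lambda>n. z (r n)) l sequentially"
      using limitin_subsequence[OF strict_mono_o[OF r2(1) r3] zl] by (simp add: o_def r_def)
    have "(\<integral>\<^sup>+x. C (x, snd p) \<partial>l) \<le> liminf (\<lambda>n. \<integral>\<^sup>+x. C (x, a (r n)) \<partial>z (r n))"
    proof (rule nn_integral_Fatou_weak[OF X z_lim])
      show "range (\<lambda>n. z (r n)) \<subseteq> prob_measures X" using zK KP by auto
      fix t y assume "range t \<subseteq> topspace X" "limitin X t y sequentially"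
      then have "limitin (prod_topology X A) (\<lambda>n. (t n, a (r n))) (y, snd p) sequentially"
        using a_lim unfolding limitin_pairwise by (simp add: o_def)
      then show "C (y, snd p) \<le> liminf (\<lambda>n. C (t n, a (r n)))"
        by (rule lsc_liminf[OF K_inf_compact_nn_lsc[OF mX A C]])
    qed
    also have "\<dots> \<le> \<rho>"
    proof (rule ccontr)
      assume "\<not> liminf (\<lambda>n. \<integral>\<^sup>+x. C (x, a (r n)) \<partial>z (r n)) \<le> \<rho>"
      then have "\<forall>\<^sub>F n in sequentially. \<rho> < (\<integral>\<^sup>+x. C (x, a (r n)) \<partial>z (r n))"
        by (intro less_LiminfD) simp
      then obtain n where "\<rho> < (\<integral>\<^sup>+x. C (x, a (r n)) \<partial>z (r n))" by (auto simp: eventually_sequentially)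
      then show False using cost[of "r n"] by simp
    qed
    finally have "(l, snd p) \<in> ?D" using l limitin_topspace[OF a_lim] by simp
    moreover have "limitin (prod_topology (weak_topology X) A) (\<sigma> \<circ> r) (l, snd p) sequentially"
      using a_lim z_lim unfolding limitin_pairwise by (simp add: o_def \<sigma>n)
    ultimately show "\<exists>l r. l \<in> ?D \<and> strict_mono r \<and> limitin (prod_topology (weak_topology X) A) (\<sigma> \<circ> r) l sequentially"
      using r by blast
  qed
qed

section \<open>Markov decision processes with nonnegative inf-compact costs\<close>

text \<open>
  Policies are measurable for the Borel sets of the product topology on histories, whereas the
  Ionescu-Tulcea construction lives on the product \<open>\<sigma>\<close>-algebra.
\<close>

lemma second_countable_finite_power:
  assumes I: "finite I" and T: "second_countable T"
  shows "second_countable (product_topology (\<lambda>_. T) I)" (is ?th1)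
    and "sets (borel_of (product_topology (\<lambda>_. T) I)) \<subseteq> sets (PiM I (\<lambda>_. borel_of T))" (is ?th2)
proof -
  obtain B where "countable_base T B" using T unfolding second_countable_iff by blast
  note B = countable_baseD[OF this]
  let ?D = "PiE I ` PiE I (\<lambda>_. B)"
  have D: "countable_base (product_topology (\<lambda>_. T) I) ?D"
    unfolding countable_base_def
  proof (intro conjI allI impI ballI)
    show "countable ?D" using countable_PiE[OF I, of "\<lambda>_. B"] B(1) by simp
    show "openin (product_topology (\<lambda>_. T) I) W" if W: "W \<in> ?D" for W
    proof -
      obtain V where V: "V \<in> PiE I (\<lambda>_. B)" "W = PiE I V" using W by blast
      have "openin T (V i)" if "i \<in> I" for i using PiE_mem[OF V(1) that] B(2) by blast
      then show ?thesis unfolding V(2) openin_PiE_gen using I by simp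
    qed
    fix U x assume Ux: "openin (product_topology (\<lambda>_. T) I) U \<and> x \<in> U"
    obtain V where V: "\<And>i. i \<in> I \<Longrightarrow> openin T (V i)" "x \<in> PiE I V" "PiE I V \<subseteq> U"
      using Ux unfolding openin_product_topology_alt by meson
    have "\<exists>W. W \<in> B \<and> x i \<in> W \<and> W \<subseteq> V i" if "i \<in> I" for i
      using B(3)[OF V(1)[OF that], of "x i"] V(2) that by auto
    then obtain W where W: "\<And>i. i \<in> I \<Longrightarrow> W i \<in> B \<and> x i \<in> W i \<and> W i \<subseteq> V i" by metis
    have "PiE I W = PiE I (restrict W I)" by (rule PiE_cong) simp
    then have "PiE I W \<in> ?D" using W by auto
    moreover have "x \<in> PiE I W" using W V(2) by (auto simp: PiE_iff)
    moreover have "PiE I W \<subseteq> U" using W PiE_mono[of I W V] V(3) by blast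
    ultimately show "\<exists>W\<in>?D. x \<in> W \<and> W \<subseteq> U" by blast
  qed
  then show ?th1 unfolding second_countable_iff by blast
  show ?th2
  proof (rule sets_borel_of_subset_countable_base[OF D])
    show "W \<in> sets (PiM I (\<lambda>_. borel_of T))" if "W \<in> ?D" for W
      using that B(2) I by (auto intro!: sets_PiM_I_finite borel_of_openin)
    have "space (PiM I (\<lambda>_. borel_of T)) \<in> sets (PiM I (\<lambda>_. borel_of T))" by (rule sets.top)
    then show "topspace (product_topology (\<lambda>_. T) I) \<in> sets (PiM I (\<lambda>_. borel_of T))" by (simp add: space_PiM)
  qed
qed

locale inf_compact_mdp =
  fixes S :: "'s topology" and A :: "'a topology" and q :: "'s \<times> 'a \<Rightarrow> 's measure"
    and C :: "'s \<times> 'a \<Rightarrow> ennreal" and \<alpha> :: real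
  assumes S: "separable_metrizable S" and A: "separable_metrizable A" and A_ne: "topspace A \<noteq> {}"
    and q: "weakly_continuous S (prod_topology S A) q"
    and C: "K_inf_compact_nn S A C" and \<alpha>: "0 \<le> \<alpha>"
begin

abbreviation "SA \<equiv> prod_topology S A"
abbreviation "B \<equiv> borel_of S \<Otimes>\<^sub>M borel_of A"

lemma met: "metrizable_space S" "metrizable_space A" "metrizable_space SA"
  using S A separable_metrizable_prod_topology[OF S A] by (auto simp: separable_metrizable_def)

lemma sets_SA: "sets (borel_of SA) = sets B"
  using S A by (intro sets_borel_of_prod_topology) (auto simp: separable_metrizable_def)

lemma q_continuous: "continuous_map SA (weak_topology S) q"
  using q metrizable_imp_first_countable[OF met(3)] unfolding weakly_continuous_def
  by (intro continuous_map_of_sequences) auto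

lemma q_kernel: "q \<in> B \<rightarrow>\<^sub>M prob_algebra (borel_of S)"
proof -
  have "q \<in> borel_of SA \<rightarrow>\<^sub>M prob_algebra (borel_of S)"
    by (rule measurable_compose[OF measurable_continuous_map_borel_of[OF q_continuous]
          measurable_weak_topology_prob_algebra[OF S]])
  then show ?thesis by (simp add: measurable_cong_sets[OF sets_SA refl])
qed

lemma q_prob: "p \<in> topspace S \<times> topspace A \<Longrightarrow> q p \<in> prob_measures S"
  using measurable_space[OF q_kernel, of p] by (simp add: prob_measures_eq_space space_pair_measure)


subsection \<open>Value iteration\<close>

definition action_value :: "('s \<Rightarrow> ennreal) \<Rightarrow> 's \<times> 'a \<Rightarrow> ennreal" where
  "action_value v p = C p + ennreal \<alpha> * (\<integral>\<^sup>+s. v s \<partial>q p)"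

primrec value_iter :: "nat \<Rightarrow> 's \<Rightarrow> ennreal" where
  "value_iter 0 s = 0"
| "value_iter (Suc n) s = (INF a\<in>topspace A. action_value (value_iter n) (s, a))"

definition val :: "enat \<Rightarrow> 's \<Rightarrow> ennreal" where
  "val T s = (case T of enat n \<Rightarrow> value_iter n s | \<infinity> \<Rightarrow> (SUP n. value_iter n s))"

definition minimizers :: "enat \<Rightarrow> 's \<Rightarrow> 'a set" where
  "minimizers T s = {a \<in> topspace A. action_value (val T) (s, a) = val (eSuc T) s}"

lemma lsc_C: "lsc SA C"
  by (rule K_inf_compact_nn_lsc[OF met(1,2) C])

lemma lsc_action_value: "lsc S v \<Longrightarrow> lsc SA (action_value v)"
  unfolding action_value_def
  by (intro lsc_add lsc_C lsc_cmult lsc_compose[OF q_continuous] lsc_nn_integral_weak[OF S])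

lemma K_inf_compact_action_value: "lsc S v \<Longrightarrow> K_inf_compact_nn S A (action_value v)"
  by (rule K_inf_compact_nn_mono[OF C lsc_action_value]) (auto simp: action_value_def)

lemma lsc_value_iter: "lsc S (value_iter n)"
proof (induction n)
  case 0 then show ?case using lsc_const[of S 0] by (simp add: fun_eq_iff[symmetric] lsc_def)
next
  case (Suc n)
  have "lsc S (\<lambda>s. INF a\<in>topspace A. action_value (value_iter n) (s, a))"
    by (rule lsc_INF_closedin[OF met(1,2) K_inf_compact_action_value[OF Suc]]) simp
  then show ?case by (simp add: lsc_def)
qed

lemma lsc_val: "lsc S (val T)"
proof (cases T)
  case (enat n) then show ?thesis using lsc_value_iter[of n] by (simp add: val_def lsc_def)
next
  case infinity
  have "lsc S (\<lambda>s. SUP n. value_iter n s)" by (intro lsc_SUP lsc_value_iter)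
  then show ?thesis by (simp add: infinity val_def lsc_def)
qed

lemma action_value_mono: "(\<And>s. s \<in> topspace S \<Longrightarrow> v s \<le> w s) \<Longrightarrow> p \<in> topspace S \<times> topspace A \<Longrightarrow> action_value v p \<le> action_value w p"
  unfolding action_value_def using prob_measuresD(3)[OF q_prob]
  by (intro add_left_mono mult_left_mono nn_integral_mono) auto

lemma action_value_cong: "(\<And>s. s \<in> topspace S \<Longrightarrow> v s = w s) \<Longrightarrow> p \<in> topspace S \<times> topspace A \<Longrightarrow> action_value v p = action_value w p"
  using action_value_mono[of v w p] action_value_mono[of w v p] by (simp add: antisym)

lemma value_iter_Suc_mono: "s \<in> topspace S \<Longrightarrow> value_iter n s \<le> value_iter (Suc n) s"
proof (induction n arbitrary: s)
  case (Suc n)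
  have "(INF a\<in>topspace A. action_value (value_iter n) (s, a)) \<le>
      (INF a\<in>topspace A. action_value (value_iter (Suc n)) (s, a))"
  proof (rule INF_mono)
    fix a assume "a \<in> topspace A"
    moreover from this have "action_value (value_iter n) (s, a) \<le> action_value (value_iter (Suc n)) (s, a)"
      using Suc.IH Suc.prems by (intro action_value_mono) (auto simp del: value_iter.simps)
    ultimately show "\<exists>b\<in>topspace A. action_value (value_iter n) (s, b) \<le> action_value (value_iter (Suc n)) (s, a)" ..
  qed
  then show ?case by (simp only: value_iter.simps(2)[of n s] value_iter.simps(2)[of "Suc n" s])
qed simp

lemma value_iter_mono: "s \<in> topspace S \<Longrightarrow> m \<le> n \<Longrightarrow> value_iter m s \<le> value_iter n s"
  by (rule lift_Suc_mono_le[of "\<lambda>n. value_iter n s"]) (auto intro: value_iter_Suc_mono simp del: value_iter.simps)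

lemma action_value_SUP:
  assumes v: "\<And>n::nat. v n \<in> borel_measurable (borel_of S)" "\<And>n s. s \<in> topspace S \<Longrightarrow> v n s \<le> v (Suc n) s"
    and p: "p \<in> topspace S \<times> topspace A"
  shows "action_value (\<lambda>s. SUP n. v n s) p = (SUP n. action_value (v n) p)"
proof -
  note qp = prob_measuresD[OF q_prob[OF p]]
  have "(\<integral>\<^sup>+s. (SUP n. v n s) \<partial>q p) = (SUP n. \<integral>\<^sup>+s. v n s \<partial>q p)"
    using v qp by (intro nn_integral_monotone_convergence_SUP_AE) (auto cong: measurable_cong_sets)
  then show ?thesis
    unfolding action_value_def by (simp add: SUP_mult_left_ennreal ennreal_SUP_add_right)
qed

text \<open>
  For an infinite horizon the nontrivial inequality exchanges a supremum over the iterates with an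
  infimum over actions: the actions at which the \<open>n\<close>-th action value is at most \<open>val \<infinity> s\<close> form a
  decreasing sequence of nonempty compact sets, and a common point attains the bound in the limit.
\<close>

theorem Bellman_equation:
  assumes s: "s \<in> topspace S"
  shows "val (eSuc T) s = (INF a\<in>topspace A. action_value (val T) (s, a))"
proof (cases T)
  case (enat n)
  then show ?thesis by (simp add: val_def eSuc_enat val_def[abs_def])
next
  case infinity
  let ?w = "\<lambda>n a. action_value (value_iter n) (s, a)"
  have pA: "(s, a) \<in> topspace S \<times> topspace A" if "a \<in> topspace A" for a using s that by simp
  have lim: "action_value (val \<infinity>) (s, a) = (SUP n. ?w n a)" if "a \<in> topspace A" for a
    using action_value_SUP[of value_iter, OF lsc_measurable[OF lsc_value_iter] value_iter_Suc_mono pA[OF that]]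
    by (simp add: val_def[abs_def])
  have "val \<infinity> s = (INF a\<in>topspace A. action_value (val \<infinity>) (s, a))"
  proof (rule antisym)
    show "val \<infinity> s \<le> (INF a\<in>topspace A. action_value (val \<infinity>) (s, a))"
    proof (rule INF_greatest)
      fix a assume a: "a \<in> topspace A"
      have "value_iter n s \<le> action_value (val \<infinity>) (s, a)" for n
      proof -
        have "value_iter n s \<le> value_iter (Suc n) s" by (rule value_iter_Suc_mono[OF s])
        also have "\<dots> \<le> ?w n a" using a by (auto intro: INF_lower)
        also have "\<dots> \<le> action_value (val \<infinity>) (s, a)" unfolding lim[OF a] by (rule SUP_upper) simp
        finally show ?thesis .
      qed
      then show "val \<infinity> s \<le> action_value (val \<infinity>) (s, a)" by (auto simp: val_def intro: SUP_least)
    qed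
    show "(INF a\<in>topspace A. action_value (val \<infinity>) (s, a)) \<le> val \<infinity> s"
    proof (cases "val \<infinity> s = \<infinity>")
      case False
      define r where "r = val \<infinity> s"
      have r: "r < \<infinity>" using False by (simp add: r_def less_top)
      have vi: "value_iter n s \<le> r" for n unfolding r_def val_def by (auto intro: SUP_upper)
      let ?D = "\<lambda>n. {a \<in> topspace A. ?w n a \<le> r}"
      have "\<Inter>(range ?D) \<noteq> {}"
      proof (rule compactin_chain_Inter_nonempty[OF metrizable_imp_Hausdorff_space[OF met(2)]])
        fix D assume "D \<in> range ?D"
        then obtain n where D: "D = ?D n" by blast
        show "compactin A D"
          unfolding D by (rule compactin_action_sublevel[OF met(1,2) K_inf_compact_action_value[OF lsc_value_iter] closedin_topspace s r])
        obtain a where "a \<in> topspace A" "?w n a = (INF a\<in>topspace A. ?w n a)"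
          using INF_attained[OF met(1,2) K_inf_compact_action_value[OF lsc_value_iter] closedin_topspace A_ne s] by blast
        then show "D \<noteq> {}" using vi[of "Suc n"] unfolding D by auto
      next
        fix D D' assume "D \<in> range ?D" "D' \<in> range ?D"
        then obtain m n where D: "D = ?D m" "D' = ?D n" by blast
        have sub: "?D n \<subseteq> ?D m" if "m \<le> n" for m n
        proof
          fix a assume a: "a \<in> ?D n"
          then have "?w m a \<le> ?w n a"
            using value_iter_mono[OF _ that] pA by (intro action_value_mono) auto
          with a show "a \<in> ?D m" by auto
        qed
        show "D \<subseteq> D' \<or> D' \<subseteq> D" unfolding D using sub[of m n] sub[of n m] nat_le_linear[of m n] by argo
      qed simp
      then obtain a where a: "a \<in> topspace A" "\<And>n. ?w n a \<le> r" by auto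
      have "(INF a\<in>topspace A. action_value (val \<infinity>) (s, a)) \<le> action_value (val \<infinity>) (s, a)"
        using a(1) by (rule INF_lower)
      also have "\<dots> \<le> r" unfolding lim[OF a(1)] using a(2) by (rule SUP_least)
      finally show ?thesis by (simp add: r_def)
    qed simp
  qed
  then show ?thesis by (simp add: infinity)
qed

lemma val_le_action_value: "s \<in> topspace S \<Longrightarrow> a \<in> topspace A \<Longrightarrow> val (eSuc T) s \<le> action_value (val T) (s, a)"
  unfolding Bellman_equation by (rule INF_lower)

lemma minimizers_eq: "s \<in> topspace S \<Longrightarrow> minimizers T s = {a \<in> topspace A. action_value (val T) (s, a) \<le> val (eSuc T) s}"
  unfolding minimizers_def using val_le_action_value[of s _ T] by (auto intro: antisym)

lemma minimizers_nonempty: "s \<in> topspace S \<Longrightarrow> minimizers T s \<noteq> {}"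
  using INF_attained[OF met(1,2) K_inf_compact_action_value[OF lsc_val] closedin_topspace A_ne, of s T]
  unfolding minimizers_def Bellman_equation by blast

lemma minimizers_infinite: "s \<in> topspace S \<Longrightarrow> val (eSuc T) s = \<infinity> \<Longrightarrow> minimizers T s = topspace A"
  unfolding minimizers_def using val_le_action_value[of s _ T] by (auto simp: top_unique)

lemma minimizers_compact: "s \<in> topspace S \<Longrightarrow> val (eSuc T) s < \<infinity> \<Longrightarrow> compactin A (minimizers T s)"
  unfolding minimizers_eq
  by (rule compactin_action_sublevel[OF met(1,2) K_inf_compact_action_value[OF lsc_val] closedin_topspace])

lemma minimizers_graph: "{(s, a). s \<in> topspace S \<and> a \<in> minimizers T s} \<in> sets (borel_of SA)"
proof -
  have [measurable]: "action_value (val T) \<in> borel_measurable (borel_of SA)"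
    by (rule lsc_measurable[OF lsc_action_value[OF lsc_val]])
  have "fst \<in> borel_of SA \<rightarrow>\<^sub>M borel_of S"
    by (rule measurable_continuous_map_borel_of[OF continuous_map_fst])
  from measurable_compose[OF this lsc_measurable[OF lsc_val]]
  have [measurable]: "(\<lambda>p. val (eSuc T) (fst p)) \<in> borel_measurable (borel_of SA)" .
  have "{(s, a). s \<in> topspace S \<and> a \<in> minimizers T s} =
      {p \<in> space (borel_of SA). action_value (val T) p = val (eSuc T) (fst p)}"
    by (auto simp: minimizers_def)
  also have "\<dots> \<in> sets (borel_of SA)" by measurable
  finally show ?thesis .
qed

text \<open>
  Where the value is finite the minimisers form a compact set, to which measurable selection
  applies. Where it is infinite every action is a minimiser but the set of them need not be
  compact, so it is replaced by a single fixed action.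
\<close>

lemma measurable_minimizer:
  "\<exists>\<phi>\<in>borel_of S \<rightarrow>\<^sub>M borel_of A. \<forall>s\<in>topspace S. \<phi> s \<in> minimizers T s"
proof -
  obtain a0 where a0: "a0 \<in> topspace A" using A_ne by blast
  define \<Psi> where "\<Psi> s = (if val (eSuc T) s < \<infinity> then minimizers T s else {a0})" for s
  have "\<exists>\<phi>\<in>borel_of S \<rightarrow>\<^sub>M borel_of A. \<forall>s\<in>space (borel_of S). \<phi> s \<in> \<Psi> s"
  proof (rule measurable_selection_compact[OF A])
    show "compactin A (\<Psi> s) \<and> \<Psi> s \<noteq> {}" if "s \<in> space (borel_of S)" for s
      using that minimizers_compact minimizers_nonempty a0 by (simp add: \<Psi>_def)
    fix F assume F: "closedin A F"
    note [measurable] = lsc_measurable[OF lsc_val] lsc_measurable[OF lsc_INF_closedin[OF met(1,2) K_inf_compact_action_value[OF lsc_val] F]]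
    have iff: "minimizers T s \<inter> F \<noteq> {} \<longleftrightarrow> (INF a\<in>F. action_value (val T) (s, a)) \<le> val (eSuc T) s"
      if s: "s \<in> topspace S" and fin: "val (eSuc T) s < \<infinity>" for s
    proof
      assume "minimizers T s \<inter> F \<noteq> {}"
      then show "(INF a\<in>F. action_value (val T) (s, a)) \<le> val (eSuc T) s"
        unfolding minimizers_eq[OF s] by (auto intro: INF_lower2)
    next
      assume le: "(INF a\<in>F. action_value (val T) (s, a)) \<le> val (eSuc T) s"
      then have "F \<noteq> {}" using fin by (auto simp: top_unique)
      then obtain a where "a \<in> F" "action_value (val T) (s, a) \<le> val (eSuc T) s"
        using INF_attained[OF met(1,2) K_inf_compact_action_value[OF lsc_val] F _ s] le by metis
      then show "minimizers T s \<inter> F \<noteq> {}"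
        using closedin_subset[OF F] unfolding minimizers_eq[OF s] by auto
    qed
    have "{s \<in> space (borel_of S). \<Psi> s \<inter> F \<noteq> {}} = {s \<in> space (borel_of S).
        if val (eSuc T) s < \<infinity> then (INF a\<in>F. action_value (val T) (s, a)) \<le> val (eSuc T) s else a0 \<in> F}"
    proof (rule Collect_cong, rule conj_cong[OF refl])
      fix s assume "s \<in> space (borel_of S)"
      then have s: "s \<in> topspace S" by simp
      show "\<Psi> s \<inter> F \<noteq> {} \<longleftrightarrow> (if val (eSuc T) s < \<infinity> then
          (INF a\<in>F. action_value (val T) (s, a)) \<le> val (eSuc T) s else a0 \<in> F)"
        using iff[OF s] by (cases "val (eSuc T) s < \<infinity>") (simp_all only: \<Psi>_def if_True if_False, blast)
    qed
    also have "\<dots> \<in> sets (borel_of S)" by measurable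
    finally show "{s \<in> space (borel_of S). \<Psi> s \<inter> F \<noteq> {}} \<in> sets (borel_of S)" .
  qed
  then obtain \<phi> where \<phi>: "\<phi> \<in> borel_of S \<rightarrow>\<^sub>M borel_of A" "\<forall>s\<in>space (borel_of S). \<phi> s \<in> \<Psi> s"
    by (elim bexE)
  have "\<Psi> s \<subseteq> minimizers T s" if "s \<in> topspace S" for s
    using minimizers_infinite[OF that] a0 by (auto simp: \<Psi>_def less_top[symmetric])
  then have "\<forall>s\<in>topspace S. \<phi> s \<in> minimizers T s" using \<phi>(2) by (simp add: subset_iff)
  then show ?thesis using \<phi>(1) by (rule bexI)
qed

text \<open>
  Each action value dominates \<open>C\<close>, so its sublevel sets are closed in compact ones, and their
  projections are the sublevel sets of the next iterate. The limit dominates the first iterate.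
\<close>

lemma val_inf_compact:
  assumes Cc: "\<And>r. r < \<infinity> \<Longrightarrow> compactin SA {p \<in> topspace SA. C p \<le> r}" and T: "T \<noteq> 0" and r: "r < \<infinity>"
  shows "compactin S {s \<in> topspace S. val T s \<le> r}"
proof -
  have fin: "compactin S {s \<in> topspace S. value_iter (Suc n) s \<le> r}" for n
  proof -
    let ?w = "action_value (value_iter n)"
    have "compactin SA ({p \<in> topspace SA. ?w p \<le> r} \<inter> {p \<in> topspace SA. C p \<le> r})"
      by (rule closed_Int_compactin[OF lsc_closedin_sublevel[OF lsc_action_value[OF lsc_value_iter]] Cc[OF r]])
    then have "compactin S (fst ` ({p \<in> topspace SA. ?w p \<le> r} \<inter> {p \<in> topspace SA. C p \<le> r}))"
      by (rule image_compactin) (rule continuous_map_fst)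
    moreover have "fst ` ({p \<in> topspace SA. ?w p \<le> r} \<inter> {p \<in> topspace SA. C p \<le> r}) = {s \<in> topspace S. value_iter (Suc n) s \<le> r}"
    proof (intro equalityI subsetI)
      fix s assume "s \<in> fst ` ({p \<in> topspace SA. ?w p \<le> r} \<inter> {p \<in> topspace SA. C p \<le> r})"
      then show "s \<in> {s \<in> topspace S. value_iter (Suc n) s \<le> r}" by (auto intro: INF_lower2)
    next
      fix s assume "s \<in> {s \<in> topspace S. value_iter (Suc n) s \<le> r}"
      then have s: "s \<in> topspace S" "value_iter (Suc n) s \<le> r" by auto
      obtain a where a: "a \<in> topspace A" "?w (s, a) = (INF a\<in>topspace A. ?w (s, a))"
        using INF_attained[OF met(1,2) K_inf_compact_action_value[OF lsc_value_iter] closedin_topspace A_ne s(1)] by blast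
      have "C (s, a) \<le> ?w (s, a)" by (simp add: action_value_def)
      then show "s \<in> fst ` ({p \<in> topspace SA. ?w p \<le> r} \<inter> {p \<in> topspace SA. C p \<le> r})"
        using a s by (intro image_eqI[of _ _ "(s, a)"]) auto
    qed
    ultimately show ?thesis by simp
  qed
  show ?thesis
  proof (cases T)
    case (enat n)
    then obtain m where "T = enat (Suc m)" using T by (cases n) (auto simp: zero_enat_def)
    then show ?thesis using fin by (simp add: val_def)
  next
    case infinity
    have "value_iter (Suc 0) s \<le> val T s" for s
      unfolding infinity val_def enat.simps by (rule SUP_upper) simp
    then have "{s \<in> topspace S. val T s \<le> r} = {s \<in> topspace S. val T s \<le> r} \<inter> {s \<in> topspace S. value_iter (Suc 0) s \<le> r}"
      using order_trans by blast
    moreover have "compactin S ({s \<in> topspace S. val T s \<le> r} \<inter> {s \<in> topspace S. value_iter (Suc 0) s \<le> r})"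
      by (rule closed_Int_compactin[OF lsc_closedin_sublevel[OF lsc_val] fin])
    ultimately show ?thesis by simp
  qed
qed

subsection \<open>Expected costs of policies\<close>

definition policy_cost :: "enat \<Rightarrow> ('s, 'a) policy \<Rightarrow> 's \<Rightarrow> ennreal" where
  "policy_cost T \<delta> s = (\<integral>\<^sup>+\<omega>. (\<Sum>t. if enat t < T then ennreal (\<alpha> ^ t) * C (\<omega> t) else 0)
     \<partial>strategic_measure S A q \<delta> s)"

lemma C_measurable [measurable]: "C \<in> borel_measurable B"
  using lsc_measurable[OF lsc_C] by (simp add: measurable_cong_sets[OF sets_SA refl])

lemma action_value_measurable: "v \<in> borel_measurable (borel_of S) \<Longrightarrow> action_value v \<in> borel_measurable B"
  unfolding action_value_def
  using measurable_compose[OF measurable_prob_algebraD[OF q_kernel] nn_integral_measurable_subprob_algebra]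
  by measurable

lemma policy_measurable:
  assumes "\<delta> \<in> policies S A"
  shows "\<delta> t \<in> PiM {0..<t} (\<lambda>_. B) \<Otimes>\<^sub>M borel_of S \<rightarrow>\<^sub>M prob_algebra (borel_of A)"
proof -
  let ?Hi = "product_topology (\<lambda>_. SA) {0..<t}"
  have SA: "second_countable SA"
    using separable_metrizable_prod_topology[OF S A] by (simp add: separable_metrizable_def)
  have PiB: "sets (PiM {0..<t} (\<lambda>_. borel_of SA)) = sets (PiM {0..<t} (\<lambda>_. B))"
    by (intro sets_PiM_cong refl sets_SA)
  have "(\<lambda>h. h) \<in> PiM {0..<t} (\<lambda>_. B) \<rightarrow>\<^sub>M PiM {0..<t} (\<lambda>_. B)" by simp
  then have "(\<lambda>h. h) \<in> PiM {0..<t} (\<lambda>_. B) \<rightarrow>\<^sub>M borel_of ?Hi"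
    using measurable_mono[of "borel_of ?Hi" "PiM {0..<t} (\<lambda>_. B)" "PiM {0..<t} (\<lambda>_. B)" "PiM {0..<t} (\<lambda>_. B)"]
      second_countable_finite_power(2)[OF _ SA, of "{0..<t}"]
    by (auto simp: PiB space_PiM space_pair_measure)
  from measurable_compose[OF measurable_fst this]
  have "(\<lambda>p. (fst p, snd p)) \<in> PiM {0..<t} (\<lambda>_. B) \<Otimes>\<^sub>M borel_of S \<rightarrow>\<^sub>M borel_of ?Hi \<Otimes>\<^sub>M borel_of S"
    by (rule measurable_Pair[OF _ measurable_snd])
  moreover have sets_eq: "sets (borel_of (prod_topology ?Hi S)) = sets (borel_of ?Hi \<Otimes>\<^sub>M borel_of S)"
    using S second_countable_finite_power(1)[OF _ SA, of "{0..<t}"]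
    by (intro sets_borel_of_prod_topology) (auto simp: separable_metrizable_def)
  ultimately have "(\<lambda>p. (fst p, snd p)) \<in> PiM {0..<t} (\<lambda>_. B) \<Otimes>\<^sub>M borel_of S \<rightarrow>\<^sub>M borel_of (prod_topology ?Hi S)"
    by (simp only: measurable_cong_sets[OF refl sets_eq])
  moreover have "\<delta> t \<in> borel_of (prod_topology ?Hi S) \<rightarrow>\<^sub>M prob_algebra (borel_of A)"
    using assms by (simp add: policies_def stochastic_kernel_prob_algebra)
  ultimately show ?thesis using measurable_compose by fastforce
qed

lemma markov_policy_in_policies:
  assumes "\<And>t. \<phi> t \<in> borel_of S \<rightarrow>\<^sub>M borel_of A"
  shows "markov_policy A \<phi> \<in> policies S A"
  unfolding policies_def mem_Collect_eq stochastic_kernel_prob_algebra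
proof
  fix t :: nat
  have "snd \<in> borel_of (prod_topology (product_topology (\<lambda>_. SA) {0..<t}) S) \<rightarrow>\<^sub>M borel_of S"
    by (rule measurable_continuous_map_borel_of[OF continuous_map_snd])
  from measurable_compose[OF measurable_compose[OF this assms] measurable_return_prob_space]
  show "markov_policy A \<phi> t \<in> borel_of (prod_topology (product_topology (\<lambda>_. SA) {0..<t}) S) \<rightarrow>\<^sub>M prob_algebra (borel_of A)"
    by (simp add: markov_policy_def case_prod_unfold)
qed

context
  fixes \<delta> :: "('s, 'a) policy" and s0 :: 's
  assumes \<delta>: "\<delta> \<in> policies S A" and s0: "s0 \<in> topspace S"
begin

abbreviation "Hist k \<equiv> PiM {0..<k} (\<lambda>_::nat. B)"

definition state_law :: "nat \<Rightarrow> (nat \<Rightarrow> 's \<times> 'a) \<Rightarrow> 's measure" where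
  "state_law k h = (case k of 0 \<Rightarrow> return (borel_of S) s0 | Suc u \<Rightarrow> q (h u))"

lemma state_law_measurable: "state_law k \<in> Hist k \<rightarrow>\<^sub>M prob_algebra (borel_of S)"
proof (cases k)
  case 0
  then show ?thesis
    using s0 by (auto simp: state_law_def[abs_def] space_prob_algebra intro!: measurable_const prob_space_return)
next
  case (Suc u)
  have "(\<lambda>h. h u) \<in> Hist k \<rightarrow>\<^sub>M B" by (rule measurable_component_singleton) (simp add: Suc)
  from measurable_compose[OF this q_kernel] show ?thesis by (simp add: state_law_def[abs_def] Suc)
qed

lemma action_law_measurable:
  "(\<lambda>(h, s). distr (\<delta> k (h, s)) B (Pair s)) \<in> Hist k \<Otimes>\<^sub>M borel_of S \<rightarrow>\<^sub>M prob_algebra B"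
proof -
  have "(\<lambda>x. distr (\<delta> k x) B (Pair (snd x))) \<in> Hist k \<Otimes>\<^sub>M borel_of S \<rightarrow>\<^sub>M prob_algebra B"
    by (rule measurable_distr_prob_space2[OF policy_measurable[OF \<delta>]]) measurable
  then show ?thesis by (simp add: case_prod_unfold)
qed

lemma step_law_eq: "step_law S A q \<delta> s0 k h = state_law k h \<bind> (\<lambda>s. distr (\<delta> k (h, s)) B (Pair s))"
  by (simp add: step_law_def state_law_def)

lemma step_law_measurable: "step_law S A q \<delta> s0 k \<in> Hist k \<rightarrow>\<^sub>M prob_algebra B"
  unfolding step_law_eq[abs_def]
  by (rule measurable_bind_prob_space2[OF state_law_measurable action_law_measurable])

lemma nn_integral_step_law:
  assumes h: "h \<in> space (Hist k)" and f: "f \<in> borel_measurable B"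
  shows "(\<integral>\<^sup>+p. f p \<partial>step_law S A q \<delta> s0 k h) = (\<integral>\<^sup>+s. \<integral>\<^sup>+a. f (s, a) \<partial>\<delta> k (h, s) \<partial>state_law k h)"
proof -
  have sl: "sets (state_law k h) = sets (borel_of S)" "space (state_law k h) = topspace S"
    using measurable_space[OF state_law_measurable h] sets_eq_imp_space_eq[of "state_law k h" "borel_of S"]
    by (auto simp: space_prob_algebra)
  have "(\<lambda>s. distr (\<delta> k (h, s)) B (Pair s)) \<in> borel_of S \<rightarrow>\<^sub>M prob_algebra B"
    using measurable_compose[OF measurable_Pair1'[OF h] action_law_measurable] by simp
  then have "(\<lambda>s. distr (\<delta> k (h, s)) B (Pair s)) \<in> state_law k h \<rightarrow>\<^sub>M subprob_algebra B"
    by (simp add: measurable_cong_sets[OF sl(1) refl] measurable_prob_algebraD)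
  then have "(\<integral>\<^sup>+p. f p \<partial>step_law S A q \<delta> s0 k h) = (\<integral>\<^sup>+s. \<integral>\<^sup>+p. f p \<partial>distr (\<delta> k (h, s)) B (Pair s) \<partial>state_law k h)"
    unfolding step_law_eq by (rule nn_integral_bind[OF f])
  also have "\<dots> = (\<integral>\<^sup>+s. \<integral>\<^sup>+a. f (s, a) \<partial>\<delta> k (h, s) \<partial>state_law k h)"
  proof (rule nn_integral_cong)
    fix s assume "s \<in> space (state_law k h)"
    then have s: "s \<in> topspace S" using sl by simp
    have "\<delta> k (h, s) \<in> space (prob_algebra (borel_of A))"
      using measurable_space[OF policy_measurable[OF \<delta>], of "(h, s)" k] h s by (simp add: space_pair_measure)
    then have sA: "sets (\<delta> k (h, s)) = sets (borel_of A)" by (simp add: space_prob_algebra)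
    have "Pair s \<in> \<delta> k (h, s) \<rightarrow>\<^sub>M B" unfolding measurable_cong_sets[OF sA refl] using s by simp
    then show "(\<integral>\<^sup>+p. f p \<partial>distr (\<delta> k (h, s)) B (Pair s)) = (\<integral>\<^sup>+a. f (s, a) \<partial>\<delta> k (h, s))"
      by (rule nn_integral_distr) (use f in simp)
  qed
  finally show ?thesis .
qed

interpretation IT: Ionescu_Tulcea "step_law S A q \<delta> s0" "\<lambda>_. B"
proof (rule Ionescu_Tulcea.intro)
  show "step_law S A q \<delta> s0 k \<in> Hist k \<rightarrow>\<^sub>M subprob_algebra B" for k
    by (rule measurable_prob_algebraD[OF step_law_measurable])
  show "prob_space (step_law S A q \<delta> s0 k h)" if "h \<in> space (Hist k)" for k h
    using measurable_space[OF step_law_measurable that] by (simp add: space_prob_algebra)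
qed

text \<open>The argument \<open>\<lambda>_. undefined\<close> is the empty history, the only element of \<open>Hist 0\<close>.\<close>

definition hist_law :: "nat \<Rightarrow> (nat \<Rightarrow> 's \<times> 'a) measure" where
  "hist_law k = IT.C 0 k (\<lambda>_. undefined)"

lemma hist_law: "sets (hist_law k) = sets (Hist k)" "space (hist_law k) = space (Hist k)" "prob_space (hist_law k)"
proof -
  have e: "(\<lambda>_. undefined) \<in> space (Hist 0)" by (simp add: space_PiM)
  show "sets (hist_law k) = sets (Hist k)" "space (hist_law k) = space (Hist k)" "prob_space (hist_law k)"
    unfolding hist_law_def
    using IT.sets_C[OF e, of k] IT.space_C[OF e, of k] IT.prob_space_C[OF e, of k] by (simp_all only: add_0)
qed

lemma nn_integral_hist_law_0: "f \<in> borel_measurable (Hist 0) \<Longrightarrow> (\<integral>\<^sup>+h. f h \<partial>hist_law 0) = f (\<lambda>_. undefined)"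
  unfolding hist_law_def IT.C.simps by (subst nn_integral_return) (simp_all add: space_PiM)

lemma nn_integral_hist_law_Suc:
  assumes f: "f \<in> borel_measurable (Hist (Suc k))"
  shows "(\<integral>\<^sup>+h. f h \<partial>hist_law (Suc k)) = (\<integral>\<^sup>+h. \<integral>\<^sup>+p. f (h(k := p)) \<partial>step_law S A q \<delta> s0 k h \<partial>hist_law k)"
proof -
  have "IT.eP k \<in> hist_law k \<rightarrow>\<^sub>M subprob_algebra (Hist (Suc k))"
    using IT.measurable_eP[of k] by (simp add: measurable_cong_sets[OF hist_law(1) refl])
  then have "(\<integral>\<^sup>+h. f h \<partial>hist_law (Suc k)) = (\<integral>\<^sup>+h. \<integral>\<^sup>+h'. f h' \<partial>IT.eP k h \<partial>hist_law k)"
    unfolding hist_law_def IT.C.simps add_0 by (rule nn_integral_bind[OF f])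
  also have "\<dots> = (\<integral>\<^sup>+h. \<integral>\<^sup>+p. f (h(k := p)) \<partial>step_law S A q \<delta> s0 k h \<partial>hist_law k)"
    using f by (intro nn_integral_cong IT.nn_integral_eP) (simp_all add: hist_law)
  finally show ?thesis .
qed

lemma nn_integral_strategic_measure:
  assumes f: "f \<in> borel_measurable (Hist k)"
  shows "(\<integral>\<^sup>+\<omega>. f (restrict \<omega> {0..<k}) \<partial>strategic_measure S A q \<delta> s0) = (\<integral>\<^sup>+h. f h \<partial>hist_law k)"
proof -
  have "IT.CI {0..<k} = hist_law k"
  proof (rule measure_eqI)
    show s: "sets (IT.CI {0..<k}) = sets (hist_law k)" by (simp add: IT.PF.sets_P hist_law)
    fix E assume "E \<in> sets (IT.CI {0..<k})"
    then have E: "E \<in> sets (Hist k)" using s by (simp add: hist_law)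
    then show "emeasure (IT.CI {0..<k}) E = emeasure (hist_law k) E"
      unfolding hist_law_def using IT.emeasure_CI[OF order_refl E] sets.sets_into_space[OF E]
      by (simp add: prod_emb_id space_PiM)
  qed
  then have "(\<integral>\<^sup>+h. f h \<partial>hist_law k) = (\<integral>\<^sup>+h. f h \<partial>distr IT.PF.lim (Hist k) (\<lambda>\<omega>. restrict \<omega> {0..<k}))"
    using IT.distr_lim[of "{0..<k}"] by simp
  also have "\<dots> = (\<integral>\<^sup>+\<omega>. f (restrict \<omega> {0..<k}) \<partial>IT.PF.lim)"
    using f by (intro nn_integral_distr) (auto intro!: measurable_restrict simp: measurable_cong_sets[OF IT.PF.sets_lim refl])
  finally show ?thesis by (simp add: strategic_measure_def)
qed

lemma sets_strategic_measure: "sets (strategic_measure S A q \<delta> s0) = sets (PiM UNIV (\<lambda>_::nat. B))"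
  unfolding strategic_measure_def by (rule IT.PF.sets_lim)

lemma prob_space_strategic_measure: "prob_space (strategic_measure S A q \<delta> s0)"
proof
  have "(\<integral>\<^sup>+\<omega>. 1 \<partial>strategic_measure S A q \<delta> s0) = 1"
    using nn_integral_strategic_measure[of "\<lambda>_. 1" 0] prob_space.emeasure_space_1[OF hist_law(3)[of 0]] by simp
  then show "emeasure (strategic_measure S A q \<delta> s0) (space (strategic_measure S A q \<delta> s0)) = 1" by simp
qed

text \<open>
  The expected cost of stopping at time \<open>k\<close> for the terminal cost \<open>w\<close>. The last state is integrated
  separately because a history of length \<open>k\<close> ends before it.
\<close>

definition stage_cost :: "nat \<Rightarrow> ('s \<Rightarrow> ennreal) \<Rightarrow> ennreal" where
  "stage_cost k w = (\<integral>\<^sup>+h. (\<Sum>t<k. ennreal (\<alpha> ^ t) * C (h t)) + ennreal (\<alpha> ^ k) * (\<integral>\<^sup>+s. w s \<partial>state_law k h) \<partial>hist_law k)"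

lemma cost_sum_measurable: "(\<lambda>h. \<Sum>t<k. ennreal (\<alpha> ^ t) * C (h t)) \<in> borel_measurable (Hist k)"
proof (intro borel_measurable_sum borel_measurable_times_ennreal borel_measurable_const)
  fix t assume "t \<in> {..<k}"
  then have "(\<lambda>h. h t) \<in> Hist k \<rightarrow>\<^sub>M B" by (intro measurable_component_singleton) simp
  then show "(\<lambda>h. C (h t)) \<in> borel_measurable (Hist k)" using C_measurable by (rule measurable_compose)
qed

lemma state_law_integral_measurable:
  "w \<in> borel_measurable (borel_of S) \<Longrightarrow> (\<lambda>h. \<integral>\<^sup>+s. w s \<partial>state_law k h) \<in> borel_measurable (Hist k)"
  by (rule measurable_compose[OF measurable_prob_algebraD[OF state_law_measurable] nn_integral_measurable_subprob_algebra])

lemma stage_cost_0: "w \<in> borel_measurable (borel_of S) \<Longrightarrow> stage_cost 0 w = w s0"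
  unfolding stage_cost_def using s0
  by (subst nn_integral_hist_law_0)
    (simp_all add: state_law_integral_measurable state_law_def nn_integral_return)

text \<open>
  Integrating out the last step turns its cost and the terminal cost \<open>w\<close> into the action value of
  \<open>w\<close>. Comparing \<open>w\<close> with its action values is all that the verification of optimality needs.
\<close>

lemma stage_cost_Suc:
  assumes w: "w \<in> borel_measurable (borel_of S)"
  shows "stage_cost (Suc k) w = (\<integral>\<^sup>+h. (\<Sum>t<k. ennreal (\<alpha> ^ t) * C (h t)) +
    ennreal (\<alpha> ^ k) * (\<integral>\<^sup>+s. \<integral>\<^sup>+a. action_value w (s, a) \<partial>\<delta> k (h, s) \<partial>state_law k h) \<partial>hist_law k)"
proof -
  let ?c = "\<lambda>k h. \<Sum>t<k. ennreal (\<alpha> ^ t) * C (h t)"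
  let ?P = "step_law S A q \<delta> s0 k"
  have "stage_cost (Suc k) w = (\<integral>\<^sup>+h. \<integral>\<^sup>+p. ?c (Suc k) (h(k := p)) +
      ennreal (\<alpha> ^ Suc k) * (\<integral>\<^sup>+s. w s \<partial>state_law (Suc k) (h(k := p))) \<partial>?P h \<partial>hist_law k)"
    unfolding stage_cost_def
    by (intro nn_integral_hist_law_Suc borel_measurable_add borel_measurable_times_ennreal borel_measurable_const
        cost_sum_measurable state_law_integral_measurable w)
  also have "\<dots> = (\<integral>\<^sup>+h. ?c k h + ennreal (\<alpha> ^ k) * (\<integral>\<^sup>+s. \<integral>\<^sup>+a. action_value w (s, a) \<partial>\<delta> k (h, s) \<partial>state_law k h) \<partial>hist_law k)"
  proof (rule nn_integral_cong)
    fix h assume "h \<in> space (hist_law k)"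
    then have h: "h \<in> space (Hist k)" by (simp add: hist_law)
    have Ph: "sets (?P h) = sets B" "prob_space (?P h)"
      using measurable_space[OF step_law_measurable h] by (auto simp: space_prob_algebra)
    have av: "action_value w \<in> borel_measurable (?P h)"
      using action_value_measurable[OF w] by (simp add: measurable_cong_sets[OF Ph(1) refl])
    have "(\<integral>\<^sup>+p. ?c (Suc k) (h(k := p)) + ennreal (\<alpha> ^ Suc k) * (\<integral>\<^sup>+s. w s \<partial>state_law (Suc k) (h(k := p))) \<partial>?P h) =
        (\<integral>\<^sup>+p. ?c k h + ennreal (\<alpha> ^ k) * action_value w p \<partial>?P h)"
    proof (rule nn_integral_cong)
      fix p
      have "?c (Suc k) (h(k := p)) = ?c k h + ennreal (\<alpha> ^ k) * C p"
        by (simp add: sum.lessThan_Suc)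
      moreover have "ennreal (\<alpha> ^ Suc k) = ennreal (\<alpha> ^ k) * ennreal \<alpha>"
        using \<alpha> by (simp add: ennreal_mult mult.commute)
      ultimately show "?c (Suc k) (h(k := p)) + ennreal (\<alpha> ^ Suc k) * (\<integral>\<^sup>+s. w s \<partial>state_law (Suc k) (h(k := p))) =
          ?c k h + ennreal (\<alpha> ^ k) * action_value w p"
        by (simp add: action_value_def state_law_def distrib_left mult.assoc add.assoc)
    qed
    also have "\<dots> = ?c k h + ennreal (\<alpha> ^ k) * (\<integral>\<^sup>+p. action_value w p \<partial>?P h)"
      using prob_space.emeasure_space_1[OF Ph(2)] av
      by (subst nn_integral_add) (simp_all add: nn_integral_cmult)
    also have "(\<integral>\<^sup>+p. action_value w p \<partial>?P h) = (\<integral>\<^sup>+s. \<integral>\<^sup>+a. action_value w (s, a) \<partial>\<delta> k (h, s) \<partial>state_law k h)"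
      by (rule nn_integral_step_law[OF h action_value_measurable[OF w]])
    finally show "(\<integral>\<^sup>+p. ?c (Suc k) (h(k := p)) + ennreal (\<alpha> ^ Suc k) * (\<integral>\<^sup>+s. w s \<partial>state_law (Suc k) (h(k := p))) \<partial>?P h) =
        ?c k h + ennreal (\<alpha> ^ k) * (\<integral>\<^sup>+s. \<integral>\<^sup>+a. action_value w (s, a) \<partial>\<delta> k (h, s) \<partial>state_law k h)" .
  qed
  finally show ?thesis .
qed

lemma policy_space:
  assumes "h \<in> space (hist_law k)" "s \<in> space (state_law k h)"
  shows "s \<in> topspace S" "\<delta> k (h, s) \<in> prob_measures A"
proof -
  have h: "h \<in> space (Hist k)" using assms(1) by (simp add: hist_law)
  show s: "s \<in> topspace S"
    using measurable_space[OF state_law_measurable h] sets_eq_imp_space_eq[of "state_law k h" "borel_of S"] assms(2)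
    by (simp add: space_prob_algebra)
  show "\<delta> k (h, s) \<in> prob_measures A"
    using measurable_space[OF policy_measurable[OF \<delta>], of "(h, s)" k] h s
    by (simp add: space_pair_measure prob_measures_eq_space)
qed

lemma stage_cost_le_Suc:
  assumes w: "w \<in> borel_measurable (borel_of S)"
    and le: "\<And>s a. s \<in> topspace S \<Longrightarrow> a \<in> topspace A \<Longrightarrow> v s \<le> action_value w (s, a)"
  shows "stage_cost k v \<le> stage_cost (Suc k) w"
  unfolding stage_cost_Suc[OF w] unfolding stage_cost_def
proof (intro nn_integral_mono add_left_mono mult_left_mono)
  fix h s assume hs: "h \<in> space (hist_law k)" "s \<in> space (state_law k h)"
  note \<delta>p = prob_measuresD[OF policy_space(2)[OF hs]]
  have "v s = (\<integral>\<^sup>+a. v s \<partial>\<delta> k (h, s))" using prob_space.emeasure_space_1[OF \<delta>p(1)] by simp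
  also have "\<dots> \<le> (\<integral>\<^sup>+a. action_value w (s, a) \<partial>\<delta> k (h, s))"
    using le policy_space(1)[OF hs] \<delta>p(3) by (intro nn_integral_mono) simp
  finally show "v s \<le> (\<integral>\<^sup>+a. action_value w (s, a) \<partial>\<delta> k (h, s))" .
qed simp

lemma stage_cost_eq_Suc:
  assumes w: "w \<in> borel_measurable (borel_of S)" and \<phi>: "\<phi> k \<in> borel_of S \<rightarrow>\<^sub>M borel_of A"
    and \<delta>_eq: "\<delta> = markov_policy A \<phi>"
    and eq: "\<And>s. s \<in> topspace S \<Longrightarrow> v s = action_value w (s, \<phi> k s)"
  shows "stage_cost k v = stage_cost (Suc k) w"
  unfolding stage_cost_Suc[OF w] unfolding stage_cost_def
proof (intro nn_integral_cong arg_cong2[where f = "(+)"] arg_cong2[where f = "(*)"] refl)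
  fix h s assume hs: "h \<in> space (hist_law k)" "s \<in> space (state_law k h)"
  have s: "s \<in> space (borel_of S)" using policy_space(1)[OF hs] by simp
  have "(\<lambda>a. action_value w (s, a)) \<in> borel_measurable (borel_of A)"
    using measurable_compose[OF measurable_Pair1'[OF s] action_value_measurable[OF w]] .
  then have "(\<integral>\<^sup>+a. action_value w (s, a) \<partial>return (borel_of A) (\<phi> k s)) = action_value w (s, \<phi> k s)"
    by (intro nn_integral_return measurable_space[OF \<phi> s])
  then show "v s = (\<integral>\<^sup>+a. action_value w (s, a) \<partial>\<delta> k (h, s))"
    using eq[of s] s by (simp add: \<delta>_eq markov_policy_def)
qed

lemma policy_cost_finite: "policy_cost (enat n) \<delta> s0 = stage_cost n (\<lambda>_. 0)"
proof -
  have "(\<Sum>t. if enat t < enat n then ennreal (\<alpha> ^ t) * C (\<omega> t) else 0) =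
      (\<Sum>t<n. ennreal (\<alpha> ^ t) * C (restrict \<omega> {0..<n} t))" for \<omega>
  proof -
    have "(\<Sum>t. if enat t < enat n then ennreal (\<alpha> ^ t) * C (\<omega> t) else 0) =
        (\<Sum>t<n. if enat t < enat n then ennreal (\<alpha> ^ t) * C (\<omega> t) else 0)"
      by (rule suminf_finite) auto
    also have "\<dots> = (\<Sum>t<n. ennreal (\<alpha> ^ t) * C (restrict \<omega> {0..<n} t))" by (rule sum.cong) auto
    finally show ?thesis .
  qed
  then show ?thesis
    unfolding policy_cost_def stage_cost_def
    using nn_integral_strategic_measure[OF cost_sum_measurable[of n]] by simp
qed

lemma policy_cost_infinite: "policy_cost \<infinity> \<delta> s0 = (SUP n. policy_cost (enat n) \<delta> s0)"
proof -
  let ?f = "\<lambda>n \<omega>. \<Sum>t<n. ennreal (\<alpha> ^ t) * C (\<omega> t)"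
  have m: "?f n \<in> borel_measurable (strategic_measure S A q \<delta> s0)" for n
    unfolding measurable_cong_sets[OF sets_strategic_measure refl]
  proof (intro borel_measurable_sum borel_measurable_times_ennreal borel_measurable_const)
    fix t :: nat
    have "(\<lambda>\<omega>. \<omega> t) \<in> PiM UNIV (\<lambda>_::nat. B) \<rightarrow>\<^sub>M B" by (rule measurable_component_singleton) simp
    then show "(\<lambda>\<omega>. C (\<omega> t)) \<in> borel_measurable (PiM UNIV (\<lambda>_::nat. B))" using C_measurable by (rule measurable_compose)
  qed
  have "policy_cost \<infinity> \<delta> s0 = (\<integral>\<^sup>+\<omega>. (SUP n. ?f n \<omega>) \<partial>strategic_measure S A q \<delta> s0)"
    by (simp add: policy_cost_def suminf_eq_SUP)
  also have "\<dots> = (SUP n. \<integral>\<^sup>+\<omega>. ?f n \<omega> \<partial>strategic_measure S A q \<delta> s0)"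
    using m by (intro nn_integral_monotone_convergence_SUP incseq_SucI le_funI) (auto simp: sum.lessThan_Suc)
  also have "\<dots> = (SUP n. policy_cost (enat n) \<delta> s0)"
  proof (rule SUP_cong[OF refl])
    fix n
    have "(\<Sum>t. if enat t < enat n then ennreal (\<alpha> ^ t) * C (\<omega> t) else 0) = ?f n \<omega>" for \<omega>
    proof -
      have "(\<Sum>t. if enat t < enat n then ennreal (\<alpha> ^ t) * C (\<omega> t) else 0) =
          (\<Sum>t<n. if enat t < enat n then ennreal (\<alpha> ^ t) * C (\<omega> t) else 0)"
        by (rule suminf_finite) auto
      then show ?thesis by simp
    qed
    then show "(\<integral>\<^sup>+\<omega>. ?f n \<omega> \<partial>strategic_measure S A q \<delta> s0) = policy_cost (enat n) \<delta> s0"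
      by (simp add: policy_cost_def)
  qed
  finally show ?thesis .
qed

text \<open>
  Starting from \<open>value_iter n\<close> as a terminal cost at time \<open>0\<close>, each exchange of the terminal cost for
  one more step can only increase the total, whatever the policy does; after \<open>n\<close> steps the terminal
  cost is \<open>0\<close>.
\<close>

theorem val_le_policy_cost: "val T s0 \<le> policy_cost T \<delta> s0"
proof -
  have fin: "value_iter n s0 \<le> policy_cost (enat n) \<delta> s0" for n
  proof -
    note meas = lsc_measurable[OF lsc_value_iter]
    have "stage_cost 0 (value_iter n) \<le> stage_cost k (value_iter (n - k))" if "k \<le> n" for k
      using that
    proof (induction k)
      case (Suc k)
      have "stage_cost k (value_iter (n - k)) \<le> stage_cost (Suc k) (value_iter (n - Suc k))"
      proof (rule stage_cost_le_Suc[OF meas])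
        fix s a assume "a \<in> topspace A"
        moreover have "n - k = Suc (n - Suc k)" using Suc.prems by simp
        ultimately show "value_iter (n - k) s \<le> action_value (value_iter (n - Suc k)) (s, a)"
          by (auto intro: INF_lower)
      qed
      with Suc show ?case by simp
    qed simp
    from this[of n] show ?thesis
      by (simp add: stage_cost_0[OF meas] policy_cost_finite value_iter.simps(1)[abs_def])
  qed
  show ?thesis
  proof (cases T)
    case (enat n) then show ?thesis using fin by (simp add: val_def)
  next
    case infinity
    then show ?thesis using fin by (auto simp: val_def policy_cost_infinite intro: SUP_mono)
  qed
qed

end

text \<open>
  With minimising actions the exchange of a terminal cost for one more step is an equality at each
  time. A policy for \<open>T\<close> steps has \<open>T - k\<close> steps to go at time \<open>k\<close>, whence the reversed index.
\<close>

theorem policy_cost_markov_minimizers: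
  assumes \<phi>: "\<And>t. \<phi> t \<in> borel_of S \<rightarrow>\<^sub>M borel_of A"
    and opt: "\<And>s t. s \<in> topspace S \<Longrightarrow> t < T \<Longrightarrow> \<phi> (T - 1 - t) s \<in> minimizers (enat t) s"
    and s0: "s0 \<in> topspace S"
  shows "policy_cost (enat T) (markov_policy A \<phi>) s0 = val (enat T) s0"
proof -
  note \<delta> = markov_policy_in_policies[OF \<phi>]
  note meas = lsc_measurable[OF lsc_value_iter]
  let ?J = "stage_cost (markov_policy A \<phi>) s0"
  have "?J 0 (value_iter T) = ?J k (value_iter (T - k))" if "k \<le> T" for k
    using that
  proof (induction k)
    case (Suc k)
    have "?J k (value_iter (T - k)) = ?J (Suc k) (value_iter (T - Suc k))"
    proof (rule stage_cost_eq_Suc[OF \<delta> s0 meas \<phi> refl])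
      fix s assume s: "s \<in> topspace S"
      have "T - 1 - (T - Suc k) = k" "T - k = Suc (T - Suc k)" using Suc.prems by auto
      then show "value_iter (T - k) s = action_value (value_iter (T - Suc k)) (s, \<phi> k s)"
        using opt[OF s, of "T - Suc k"] Suc.prems
        by (simp add: minimizers_def val_def[abs_def] eSuc_enat)
    qed
    with Suc show ?case by simp
  qed simp
  from this[of T] show ?thesis
    by (simp add: stage_cost_0[OF \<delta> s0 meas] policy_cost_finite[OF \<delta> s0] val_def value_iter.simps(1)[abs_def])
qed

text \<open>
  For minimising \<open>\<phi>\<close> the value is a fixed point of the cost recursion of the policy, which bounds the
  costs of finitely many steps by it. Conversely the cost of any stationary policy is a fixed point of
  its own recursion; if it equals the value, this equation says that \<open>\<phi>\<close> minimises.
\<close>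

theorem policy_cost_stationary_iff:
  assumes \<phi>: "\<phi> \<in> borel_of S \<rightarrow>\<^sub>M borel_of A"
  shows "(\<forall>s\<in>topspace S. policy_cost \<infinity> (markov_policy A (\<lambda>_. \<phi>)) s = val \<infinity> s) \<longleftrightarrow>
    (\<forall>s\<in>topspace S. \<phi> s \<in> minimizers \<infinity> s)" (is "?L \<longleftrightarrow> ?R")
proof
  let ?\<delta> = "markov_policy A (\<lambda>_. \<phi>)"
  have \<delta>: "?\<delta> \<in> policies S A" by (rule markov_policy_in_policies[OF \<phi>])
  have \<phi>A: "\<phi> s \<in> topspace A" if "s \<in> topspace S" for s using measurable_space[OF \<phi>, of s] that by simp
  have le: "val \<infinity> s \<le> policy_cost \<infinity> ?\<delta> s" if "s \<in> topspace S" for s by (rule val_le_policy_cost[OF \<delta> that])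
  {
    assume R: ?R
    show ?L
    proof (intro ballI antisym le)
      fix s0 assume s0: "s0 \<in> topspace S"
      note meas = lsc_measurable[OF lsc_val[of \<infinity>]]
      have const: "stage_cost ?\<delta> s0 0 (val \<infinity>) = stage_cost ?\<delta> s0 n (val \<infinity>)" for n
      proof (induction n)
        case (Suc n)
        have "stage_cost ?\<delta> s0 n (val \<infinity>) = stage_cost ?\<delta> s0 (Suc n) (val \<infinity>)"
          by (rule stage_cost_eq_Suc[OF \<delta> s0 meas \<phi> refl]) (use R in \<open>simp add: minimizers_def\<close>)
        with Suc show ?case by simp
      qed simp
      have "stage_cost ?\<delta> s0 n (\<lambda>_. 0) \<le> stage_cost ?\<delta> s0 n (val \<infinity>)" for n
        unfolding stage_cost_def[OF \<delta> s0] by (intro nn_integral_mono add_left_mono mult_left_mono) auto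
      then have "policy_cost (enat n) ?\<delta> s0 \<le> val \<infinity> s0" for n
        unfolding policy_cost_finite[OF \<delta> s0] stage_cost_0[OF \<delta> s0 meas, symmetric] const[of n] .
      then show "policy_cost \<infinity> ?\<delta> s0 \<le> val \<infinity> s0"
        unfolding policy_cost_infinite[OF \<delta> s0] by (rule SUP_least)
    qed
  next
    assume L: ?L
    \<comment> \<open>\<open>e n\<close> is the cost of the first \<open>n\<close> steps of the stationary policy, by its recursion\<close>
    define e where "e n = ((\<lambda>v s. action_value v (s, \<phi> s)) ^^ n) (\<lambda>_. 0)" for n
    have e0: "e 0 = (\<lambda>_. 0)" and e_Suc: "e (Suc n) s = action_value (e n) (s, \<phi> s)" for n s
      by (simp_all add: e_def)
    have pair: "(\<lambda>s. (s, \<phi> s)) \<in> borel_of S \<rightarrow>\<^sub>M B" using \<phi> by measurable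
    have meas: "e n \<in> borel_measurable (borel_of S)" for n
    proof (induction n)
      case (Suc n)
      show ?case using measurable_compose[OF pair action_value_measurable[OF Suc]] by (simp add: e_Suc[abs_def])
    qed (simp add: e0)
    have mono: "e n s \<le> e (Suc n) s" if "s \<in> topspace S" for n s
      using that
    proof (induction n arbitrary: s)
      case (Suc n)
      have "action_value (e n) (s, \<phi> s) \<le> action_value (e (Suc n)) (s, \<phi> s)"
        using Suc \<phi>A by (intro action_value_mono) auto
      then show ?case by (simp only: e_Suc)
    qed (simp add: e0)
    have cost_e: "policy_cost (enat n) ?\<delta> s0 = e n s0" if s0: "s0 \<in> topspace S" for n s0
    proof -
      have "stage_cost ?\<delta> s0 0 (e n) = stage_cost ?\<delta> s0 k (e (n - k))" if "k \<le> n" for k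
        using that
      proof (induction k)
        case (Suc k)
        have "stage_cost ?\<delta> s0 k (e (n - k)) = stage_cost ?\<delta> s0 (Suc k) (e (n - Suc k))"
        proof (rule stage_cost_eq_Suc[OF \<delta> s0 meas \<phi> refl])
          have "n - k = Suc (n - Suc k)" using Suc.prems by simp
          then show "e (n - k) s = action_value (e (n - Suc k)) (s, \<phi> s)" for s by (simp only: e_Suc)
        qed
        with Suc show ?case by simp
      qed simp
      from this[of n] show ?thesis
        by (simp add: stage_cost_0[OF \<delta> s0 meas] policy_cost_finite[OF \<delta> s0] e0)
    qed
    have cost_lim: "(SUP n. e n s) = val \<infinity> s" if s: "s \<in> topspace S" for s
      using bspec[OF L s] unfolding policy_cost_infinite[OF \<delta> s] cost_e[OF s] .
    show ?R
    proof
      fix s assume s: "s \<in> topspace S"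
      have p: "(s, \<phi> s) \<in> topspace S \<times> topspace A" using s \<phi>A by simp
      have "val \<infinity> s = (SUP n. e (Suc n) s)"
        unfolding cost_lim[OF s, symmetric] using mono[OF s] by (intro antisym SUP_mono) auto
      also have "\<dots> = action_value (\<lambda>s. SUP n. e n s) (s, \<phi> s)"
        by (simp only: e_Suc action_value_SUP[of e, OF meas mono p])
      also have "\<dots> = action_value (val \<infinity>) (s, \<phi> s)"
        by (rule action_value_cong[OF cost_lim p])
      finally show "\<phi> s \<in> minimizers \<infinity> s" using \<phi>A[OF s] by (simp add: minimizers_def)
    qed
  }
qed

end

section \<open>Costs bounded below\<close>

text \<open>
  The negative part of the integrand is at most \<open>k\<close>, so the difference of the integrals of the two
  parts is not of the form \<open>\<infinity> - \<infinity>\<close>, and both sides are rearrangements of the same equation.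
\<close>

lemma ereal_integral_shift:
  fixes g :: "'a \<Rightarrow> ennreal"
  assumes \<mu>: "prob_space \<mu>" and g: "g \<in> borel_measurable \<mu>" and k: "0 \<le> k"
    and f: "\<And>x. x \<in> space \<mu> \<Longrightarrow> f x = enn2ereal (g x) - ereal k"
  shows "ereal_integral \<mu> f = enn2ereal (\<integral>\<^sup>+x. g x \<partial>\<mu>) - ereal k"
proof -
  interpret prob_space \<mu> by fact
  let ?p = "\<lambda>x. g x - ennreal k" and ?n = "\<lambda>x. ennreal k - g x"
  have [measurable]: "g \<in> borel_measurable \<mu>" by (rule g)
  have conv: "e2ennreal (enn2ereal y - ereal k) = y - ennreal k" "e2ennreal (- (enn2ereal y - ereal k)) = ennreal k - y" for y
  proof -
    show "e2ennreal (enn2ereal y - ereal k) = y - ennreal k"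
      using k by (cases y) (simp_all add: ennreal_minus)
    show "e2ennreal (- (enn2ereal y - ereal k)) = ennreal k - y"
    proof (cases y)
      case (real r)
      then have "- (enn2ereal y - ereal k) = ereal (k - r)" by simp
      then show ?thesis using real by (simp only: e2ennreal_ereal ennreal_minus)
    next
      case top
      then have "- (enn2ereal y - ereal k) = - \<infinity>" by simp
      then show ?thesis using top by (simp add: e2ennreal_neg)
    qed
  qed
  have f_eq: "e2ennreal (f x) = ?p x" "e2ennreal (- f x) = ?n x" if x: "x \<in> space \<mu>" for x
    unfolding f[OF x] by (rule conv)+
  have "?p x + ennreal k = g x + ?n x" for x
  proof (cases "g x \<le> ennreal k")
    case True
    then have "?p x = 0" by (simp add: diff_eq_0_iff_ennreal order_le_less_trans)
    then show ?thesis by (simp only: add_diff_inverse_ennreal[OF True] add_0)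
  next
    case False
    then have le: "ennreal k \<le> g x" by simp
    then have "?n x = 0" by (simp add: diff_eq_0_iff_ennreal)
    then show ?thesis by (simp only: add.commute[of _ "ennreal k"] add_diff_inverse_ennreal[OF le] add_0_right)
  qed
  then have "(\<integral>\<^sup>+x. ?p x + ennreal k \<partial>\<mu>) = (\<integral>\<^sup>+x. g x + ?n x \<partial>\<mu>)" by simp
  then have eq: "(\<integral>\<^sup>+x. ?p x \<partial>\<mu>) + ennreal k = (\<integral>\<^sup>+x. g x \<partial>\<mu>) + (\<integral>\<^sup>+x. ?n x \<partial>\<mu>)"
    by (simp add: nn_integral_add emeasure_space_1)
  have "(\<integral>\<^sup>+x. ?n x \<partial>\<mu>) \<le> (\<integral>\<^sup>+x. ennreal k \<partial>\<mu>)"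
    by (intro nn_integral_mono) (simp add: diff_le_self_ennreal)
  also have "\<dots> < \<infinity>" by (simp add: emeasure_space_1)
  finally obtain m where m: "(\<integral>\<^sup>+x. ?n x \<partial>\<mu>) = ennreal m" "0 \<le> m" by (cases "\<integral>\<^sup>+x. ?n x \<partial>\<mu>") auto
  have "ereal_integral \<mu> f = enn2ereal (\<integral>\<^sup>+x. ?p x \<partial>\<mu>) - enn2ereal (\<integral>\<^sup>+x. ?n x \<partial>\<mu>)"
    unfolding ereal_integral_def
    by (intro arg_cong2[where f = "\<lambda>a b. enn2ereal a - enn2ereal b"] nn_integral_cong f_eq)
  also have "\<dots> = enn2ereal (\<integral>\<^sup>+x. g x \<partial>\<mu>) - ereal k"
    using eq k m by (cases "\<integral>\<^sup>+x. ?p x \<partial>\<mu>"; cases "\<integral>\<^sup>+x. g x \<partial>\<mu>") (auto simp flip: ennreal_plus)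
  finally show ?thesis .
qed

lemma ereal_mult_diff_shift:
  assumes "0 \<le> x"
  shows "ereal x * (enn2ereal y - ereal k) = enn2ereal (ennreal x * y) - ereal (x * k)"
  using assms
  by (cases y; cases "x = 0") (auto simp: zero_ennreal.rep_eq algebra_simps ennreal_mult_top simp flip: ennreal_mult)

lemma ereal_add_shift:
  "(enn2ereal x - ereal k) + (enn2ereal y - ereal l) = enn2ereal (x + y) - ereal (k + l)"
  by (cases x; cases y) (auto simp flip: ennreal_plus)

lemma suminf_ereal_shift:
  fixes g :: "nat \<Rightarrow> ennreal"
  assumes f: "\<And>t. f t = enn2ereal (g t) - ereal (r t)" and r: "r sums R"
  shows "(\<Sum>t. f t) = enn2ereal (\<Sum>t. g t) - ereal R"
proof -
  have part: "(\<Sum>t<n. f t) = enn2ereal (\<Sum>t<n. g t) - ereal (\<Sum>t<n. r t)" for n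
  proof (induction n)
    case (Suc n)
    then show ?case by (simp only: sum.lessThan_Suc f ereal_add_shift)
  qed (simp add: zero_ennreal.rep_eq)
  have "(\<lambda>n. enn2ereal (\<Sum>t<n. g t)) \<longlonglongrightarrow> enn2ereal (\<Sum>t. g t)"
    using summable_LIMSEQ[of g] by (intro tendsto_enn2erealI) simp
  moreover have "(\<lambda>n. ereal (\<Sum>t<n. r t)) \<longlonglongrightarrow> ereal R"
    using r by (simp add: sums_def)
  ultimately have "(\<lambda>n. \<Sum>t<n. f t) \<longlonglongrightarrow> enn2ereal (\<Sum>t. g t) - ereal R"
    unfolding part by (intro tendsto_diff_ereal_general) auto
  then have "f sums (enn2ereal (\<Sum>t. g t) - ereal R)" by (simp add: sums_def)
  then show ?thesis by (rule sums_unique[symmetric])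
qed

text \<open>
  A shift is admissible if its discounted total is finite: either it vanishes or the discount factor
  is less than \<open>1\<close>.
\<close>

locale shifted_mdp = inf_compact_mdp S A q C \<alpha>
  for S :: "'s topology" and A :: "'a topology" and q C \<alpha> +
  fixes c :: "'s \<times> 'a \<Rightarrow> ereal" and b :: real
  assumes c: "\<And>p. p \<in> topspace S \<times> topspace A \<Longrightarrow> c p = enn2ereal (C p) - ereal b"
    and b: "0 \<le> b" "b = 0 \<or> \<alpha> < 1"
begin

definition total_shift :: "enat \<Rightarrow> real" where
  "total_shift T = (\<Sum>t. if enat t < T then \<alpha> ^ t * b else 0)"

lemma total_shift_sums: "(\<lambda>t. if enat t < T then \<alpha> ^ t * b else 0) sums total_shift T"
proof -
  have "summable (\<lambda>t. if enat t < T then \<alpha> ^ t * b else 0)"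
  proof (cases "b = 0")
    case False
    then have "summable (\<lambda>t. \<alpha> ^ t * b)" using b \<alpha> by (intro summable_mult2 summable_geometric) auto
    then show ?thesis by (rule summable_comparison_test'[where N = 0]) (use b \<alpha> in auto)
  qed (simp cong: if_cong)
  then show ?thesis by (simp add: total_shift_def summable_sums)
qed

lemma total_shift_nonneg: "0 \<le> total_shift T"
  unfolding total_shift_def using b \<alpha> total_shift_sums[of T] by (intro suminf_nonneg) (auto simp: sums_iff)

text \<open>The shift obeys the same recursion as the value and therefore cancels in optimality equations.\<close>

lemma total_shift_eSuc: "total_shift (eSuc T) = b + \<alpha> * total_shift T"
proof -
  let ?f = "\<lambda>T t. if enat t < T then \<alpha> ^ t * b else 0"
  have "?f (eSuc T) (Suc t) = \<alpha> * ?f T t" for t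
    by (simp flip: eSuc_enat add: mult.assoc)
  then have "(\<lambda>t. ?f (eSuc T) (Suc t)) sums (\<alpha> * total_shift T)"
    using sums_mult[OF total_shift_sums[of T], of \<alpha>] by simp
  then have "?f (eSuc T) sums (\<alpha> * total_shift T + ?f (eSuc T) 0)" by (rule sums_Suc)
  moreover have "?f (eSuc T) 0 = b" by (simp flip: zero_enat_def)
  ultimately have "?f (eSuc T) sums (\<alpha> * total_shift T + b)" by (simp only:)
  from sums_unique2[OF total_shift_sums this] show ?thesis by simp
qed

lemma total_shift_tendsto: "(\<lambda>n. total_shift (enat n)) \<longlonglongrightarrow> total_shift \<infinity>"
proof -
  have "total_shift (enat n) = (\<Sum>t<n. \<alpha> ^ t * b)" for n
    unfolding total_shift_def by (subst suminf_finite[of "{..<n}"]) auto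
  moreover have "(\<lambda>t. \<alpha> ^ t * b) sums total_shift \<infinity>" using total_shift_sums[of \<infinity>] by simp
  ultimately show ?thesis by (simp add: sums_def)
qed

lemma policy_value_eq:
  assumes \<delta>: "\<delta> \<in> policies S A" and s: "s \<in> topspace S"
  shows "policy_value S A q c \<alpha> T \<delta> s = enn2ereal (policy_cost T \<delta> s) - ereal (total_shift T)"
  unfolding policy_value_def policy_cost_def
proof (rule ereal_integral_shift[OF prob_space_strategic_measure[OF \<delta> s] _ total_shift_nonneg])
  note sets = sets_strategic_measure[OF \<delta> s]
  show "(\<lambda>\<omega>. \<Sum>t. if enat t < T then ennreal (\<alpha> ^ t) * C (\<omega> t) else 0) \<in> borel_measurable (strategic_measure S A q \<delta> s)"
    unfolding measurable_cong_sets[OF sets refl]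
  proof (rule borel_measurable_suminf_order)
    fix t :: nat
    have "(\<lambda>\<omega>. \<omega> t) \<in> PiM UNIV (\<lambda>_::nat. B) \<rightarrow>\<^sub>M B" by (rule measurable_component_singleton) simp
    from measurable_compose[OF this C_measurable]
    show "(\<lambda>\<omega>. if enat t < T then ennreal (\<alpha> ^ t) * C (\<omega> t) else 0) \<in> borel_measurable (PiM UNIV (\<lambda>_::nat. B))"
      by (cases "enat t < T") simp_all
  qed
  fix \<omega> assume "\<omega> \<in> space (strategic_measure S A q \<delta> s)"
  then have \<omega>: "\<omega> t \<in> topspace S \<times> topspace A" for t
    using sets_eq_imp_space_eq[OF sets] by (auto simp: space_PiM space_pair_measure PiE_iff)
  show "total_cost c \<alpha> T \<omega> = enn2ereal (\<Sum>t. if enat t < T then ennreal (\<alpha> ^ t) * C (\<omega> t) else 0) - ereal (total_shift T)"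
    unfolding total_cost_def
  proof (rule suminf_ereal_shift[OF _ total_shift_sums])
    fix t show "(if enat t < T then ereal (\<alpha> ^ t) * c (\<omega> t) else 0) =
        enn2ereal (if enat t < T then ennreal (\<alpha> ^ t) * C (\<omega> t) else 0) - ereal (if enat t < T then \<alpha> ^ t * b else 0)"
      using \<alpha> by (simp add: c[OF \<omega>] ereal_mult_diff_shift zero_ennreal.rep_eq)
  qed
qed

lemma enn2ereal_shift_le_iff: "enn2ereal x - ereal k \<le> enn2ereal y - ereal k \<longleftrightarrow> x \<le> y"
  by (cases x; cases y) (auto simp: top_unique)

lemma enn2ereal_shift_eq_iff: "enn2ereal x - ereal k = enn2ereal y - ereal k \<longleftrightarrow> x = y"
  by (cases x; cases y) auto

lemma exists_optimal_markov:
  "\<exists>\<phi>. (\<forall>t. \<phi> t \<in> borel_of S \<rightarrow>\<^sub>M borel_of A) \<and> (\<forall>s\<in>topspace S. policy_cost (enat n) (markov_policy A \<phi>) s = val (enat n) s)"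
proof -
  \<comment> \<open>for \<open>t \<ge> n\<close> truncated subtraction gives the index \<open>0\<close>, at times that do not affect the cost\<close>
  have "\<exists>\<psi>. \<psi> \<in> borel_of S \<rightarrow>\<^sub>M borel_of A \<and> (\<forall>s\<in>topspace S. \<psi> s \<in> minimizers (enat (n - 1 - t)) s)" for t
    using measurable_minimizer by blast
  then obtain \<phi> where \<phi>: "\<And>t. \<phi> t \<in> borel_of S \<rightarrow>\<^sub>M borel_of A"
    "\<And>t s. s \<in> topspace S \<Longrightarrow> \<phi> t s \<in> minimizers (enat (n - 1 - t)) s" by metis
  have "policy_cost (enat n) (markov_policy A \<phi>) s = val (enat n) s" if s: "s \<in> topspace S" for s
  proof (rule policy_cost_markov_minimizers[OF \<phi>(1) _ s])
    fix s t assume "s \<in> topspace S" "t < n"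
    then show "\<phi> (n - 1 - t) s \<in> minimizers (enat t) s" using \<phi>(2)[of s "n - 1 - t"] by simp
  qed
  with \<phi>(1) show ?thesis by blast
qed

lemma exists_optimal_stationary:
  "\<exists>\<phi>\<in>borel_of S \<rightarrow>\<^sub>M borel_of A. \<forall>s\<in>topspace S. policy_cost \<infinity> (markov_policy A (\<lambda>_. \<phi>)) s = val \<infinity> s"
  using measurable_minimizer[of \<infinity>] policy_cost_stationary_iff by blast

theorem opt_value_eq:
  assumes s: "s \<in> topspace S"
  shows "opt_value S A q c \<alpha> T s = enn2ereal (val T s) - ereal (total_shift T)"
  unfolding opt_value_def
proof (rule antisym)
  show "enn2ereal (val T s) - ereal (total_shift T) \<le> (INF \<delta>\<in>policies S A. policy_value S A q c \<alpha> T \<delta> s)"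
    using val_le_policy_cost[OF _ s] by (intro INF_greatest) (simp add: policy_value_eq[OF _ s] enn2ereal_shift_le_iff)
  obtain \<delta> where \<delta>: "\<delta> \<in> policies S A" "policy_cost T \<delta> s = val T s"
  proof (cases T)
    case (enat n)
    obtain \<phi> where "\<And>t. \<phi> t \<in> borel_of S \<rightarrow>\<^sub>M borel_of A" "policy_cost (enat n) (markov_policy A \<phi>) s = val (enat n) s"
      using exists_optimal_markov[of n] s by blast
    then show ?thesis using that[OF markov_policy_in_policies] enat by blast
  next
    case infinity
    obtain \<phi> where "\<phi> \<in> borel_of S \<rightarrow>\<^sub>M borel_of A" "policy_cost \<infinity> (markov_policy A (\<lambda>_. \<phi>)) s = val \<infinity> s"
      using exists_optimal_stationary s by blast
    then show ?thesis using that[OF markov_policy_in_policies, of "\<lambda>_. \<phi>"] infinity by blast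
  qed
  then have "policy_value S A q c \<alpha> T \<delta> s = enn2ereal (val T s) - ereal (total_shift T)"
    by (simp add: policy_value_eq[OF _ s])
  then show "(INF \<delta>\<in>policies S A. policy_value S A q c \<alpha> T \<delta> s) \<le> enn2ereal (val T s) - ereal (total_shift T)"
    using \<delta>(1) by (intro INF_lower2) auto
qed

lemma optimal_policy_iff:
  "optimal_policy S A q c \<alpha> T \<delta> \<longleftrightarrow> \<delta> \<in> policies S A \<and> (\<forall>s\<in>topspace S. policy_cost T \<delta> s = val T s)"
  unfolding optimal_policy_def by (auto simp: policy_value_eq opt_value_eq enn2ereal_shift_eq_iff)

lemma integral_opt_value:
  assumes p: "p \<in> topspace S \<times> topspace A"
  shows "ereal_integral (q p) (opt_value S A q c \<alpha> T) = enn2ereal (\<integral>\<^sup>+s. val T s \<partial>q p) - ereal (total_shift T)"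
  using prob_measuresD[OF q_prob[OF p]] lsc_measurable[OF lsc_val]
  by (intro ereal_integral_shift total_shift_nonneg) (auto simp: opt_value_eq cong: measurable_cong_sets)

lemma shifted_action_value:
  assumes p: "p \<in> topspace S \<times> topspace A"
  shows "c p + ereal \<alpha> * (enn2ereal (\<integral>\<^sup>+s. v s \<partial>q p) - ereal (total_shift T)) =
    enn2ereal (action_value v p) - ereal (total_shift (eSuc T))"
  unfolding c[OF p] ereal_mult_diff_shift[OF \<alpha>] action_value_def total_shift_eSuc
  by (cases "C p"; cases "ennreal \<alpha> * (\<integral>\<^sup>+s. v s \<partial>q p)") (auto simp flip: ennreal_plus)

lemma Bellman_value_eq:
  assumes p: "p \<in> topspace S \<times> topspace A"
  shows "c p + ereal \<alpha> * ereal_integral (q p) (opt_value S A q c \<alpha> T) =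
    enn2ereal (action_value (val T) p) - ereal (total_shift (eSuc T))"
  unfolding integral_opt_value[OF p] by (rule shifted_action_value[OF p])

lemma opt_actions_eq: "s \<in> topspace S \<Longrightarrow> opt_actions S A q c \<alpha> T s = minimizers T s"
  unfolding opt_actions_def minimizers_def
  by (auto simp: opt_value_eq Bellman_value_eq enn2ereal_shift_eq_iff)

lemma opt_value_attained:
  assumes s: "s \<in> topspace S"
  shows "is_attained_min (topspace A) (\<lambda>a. c (s, a) + ereal \<alpha> * ereal_integral (q (s, a)) (opt_value S A q c \<alpha> T))
    (opt_value S A q c \<alpha> (eSuc T) s)"
  using minimizers_nonempty[OF s, of T] val_le_action_value[OF s, of _ T]
  unfolding is_attained_min_def minimizers_def
  by (auto simp: opt_value_eq[OF s] Bellman_value_eq s enn2ereal_shift_eq_iff enn2ereal_shift_le_iff)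

lemma opt_value_infinite_iff: "s \<in> topspace S \<Longrightarrow> opt_value S A q c \<alpha> T s = \<infinity> \<longleftrightarrow> val T s = \<infinity>"
  by (cases "val T s") (auto simp: opt_value_eq)

lemma lower_semicontinuous_opt_value: "lower_semicontinuous S (opt_value S A q c \<alpha> T)"
  unfolding lower_semicontinuous_def
proof
  fix r
  have iff: "r < opt_value S A q c \<alpha> T s \<longleftrightarrow> r + ereal (total_shift T) < enn2ereal (val T s)" if "s \<in> topspace S" for s
    unfolding opt_value_eq[OF that] by (cases r; cases "val T s") auto
  show "openin S {s \<in> topspace S. r < opt_value S A q c \<alpha> T s}"
  proof (cases "0 \<le> r + ereal (total_shift T)")
    case True
    then have "{s \<in> topspace S. r < opt_value S A q c \<alpha> T s} = {s \<in> topspace S. e2ennreal (r + ereal (total_shift T)) < val T s}"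
      using enn2ereal_e2ennreal[OF True] by (auto simp: iff less_ennreal.rep_eq)
    then show ?thesis using lsc_val[of T] by (simp add: lsc_def)
  next
    case False
    have "r + ereal (total_shift T) < enn2ereal (val T s)" for s
      using False by (meson enn2ereal_nonneg le_less_trans not_le order_less_le_trans)
    then have "{s \<in> topspace S. r < opt_value S A q c \<alpha> T s} = topspace S" by (auto simp: iff)
    then show ?thesis by simp
  qed
qed

lemma opt_value_tendsto:
  assumes s: "s \<in> topspace S"
  shows "(\<lambda>n. opt_value S A q c \<alpha> (enat n) s) \<longlonglongrightarrow> opt_value S A q c \<alpha> \<infinity> s"
proof -
  have "(\<lambda>n. value_iter n s) \<longlonglongrightarrow> (SUP n. value_iter n s)"
    using value_iter_mono[OF s] by (intro LIMSEQ_SUP) (simp add: incseq_def)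
  then have "(\<lambda>n. enn2ereal (val (enat n) s)) \<longlonglongrightarrow> enn2ereal (val \<infinity> s)"
    by (intro tendsto_enn2erealI) (simp add: val_def)
  moreover have "(\<lambda>n. ereal (total_shift (enat n))) \<longlonglongrightarrow> ereal (total_shift \<infinity>)"
    using total_shift_tendsto by simp
  ultimately show ?thesis unfolding opt_value_eq[OF s] by (intro tendsto_diff_ereal_general) auto
qed

lemma sublevel_shift:
  "enn2ereal x - ereal k \<le> ereal r \<longleftrightarrow> 0 \<le> r + k \<and> x \<le> ennreal (r + k)"
  by (cases x) (auto simp: top_unique ennreal_le_iff2 not_le)

lemma inf_compact_opt_value:
  assumes cc: "inf_compact SA c" and T: "T \<noteq> 0"
  shows "inf_compact S (opt_value S A q c \<alpha> T)"
  unfolding inf_compact_def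
proof
  fix r :: real
  have "compactin SA {p \<in> topspace SA. C p \<le> x}" if x: "x < \<infinity>" for x
  proof -
    obtain y where y: "x = ennreal y" "0 \<le> y" using x by (cases x) auto
    have "{p \<in> topspace SA. C p \<le> x} = {p \<in> topspace SA. c p \<le> ereal (y - b)}"
      using y by (intro Collect_cong conj_cong refl) (simp add: c sublevel_shift)
    then show ?thesis using cc by (simp add: inf_compact_def)
  qed
  from val_inf_compact[OF this T, of "ennreal (r + total_shift T)"]
  have "compactin S {s \<in> topspace S. val T s \<le> ennreal (r + total_shift T)}" by simp
  moreover have "{s \<in> topspace S. opt_value S A q c \<alpha> T s \<le> ereal r} =
      (if 0 \<le> r + total_shift T then {s \<in> topspace S. val T s \<le> ennreal (r + total_shift T)} else {})"
    by (auto simp: opt_value_eq sublevel_shift)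
  ultimately show "compactin S {s \<in> topspace S. opt_value S A q c \<alpha> T s \<le> ereal r}" by simp
qed

lemma K_inf_compact_cost: "K_inf_compact S A c"
  unfolding K_inf_compact_def inf_compact_def
proof (intro allI impI)
  fix K and r :: real assume K: "compactin S K"
  have "{p \<in> topspace (subtopology SA (K \<times> topspace A)). c p \<le> ereal r} =
      (if 0 \<le> r + b then {p \<in> K \<times> topspace A. C p \<le> ennreal (r + b)} else {})"
    using compactin_subset_topspace[OF K] by (auto simp: c sublevel_shift subset_iff)
  moreover have "compactin SA {p \<in> K \<times> topspace A. C p \<le> ennreal (r + b)}"
    using C K by (simp add: K_inf_compact_nn_def)
  ultimately show "compactin (subtopology SA (K \<times> topspace A)) {p \<in> topspace (subtopology SA (K \<times> topspace A)). c p \<le> ereal r}"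
    by (auto simp: compactin_subtopology)
qed

end

section \<open>The belief process\<close>

theorem theorem3p6:
  fixes M :: "('x::polish_space, 'y::polish_space, 'a::polish_space) pomdp"
    and H :: "'x measure \<times> 'a \<times> 'y \<Rightarrow> 'x measure"
    and \<alpha> :: real
  assumes "is_pomdp M"
    and "filter_kernel M H"
    and "assumption_D M \<alpha> \<or> assumption_P M \<alpha>"
    and "K_inf_compact (state_top M) (action_top M) (cost M)"
    and "weakly_continuous (state_top M) (prod_topology (state_top M) (action_top M)) (trans_kernel M)"
    and "tv_continuous (obs_top M) (prod_topology (action_top M) (state_top M)) (obs_kernel M)"
  shows "assumption_W (belief_top M) (action_top M) (belief_kernel M H) (belief_cost M) \<and>
    property_O1 M H \<alpha> \<and> property_O2 M H \<alpha> \<and> property_O3 M H \<alpha> \<and>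
    property_O4 M H \<alpha> \<and> property_O5 M H \<alpha> \<and> property_O6 M H \<alpha>"
proof -
  interpret F: continuous_filter M H
    by standard (use assms in auto)
  note sX = F.sm(1) and sA = F.sm(3)
  have cm: "cost M \<in> borel_measurable (borel_of (prod_topology (state_top M) (action_top M)))"
    using assms(1) by (simp add: is_pomdp_def)
  \<comment> \<open>nonnegative costs take \<open>b = 0\<close>, as \<open>\<alpha> = 1\<close> may occur; otherwise \<open>\<alpha> < 1\<close> and any lower bound will do\<close>
  obtain b where b: "0 \<le> b" "b = 0 \<or> \<alpha> < 1" "0 \<le> \<alpha>"
    and bc: "\<And>x a. x \<in> state_set M \<Longrightarrow> a \<in> action_set M \<Longrightarrow> 0 \<le> cost M (x, a) + ereal b"
    using assms(3)
  proof
    assume D: "assumption_D M \<alpha>"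
    then obtain k where k: "\<And>x a. x \<in> state_set M \<Longrightarrow> a \<in> action_set M \<Longrightarrow> ereal k \<le> cost M (x, a)"
      by (auto simp: assumption_D_def cost_bounded_below_def)
    have "0 \<le> cost M (x, a) + ereal \<bar>k\<bar>" if "x \<in> state_set M" "a \<in> action_set M" for x a
      using k[OF that] by (cases "cost M (x, a)") auto
    with D show ?thesis by (intro that[of "\<bar>k\<bar>"]) (auto simp: assumption_D_def)
  next
    assume "assumption_P M \<alpha>"
    then show ?thesis by (intro that[of 0]) (auto simp: assumption_P_def zero_ereal_def[symmetric])
  qed
  define C where "C p = e2ennreal (cost M p + ereal b)" for p
  have cost_C: "cost M (x, a) = enn2ereal (C (x, a)) - ereal b" if "x \<in> state_set M" "a \<in> action_set M" for x a
    using bc[OF that] by (cases "cost M (x, a)") (auto simp: C_def enn2ereal_e2ennreal)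
  have CK: "K_inf_compact_nn (state_top M) (action_top M) C"
    unfolding K_inf_compact_nn_def
  proof (intro allI impI)
    let ?XA = "prod_topology (state_top M) (action_top M)"
    fix K and r :: ennreal assume Kr: "compactin (state_top M) K \<and> r < \<infinity>"
    then have KX: "K \<subseteq> state_set M" using compactin_subset_topspace by fastforce
    obtain y where y: "r = ennreal y" "0 \<le> y" using Kr by (cases r) auto
    let ?L = "{p \<in> topspace (subtopology ?XA (K \<times> topspace (action_top M))). cost M p \<le> ereal (y - b)}"
    have "compactin (subtopology ?XA (K \<times> topspace (action_top M))) ?L"
      using assms(4) Kr unfolding K_inf_compact_def inf_compact_def by blast
    then have "compactin ?XA ?L" unfolding compactin_subtopology by (rule conjunct1)
    moreover have "?L = {p \<in> K \<times> topspace (action_top M). C p \<le> r}"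
    proof -
      have "cost M p \<le> ereal (y - b) \<longleftrightarrow> C p \<le> r" if "p \<in> K \<times> action_set M" for p
        using that KX y(2) cost_C[of "fst p" "snd p"] by (cases "C p") (auto simp: y(1) top_unique subset_iff)
      then show ?thesis using KX by auto
    qed
    ultimately show "compactin ?XA {p \<in> K \<times> topspace (action_top M). C p \<le> r}" by simp
  qed
  define C' where "C' = (\<lambda>(z, a). \<integral>\<^sup>+x. C (x, a) \<partial>z)"
  have belief_cost: "belief_cost M (z, a) = enn2ereal (C' (z, a)) - ereal b"
    if z: "z \<in> prob_measures (state_top M)" and a: "a \<in> action_set M" for z a
    unfolding belief_cost_def C'_def prod.case
  proof (rule ereal_integral_shift[OF prob_measuresD(1)[OF z] _ b(1)])
    have "(\<lambda>x. (x, a)) \<in> borel_of (state_top M) \<rightarrow>\<^sub>M borel_of (prod_topology (state_top M) (action_top M))"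
      by (rule measurable_continuous_map_borel_of)
        (use a in \<open>auto simp: continuous_map_pairedI intro!: continuous_intros\<close>)
    from measurable_compose[OF this cm] have "(\<lambda>x. cost M (x, a)) \<in> borel_measurable (borel_of (state_top M))" .
    then show "(\<lambda>x. C (x, a)) \<in> borel_measurable z"
      unfolding C_def measurable_cong_sets[OF prob_measuresD(2)[OF z] refl] by measurable
    show "cost M (x, a) = enn2ereal (C (x, a)) - ereal b" if "x \<in> space z" for x
      using cost_C[OF _ a] that prob_measuresD(3)[OF z] by simp
  qed
  interpret S: shifted_mdp "belief_top M" "action_top M" "belief_kernel M H" C' \<alpha> "belief_cost M" b
  proof
    show "separable_metrizable (belief_top M)" by (rule separable_metrizable_weak_topology[OF sX])
    show "topspace (action_top M) \<noteq> {}" using assms(1) by (simp add: is_pomdp_def)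
    show "weakly_continuous (belief_top M) (prod_topology (belief_top M) (action_top M)) (belief_kernel M H)"
      by (rule F.belief_kernel_weakly_continuous)
    show "K_inf_compact_nn (belief_top M) (action_top M) C'"
      unfolding C'_def by (rule K_inf_compact_nn_expectation[OF sX _ CK])
        (use sA in \<open>simp add: separable_metrizable_def\<close>)
    show "belief_cost M p = enn2ereal (C' p) - ereal b" if "p \<in> topspace (belief_top M) \<times> topspace (action_top M)" for p
      using that belief_cost by auto
  qed (use b sA in auto)
  let ?v = "\<lambda>T. comdp_value M H \<alpha> T"
  \<comment> \<open>the shift is carried through the three integrals, since each is taken with a probability measure\<close>
  have iterated: "ereal_integral z (\<lambda>x. ereal_integral (trans_kernel M (x, a)) (\<lambda>x'. ereal_integral (obs_kernel M (a, x'))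
        (\<lambda>y. ?v T (H (z, a, y))))) = ereal_integral (belief_kernel M H (z, a)) (?v T)"
    if z: "z \<in> prob_measures (state_top M)" and a: "a \<in> action_set M" for z a T
  proof -
    have vm: "S.val T \<in> borel_measurable (borel_of (belief_top M))" by (rule lsc_measurable[OF S.lsc_val])
    define g where "g x' = (\<integral>\<^sup>+y. S.val T (H (z, a, y)) \<partial>obs_kernel M (a, x'))" for x'
    define G where "G x = (\<integral>\<^sup>+x'. g x' \<partial>trans_kernel M (x, a))" for x
    have Hm: "(\<lambda>y. S.val T (H (z, a, y))) \<in> borel_measurable (borel_of (obs_top M))"
      by (rule measurable_compose[OF F.H_measurable_belief[OF z a] vm])
    have gm: "g \<in> borel_measurable (borel_of (state_top M))" unfolding g_def
      by (rule measurable_compose[OF measurable_prob_algebraD[OF F.Q_kernel[OF a]] nn_integral_measurable_subprob_algebra[OF Hm]])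
    have Gm: "G \<in> borel_measurable (borel_of (state_top M))" unfolding G_def
      by (rule measurable_compose[OF measurable_prob_algebraD[OF F.P_kernel[OF a]] nn_integral_measurable_subprob_algebra[OF gm]])
    note k = S.total_shift_nonneg[of T]
    have 1: "ereal_integral (obs_kernel M (a, x')) (\<lambda>y. ?v T (H (z, a, y))) = enn2ereal (g x') - ereal (S.total_shift T)"
      if x': "x' \<in> state_set M" for x'
      unfolding g_def
    proof (rule ereal_integral_shift[OF prob_measuresD(1)[OF F.in_prob_measures(2)[OF z a x']] _ k])
      note Q = F.in_prob_measures(2)[OF z a x']
      show "(\<lambda>y. S.val T (H (z, a, y))) \<in> borel_measurable (obs_kernel M (a, x'))"
        unfolding measurable_cong_sets[OF prob_measuresD(2)[OF Q] refl] by (rule Hm)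
      show "?v T (H (z, a, y)) = enn2ereal (S.val T (H (z, a, y))) - ereal (S.total_shift T)"
        if "y \<in> space (obs_kernel M (a, x'))" for y
        using that prob_measuresD(3)[OF Q] F.in_prob_measures(3)[OF z a] by (intro S.opt_value_eq) simp
    qed
    have 2: "ereal_integral (trans_kernel M (x, a)) (\<lambda>x'. ereal_integral (obs_kernel M (a, x')) (\<lambda>y. ?v T (H (z, a, y)))) =
        enn2ereal (G x) - ereal (S.total_shift T)" if x: "x \<in> state_set M" for x
      unfolding G_def
    proof (rule ereal_integral_shift[OF prob_measuresD(1)[OF F.in_prob_measures(1)[OF z a x]] _ k])
      note P = F.in_prob_measures(1)[OF z a x]
      show "g \<in> borel_measurable (trans_kernel M (x, a))"
        unfolding measurable_cong_sets[OF prob_measuresD(2)[OF P] refl] by (rule gm)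
    qed (use 1 prob_measuresD(3)[OF F.in_prob_measures(1)[OF z a x]] in simp)
    have "ereal_integral z (\<lambda>x. ereal_integral (trans_kernel M (x, a)) (\<lambda>x'. ereal_integral (obs_kernel M (a, x'))
        (\<lambda>y. ?v T (H (z, a, y))))) = enn2ereal (\<integral>\<^sup>+x. G x \<partial>z) - ereal (S.total_shift T)"
    proof (rule ereal_integral_shift[OF prob_measuresD(1)[OF z] _ k])
      show "G \<in> borel_measurable z"
        unfolding measurable_cong_sets[OF prob_measuresD(2)[OF z] refl] by (rule Gm)
    qed (use 2 prob_measuresD(3)[OF z] in simp)
    also have "\<dots> = ereal_integral (belief_kernel M H (z, a)) (?v T)"
      using z a by (subst S.integral_opt_value) (simp_all add: F.nn_integral_belief_kernel[OF z a vm] G_def[abs_def] g_def[abs_def])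
    finally show ?thesis .
  qed
  have opt_eq: "optimality_equation M H \<alpha> T" for T
    unfolding optimality_equation_def
  proof (intro conjI ballI impI)
    fix z assume z: "z \<in> prob_measures (state_top M)"
    then have zt: "z \<in> topspace (belief_top M)" by simp
    show "is_attained_min (action_set M) (\<lambda>a. belief_cost M (z, a) + ereal \<alpha> * ereal_integral (belief_kernel M H (z, a)) (?v T)) (?v (eSuc T) z)"
      using S.opt_value_attained[OF zt, of T] by simp
    moreover have "ereal_integral z (\<lambda>x. cost M (x, a)) = belief_cost M (z, a)" for a
      by (simp add: belief_cost_def)
    ultimately show "is_attained_min (action_set M) (\<lambda>a. ereal_integral z (\<lambda>x. cost M (x, a)) +
        ereal \<alpha> * ereal_integral z (\<lambda>x. ereal_integral (trans_kernel M (x, a)) (\<lambda>x'. ereal_integral (obs_kernel M (a, x'))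
          (\<lambda>y. ?v T (H (z, a, y)))))) (?v (eSuc T) z)"
      by (simp add: is_attained_min_def iterated[OF z])
    show "comdp_actions M H \<alpha> T z \<noteq> {}"
      using S.minimizers_nonempty[OF zt] by (simp add: S.opt_actions_eq[OF zt])
    show "comdp_actions M H \<alpha> T z = action_set M" if "?v (eSuc T) z = \<infinity>"
      using S.minimizers_infinite[OF zt] that by (simp add: S.opt_actions_eq[OF zt] S.opt_value_infinite_iff[OF zt])
    show "compact (comdp_actions M H \<alpha> T z)" if "?v (eSuc T) z < \<infinity>"
    proof -
      have "S.val (eSuc T) z < \<infinity>"
        using that S.opt_value_infinite_iff[OF zt, of "eSuc T"] by (auto simp: less_top)
      then show ?thesis
        using S.minimizers_compact[OF zt, of T] by (simp add: S.opt_actions_eq[OF zt] compactin_subtopology)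
    qed
  next
    have "{(z, a). z \<in> prob_measures (state_top M) \<and> a \<in> comdp_actions M H \<alpha> T z} =
        {(z, a). z \<in> topspace (belief_top M) \<and> a \<in> S.minimizers T z}"
      using S.opt_actions_eq by auto
    then show "{(z, a). z \<in> prob_measures (state_top M) \<and> a \<in> comdp_actions M H \<alpha> T z}
        \<in> sets (borel_of (prod_topology (belief_top M) (action_top M)))"
      using S.minimizers_graph by simp
  qed
  have W: "assumption_W (belief_top M) (action_top M) (belief_kernel M H) (belief_cost M)"
    unfolding assumption_W_def using S.K_inf_compact_cost F.belief_kernel_weakly_continuous by blast
  have O1: "property_O1 M H \<alpha>"
    unfolding property_O1_def using S.lower_semicontinuous_opt_value S.opt_value_tendsto by simp
  have O3: "property_O3 M H \<alpha>"
    unfolding property_O3_def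
  proof (intro allI impI conjI)
    fix T :: nat
    show "\<exists>\<phi>. (\<forall>t. \<phi> t \<in> borel_of (belief_top M) \<rightarrow>\<^sub>M borel_of (action_top M)) \<and>
        comdp_optimal M H \<alpha> (enat T) (markov_policy (action_top M) \<phi>)"
      using S.exists_optimal_markov[of T] S.markov_policy_in_policies unfolding S.optimal_policy_iff by blast
    fix \<phi> assume \<phi>: "(\<forall>t. \<phi> t \<in> borel_of (belief_top M) \<rightarrow>\<^sub>M borel_of (action_top M)) \<and>
        (\<forall>z\<in>prob_measures (state_top M). \<forall>t<T. \<phi> (T - 1 - t) z \<in> comdp_actions M H \<alpha> (enat t) z)"
    have "S.policy_cost (enat T) (markov_policy (action_top M) \<phi>) z = S.val (enat T) z" if "z \<in> topspace (belief_top M)" for z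
      using \<phi> S.opt_actions_eq that by (intro S.policy_cost_markov_minimizers) auto
    then show "comdp_optimal M H \<alpha> (enat T) (markov_policy (action_top M) \<phi>)"
      unfolding S.optimal_policy_iff using S.markov_policy_in_policies \<phi> by blast
  qed
  have O5: "property_O5 M H \<alpha>"
    unfolding property_O5_def S.optimal_policy_iff
    using S.exists_optimal_stationary S.policy_cost_stationary_iff S.markov_policy_in_policies S.opt_actions_eq by simp
  have O6: "property_O6 M H \<alpha>"
    unfolding property_O6_def using S.inf_compact_opt_value by (auto simp: zero_enat_def)
  show ?thesis
    using W O1 O3 O5 O6 opt_eq by (simp add: property_O2_def property_O4_def)
qed

end
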